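(* Let $n\ge 1$ be an integer. Let $\mathcal{S}_n$ denote the class of slim semimodular lattices of length $n$, let $\mathcal{S}_n/{\cong}$ be the set of isomorphism classes of members of $\mathcal{S}_n$, and let $\mathcal{D}_n$ be the (finite) set of all planar diagrams of members of $\mathcal{S}_n$, considered up to boundary similarity. Then: (1) For every $\pi\in S_n$, the quotient $G/\beta_\pi$ is a slim semimodular lattice of length $n$ and it has a planar diagram (unique up to boundary similarity) whose left boundary chain is $\{[c_i]_{\beta_\pi}:0\le i\le n\}$ and whose right boundary chain is $\{[d_i]_{\beta_\pi}:0\le i\le n\}$; call it $\phi_0(\pi)$. This gives a well-defined map $\phi_0\colon S_n\to\mathcal{D}_n$. (2) The map $\psi_0\colon\mathcal{D}_n\to S_n$, $D\mapsto\pi_D$, is well defined, and $\phi_0,\psi_0$ are mutually inverse bijections. (3) The map $\phi\colon S_n/\rho_{ie}\to\mathcal{S}_n/{\cong}$, $[\pi]_{\rho_{ie}}\mapsto$ the isomorphism class of $G/\beta_\pi$, and the map $\psi\colon\mathcal{S}_n/{\cong}\to S_n/\rho_{ie}$, sending the isomorphism class of $L$ to $[\pi_D]_{\rho_{ie}}$ where $D$ is an arbitrarily chosen planar diagram of $L$, are well defined, and they are mutually inverse bijections. In particular, slim semimodular lattices of length $n$, up to isomorphism, correspond bijectively to permutations in $S_n$ up to the relation $\rho_{ie}$.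
   Context: A finite lattice $L$ is slim if the set of its join-irreducible elements (including $0$) contains no three-element antichain. $L$ is (upper) semimodular if $a\prec b$ implies $a\vee c\preceq b\vee c$ for all $a,b,c$. Slim lattices are planar. For a planar diagram $D$ of a finite lattice, its left boundary chain and right boundary chain are the maximal chains on the left and right of the boundary of the diagram. Planar diagrams $D_1$ of $M_1$ and $D_2$ of $M_2$ are boundarily similar if there is a lattice isomorphism $M_1\to M_2$ mapping the left (right) boundary chain of $D_1$ onto the left (right) boundary chain of $D_2$; diagrams are considered only up to boundary similarity. Permutation of a diagram: let $D$ be a planar diagram of a slim semimodular lattice $L$ of length $n$, with left boundary chain $0=c_0\prec c_1\prec\dots\prec c_n=1$ and right boundary chain $0=d_0\prec\dots\prec d_n=1$. For $i\in\{1,\dots,n\}$ there is a unique meet-irreducible element $u\ne 1$ of $L$ such that $c_i$ is the smallest element of the left boundary chain not below $u$; then $\pi_D(i)=j$ where $d_j$ is the smallest element of the right boundary chain not below $u$. This $\pi_D$ is a permutation of $\{1,\dots,n\}$. Grid: $G$ is the direct product of two chains $0=c_0\prec\dots\prec c_n$ and $0=d_0\prec\dots\prec d_n$ (identified with the lower left and lower right boundaries of $G$); every element of $G$ is uniquely $c_i\vee d_j$. A join-congruence of $G$ is an equivalence relation compatible with $\vee$. For $\pi\in S_n$, $\beta_\pi$ is the join, in the lattice of join-congruences of $(G;\vee)$, of the smallest join-congruences collapsing $\{c_{i-1}\vee d_{\pi(i)},\,c_i\vee d_{\pi(i)-1},\,c_i\vee d_{\pi(i)}\}$ for $i=1,\dots,n$;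 $G/\beta_\pi$ is a finite join-semilattice with $0$, hence a lattice. Sections: for $\sigma\in S_n$, a subset $I\subseteq\{1,\dots,n\}$ is closed if $\sigma(I)\subseteq I$ ($\emptyset$ is closed). A nonempty interval $I=\{u,\dots,v\}$ of $\{1<\dots<n\}$ is a $\sigma$-section if $\{1,\dots,u-1\}$, $I$, $\{v+1,\dots,n\}$ are all closed; inclusion-minimal sections are $\sigma$-segments, and $\mathrm{Seg}(\sigma)$ is the set of segments. For $\sigma,\mu\in S_n$, $(\sigma,\mu)\in\rho_{ie}$ ("sectionally inverted or equal") iff $\mathrm{Seg}(\sigma)=\mathrm{Seg}(\mu)$ and for every $I\in\mathrm{Seg}(\sigma)$ the restriction $\mu|_I$ equals $\sigma|_I$ or $(\sigma|_I)^{-1}$. $S_n/\rho_{ie}$ is the set of its classes. *)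

theory Defs
  imports "HOL-Analysis.Analysis" "HOL-Combinatorics.Permutations"
begin

definition porder_on :: "'a set \<Rightarrow> ('a \<Rightarrow> 'a \<Rightarrow> bool) \<Rightarrow> bool" where
  "porder_on A le \<longleftrightarrow> (\<forall>x\<in>A. le x x) \<and>
     (\<forall>x\<in>A. \<forall>y\<in>A. le x y \<and> le y x \<longrightarrow> x = y) \<and>
     (\<forall>x\<in>A. \<forall>y\<in>A. \<forall>z\<in>A. le x y \<and> le y z \<longrightarrow> le x z)"

definition is_lub :: "'a set \<Rightarrow> ('a \<Rightarrow> 'a \<Rightarrow> bool) \<Rightarrow> 'a \<Rightarrow> 'a \<Rightarrow> 'a \<Rightarrow> bool" where
  "is_lub A le a b s \<longleftrightarrow> s \<in> A \<and> le a s \<and> le b s \<and> (\<forall>z\<in>A. le a z \<and> le b z \<longrightarrow> le s z)"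

definition is_glb :: "'a set \<Rightarrow> ('a \<Rightarrow> 'a \<Rightarrow> bool) \<Rightarrow> 'a \<Rightarrow> 'a \<Rightarrow> 'a \<Rightarrow> bool" where
  "is_glb A le a b s \<longleftrightarrow> s \<in> A \<and> le s a \<and> le s b \<and> (\<forall>z\<in>A. le z a \<and> le z b \<longrightarrow> le z s)"

definition fin_lattice :: "'a set \<Rightarrow> ('a \<Rightarrow> 'a \<Rightarrow> bool) \<Rightarrow> bool" where
  "fin_lattice A le \<longleftrightarrow> finite A \<and> A \<noteq> {} \<and> porder_on A le \<and>
     (\<forall>a\<in>A. \<forall>b\<in>A. (\<exists>s. is_lub A le a b s) \<and> (\<exists>s. is_glb A le a b s))"

definition ljoin :: "'a set \<Rightarrow> ('a \<Rightarrow> 'a \<Rightarrow> bool) \<Rightarrow> 'a \<Rightarrow> 'a \<Rightarrow> 'a" where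
  "ljoin A le a b = (THE s. is_lub A le a b s)"

definition lmeet :: "'a set \<Rightarrow> ('a \<Rightarrow> 'a \<Rightarrow> bool) \<Rightarrow> 'a \<Rightarrow> 'a \<Rightarrow> 'a" where
  "lmeet A le a b = (THE s. is_glb A le a b s)"

definition ltop :: "'a set \<Rightarrow> ('a \<Rightarrow> 'a \<Rightarrow> bool) \<Rightarrow> 'a" where
  "ltop A le = (THE t. t \<in> A \<and> (\<forall>x\<in>A. le x t))"

definition covers :: "'a set \<Rightarrow> ('a \<Rightarrow> 'a \<Rightarrow> bool) \<Rightarrow> 'a \<Rightarrow> 'a \<Rightarrow> bool" where
  "covers A le a b \<longleftrightarrow> a \<in> A \<and> b \<in> A \<and> le a b \<and> a \<noteq> b \<and>
     (\<forall>c\<in>A. le a c \<and> le c b \<longrightarrow> c = a \<or> c = b)"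

text \<open>join-irreducible elements, 0 included (as in the paper)\<close>
definition join_irr :: "'a set \<Rightarrow> ('a \<Rightarrow> 'a \<Rightarrow> bool) \<Rightarrow> 'a \<Rightarrow> bool" where
  "join_irr A le x \<longleftrightarrow> x \<in> A \<and> (\<forall>a\<in>A. \<forall>b\<in>A. ljoin A le a b = x \<longrightarrow> a = x \<or> b = x)"

definition meet_irr :: "'a set \<Rightarrow> ('a \<Rightarrow> 'a \<Rightarrow> bool) \<Rightarrow> 'a \<Rightarrow> bool" where
  "meet_irr A le x \<longleftrightarrow> x \<in> A \<and> (\<forall>a\<in>A. \<forall>b\<in>A. lmeet A le a b = x \<longrightarrow> a = x \<or> b = x)"

definition slim :: "'a set \<Rightarrow> ('a \<Rightarrow> 'a \<Rightarrow> bool) \<Rightarrow> bool" where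
  "slim A le \<longleftrightarrow> \<not> (\<exists>x y z. join_irr A le x \<and> join_irr A le y \<and> join_irr A le z \<and>
      \<not> le x y \<and> \<not> le y x \<and> \<not> le x z \<and> \<not> le z x \<and> \<not> le y z \<and> \<not> le z y)"

definition semimodular :: "'a set \<Rightarrow> ('a \<Rightarrow> 'a \<Rightarrow> bool) \<Rightarrow> bool" where
  "semimodular A le \<longleftrightarrow> (\<forall>a\<in>A. \<forall>b\<in>A. \<forall>c\<in>A. covers A le a b \<longrightarrow>
      (ljoin A le a c = ljoin A le b c \<or> covers A le (ljoin A le a c) (ljoin A le b c)))"

definition ssl :: "'a set \<Rightarrow> ('a \<Rightarrow> 'a \<Rightarrow> bool) \<Rightarrow> bool" where
  "ssl A le \<longleftrightarrow> fin_lattice A le \<and> slim A le \<and> semimodular A le"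

definition is_chain :: "'a set \<Rightarrow> ('a \<Rightarrow> 'a \<Rightarrow> bool) \<Rightarrow> 'a set \<Rightarrow> bool" where
  "is_chain A le C \<longleftrightarrow> C \<subseteq> A \<and> (\<forall>x\<in>C. \<forall>y\<in>C. le x y \<or> le y x)"

definition maximal_chain :: "'a set \<Rightarrow> ('a \<Rightarrow> 'a \<Rightarrow> bool) \<Rightarrow> 'a set \<Rightarrow> bool" where
  "maximal_chain A le C \<longleftrightarrow> is_chain A le C \<and> (\<forall>D. is_chain A le D \<and> C \<subseteq> D \<longrightarrow> D = C)"

definition lattice_length :: "'a set \<Rightarrow> ('a \<Rightarrow> 'a \<Rightarrow> bool) \<Rightarrow> nat \<Rightarrow> bool" where
  "lattice_length A le n \<longleftrightarrow> (\<exists>C. is_chain A le C \<and> finite C \<and> card C = n + 1) \<and>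
     (\<forall>C. is_chain A le C \<longrightarrow> finite C \<and> card C \<le> n + 1)"

definition lat_iso :: "'a set \<Rightarrow> ('a \<Rightarrow> 'a \<Rightarrow> bool) \<Rightarrow> 'b set \<Rightarrow> ('b \<Rightarrow> 'b \<Rightarrow> bool) \<Rightarrow> ('a \<Rightarrow> 'b) \<Rightarrow> bool" where
  "lat_iso A le B le' f \<longleftrightarrow> bij_betw f A B \<and> (\<forall>x\<in>A. \<forall>y\<in>A. le x y \<longleftrightarrow> le' (f x) (f y))"

definition isomorphic :: "'a set \<Rightarrow> ('a \<Rightarrow> 'a \<Rightarrow> bool) \<Rightarrow> 'b set \<Rightarrow> ('b \<Rightarrow> 'b \<Rightarrow> bool) \<Rightarrow> bool" where
  "isomorphic A le B le' \<longleftrightarrow> (\<exists>f. lat_iso A le B le' f)"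

definition planar_diagram :: "'a set \<Rightarrow> ('a \<Rightarrow> 'a \<Rightarrow> bool) \<Rightarrow> ('a \<Rightarrow> real \<times> real) \<Rightarrow> bool" where
  "planar_diagram A le p \<longleftrightarrow> fin_lattice A le \<and> inj_on p A \<and>
     (\<forall>a b. covers A le a b \<longrightarrow> snd (p a) < snd (p b)) \<and>
     (\<forall>a b c. covers A le a b \<longrightarrow> c \<in> A \<longrightarrow> c \<noteq> a \<longrightarrow> c \<noteq> b \<longrightarrow>
        p c \<notin> closed_segment (p a) (p b)) \<and>
     (\<forall>a b c d. covers A le a b \<longrightarrow> covers A le c d \<longrightarrow> (a, b) \<noteq> (c, d) \<longrightarrow>
        closed_segment (p a) (p b) \<inter> closed_segment (p c) (p d) \<subseteq> p ` ({a, b} \<inter> {c, d}))"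

definition chain_path :: "'a set \<Rightarrow> ('a \<Rightarrow> 'a \<Rightarrow> bool) \<Rightarrow> ('a \<Rightarrow> real \<times> real) \<Rightarrow> 'a set \<Rightarrow> (real \<times> real) set" where
  "chain_path A le p C = \<Union> {closed_segment (p a) (p b) | a b. a \<in> C \<and> b \<in> C \<and> covers A le a b}"

definition left_boundary :: "'a set \<Rightarrow> ('a \<Rightarrow> 'a \<Rightarrow> bool) \<Rightarrow> ('a \<Rightarrow> real \<times> real) \<Rightarrow> 'a set \<Rightarrow> bool" where
  "left_boundary A le p C \<longleftrightarrow> maximal_chain A le C \<and>
     (\<forall>x\<in>A. \<exists>q\<in>chain_path A le p C. snd q = snd (p x) \<and> fst q \<le> fst (p x))"

definition right_boundary :: "'a set \<Rightarrow> ('a \<Rightarrow> 'a \<Rightarrow> bool) \<Rightarrow> ('a \<Rightarrow> real \<times> real) \<Rightarrow> 'a set \<Rightarrow> bool" where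
  "right_boundary A le p C \<longleftrightarrow> maximal_chain A le C \<and>
     (\<forall>x\<in>A. \<exists>q\<in>chain_path A le p C. snd q = snd (p x) \<and> fst (p x) \<le> fst q)"

definition bsim :: "'a set \<Rightarrow> ('a \<Rightarrow> 'a \<Rightarrow> bool) \<Rightarrow> ('a \<Rightarrow> real \<times> real) \<Rightarrow>
                    'b set \<Rightarrow> ('b \<Rightarrow> 'b \<Rightarrow> bool) \<Rightarrow> ('b \<Rightarrow> real \<times> real) \<Rightarrow> bool" where
  "bsim A le p B le' p' \<longleftrightarrow> (\<exists>f CL CR CL' CR'. lat_iso A le B le' f \<and>
      left_boundary A le p CL \<and> right_boundary A le p CR \<and>
      left_boundary B le' p' CL' \<and> right_boundary B le' p' CR' \<and>
      f ` CL = CL' \<and> f ` CR = CR')"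

definition chain_idx :: "('a \<Rightarrow> 'a \<Rightarrow> bool) \<Rightarrow> 'a set \<Rightarrow> 'a \<Rightarrow> nat" where
  "chain_idx le C x = card {y \<in> C. le y x \<and> y \<noteq> x}"

definition first_idx :: "('a \<Rightarrow> 'a \<Rightarrow> bool) \<Rightarrow> 'a set \<Rightarrow> 'a \<Rightarrow> nat" where
  "first_idx le C u = chain_idx le C (THE x. x \<in> C \<and> \<not> le x u \<and> (\<forall>y\<in>C. \<not> le y u \<longrightarrow> le x y))"

text \<open>pi is the permutation pi_D of the diagram D = (A, le, p) of length n
  (including the facts that make pi_D well defined: uniqueness of u and pi_D being a permutation).\<close>
definition perm_of_diagram :: "'a set \<Rightarrow> ('a \<Rightarrow> 'a \<Rightarrow> bool) \<Rightarrow> ('a \<Rightarrow> real \<times> real) \<Rightarrow> nat \<Rightarrow> (nat \<Rightarrow> nat) \<Rightarrow> bool" where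
  "perm_of_diagram A le p n \<pi> \<longleftrightarrow> \<pi> permutes {1..n} \<and>
     (\<exists>CL CR. left_boundary A le p CL \<and> right_boundary A le p CR \<and>
        (\<forall>i\<in>{1..n}. \<exists>!u. meet_irr A le u \<and> u \<noteq> ltop A le \<and> first_idx le CL u = i) \<and>
        (\<forall>u. meet_irr A le u \<and> u \<noteq> ltop A le \<longrightarrow> \<pi> (first_idx le CL u) = first_idx le CR u))"

text \<open>G = chain c_0..c_n times chain d_0..d_n; c_i = (i,0), d_j = (0,j), c_i \<or> d_j = (i,j)\<close>
definition grid :: "nat \<Rightarrow> (nat \<times> nat) set" where
  "grid n = {0..n} \<times> {0..n}"

definition grid_join :: "nat \<times> nat \<Rightarrow> nat \<times> nat \<Rightarrow> nat \<times> nat" where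
  "grid_join x y = (max (fst x) (fst y), max (snd x) (snd y))"

definition join_congruence :: "nat \<Rightarrow> ((nat \<times> nat) \<times> (nat \<times> nat)) set \<Rightarrow> bool" where
  "join_congruence n \<theta> \<longleftrightarrow> equiv (grid n) \<theta> \<and>
     (\<forall>x y z. (x, y) \<in> \<theta> \<longrightarrow> z \<in> grid n \<longrightarrow> (grid_join x z, grid_join y z) \<in> \<theta>)"

definition beta_gens :: "nat \<Rightarrow> (nat \<Rightarrow> nat) \<Rightarrow> ((nat \<times> nat) \<times> (nat \<times> nat)) set" where
  "beta_gens n \<pi> = (\<Union>i\<in>{1..n}.
     {(i - 1, \<pi> i), (i, \<pi> i - 1), (i, \<pi> i)} \<times> {(i - 1, \<pi> i), (i, \<pi> i - 1), (i, \<pi> i)})"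

text \<open>join of the generated join-congruences = smallest join-congruence containing all generators\<close>
definition beta :: "nat \<Rightarrow> (nat \<Rightarrow> nat) \<Rightarrow> ((nat \<times> nat) \<times> (nat \<times> nat)) set" where
  "beta n \<pi> = \<Inter> {\<theta>. join_congruence n \<theta> \<and> beta_gens n \<pi> \<subseteq> \<theta>}"

definition quot_carrier :: "nat \<Rightarrow> (nat \<Rightarrow> nat) \<Rightarrow> (nat \<times> nat) set set" where
  "quot_carrier n \<pi> = grid n // beta n \<pi>"

definition quot_le :: "nat \<Rightarrow> (nat \<Rightarrow> nat) \<Rightarrow> (nat \<times> nat) set \<Rightarrow> (nat \<times> nat) set \<Rightarrow> bool" where
  "quot_le n \<pi> X Y \<longleftrightarrow> (\<exists>x\<in>X. \<exists>y\<in>Y. grid_join x y \<in> Y)"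

definition left_chain_G :: "nat \<Rightarrow> (nat \<Rightarrow> nat) \<Rightarrow> (nat \<times> nat) set set" where
  "left_chain_G n \<pi> = {beta n \<pi> `` {(i, 0)} | i. i \<le> n}"

definition right_chain_G :: "nat \<Rightarrow> (nat \<Rightarrow> nat) \<Rightarrow> (nat \<times> nat) set set" where
  "right_chain_G n \<pi> = {beta n \<pi> `` {(0, i)} | i. i \<le> n}"

definition phi0_diagram :: "nat \<Rightarrow> (nat \<Rightarrow> nat) \<Rightarrow> ((nat \<times> nat) set \<Rightarrow> real \<times> real) \<Rightarrow> bool" where
  "phi0_diagram n \<pi> p \<longleftrightarrow> planar_diagram (quot_carrier n \<pi>) (quot_le n \<pi>) p \<and>
     left_boundary (quot_carrier n \<pi>) (quot_le n \<pi>) p (left_chain_G n \<pi>) \<and>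
     right_boundary (quot_carrier n \<pi>) (quot_le n \<pi>) p (right_chain_G n \<pi>)"

definition closed_set :: "(nat \<Rightarrow> nat) \<Rightarrow> nat set \<Rightarrow> bool" where
  "closed_set \<sigma> I \<longleftrightarrow> \<sigma> ` I \<subseteq> I"

definition is_section :: "nat \<Rightarrow> (nat \<Rightarrow> nat) \<Rightarrow> nat set \<Rightarrow> bool" where
  "is_section n \<sigma> I \<longleftrightarrow> (\<exists>u v. 1 \<le> u \<and> u \<le> v \<and> v \<le> n \<and> I = {u..v} \<and>
     closed_set \<sigma> {1..<u} \<and> closed_set \<sigma> I \<and> closed_set \<sigma> {v+1..n})"

definition Seg :: "nat \<Rightarrow> (nat \<Rightarrow> nat) \<Rightarrow> nat set set" where
  "Seg n \<sigma> = {I. is_section n \<sigma> I \<and> (\<forall>J. is_section n \<sigma> J \<and> J \<subseteq> I \<longrightarrow> J = I)}"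

definition rho_ie :: "nat \<Rightarrow> ((nat \<Rightarrow> nat) \<times> (nat \<Rightarrow> nat)) set" where
  "rho_ie n = {(\<sigma>, \<mu>). \<sigma> permutes {1..n} \<and> \<mu> permutes {1..n} \<and> Seg n \<sigma> = Seg n \<mu> \<and>
     (\<forall>I\<in>Seg n \<sigma>. (\<forall>x\<in>I. \<mu> x = \<sigma> x) \<or> (\<forall>x\<in>I. \<mu> x = inv_into I \<sigma> x))}"

end

theory Submission
  imports Defs
begin

text \<open>
  To \<open>c\<^sub>k \<or> d\<^sub>l\<close> assign the set of indices \<open>m\<close> with \<open>k < m\<close> and \<open>l < \<pi> m\<close>. The kernel of this map is
  \<open>\<beta>\<^sub>\<pi>\<close>, so \<open>G/\<beta>\<^sub>\<pi>\<close> is the family of these sets ordered by reverse inclusion, where semimodularity and the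
  length can be read off from cardinalities. Conversely, if the join-irreducible elements of a semimodular
  lattice lie on two maximal chains, then its meet-irreducible elements are indexed bijectively by either chain,
  and sending an element to the meet-irreducible elements above it identifies the lattice with such a family.

  On the geometric side, an edge of a planar diagram never crosses the path of a maximal chain. Hence a maximal
  chain with the fewest elements to its left is the left boundary, and a join-irreducible element off the boundary
  would be the middle of a three-element antichain of join-irreducible elements. In the other direction, the indices
  of the largest \<open>c\<^sub>k\<close> and \<open>d\<^sub>l\<close> below an element are coordinates of a planar dominance drawing.

  An isomorphism between two such families preserves the chains \<open>c\<close> and \<open>d\<close> on each segment or swaps them there,
  since at an element where the chains differ the continuation of each chain is forced.
\<close>

section \<open>Finite lattices and maximal chains\<close>

text \<open>Why these index sets: a meet-irreducible element other than the top, with left index m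
  and right index \<open>\<pi> m\<close>, lies above \<open>c\<^sub>k\<close> iff k < m and above
  \<open>d\<^sub>l\<close> iff l < \<open>\<pi> m\<close>. So the set attached to an element lists
  the meet-irreducible elements above it. Joins become intersections, while meets are not unions in
  general. The obstacle in the geometry is to give left and right a meaning. Edges ascend strictly,
  so the path of a maximal chain is the graph of a continuous function of the height; sides are
  comparisons of reals, and the intermediate value theorem takes the place of arguments about plane
  curves. A one-element lattice has no edge and hence no boundary path, which is where n \<ge> 1
  enters. For isomorphisms, exchanging the two chains replaces \<pi> by its inverse. An element
  where the chains meet is comparable with everything, so every stretch between two meeting points
  can be flipped on its own; this is what \<open>rho_ie\<close> records. Forcing the continuation of
  a chain takes the isomorphism and its inverse together, since either alone leaves a second
  possibility open.\<close>

locale finlat =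
  fixes A :: "'a set" and le :: "'a \<Rightarrow> 'a \<Rightarrow> bool"
  assumes fin_lattice: "fin_lattice A le"
begin

lemma finite_carrier: "finite A" and carrier_nonempty: "A \<noteq> {}"
  using fin_lattice by (auto simp: fin_lattice_def)

lemma refl: "x \<in> A \<Longrightarrow> le x x"
  and antisym: "le x y \<Longrightarrow> le y x \<Longrightarrow> x \<in> A \<Longrightarrow> y \<in> A \<Longrightarrow> x = y"
  and trans: "le x y \<Longrightarrow> le y z \<Longrightarrow> x \<in> A \<Longrightarrow> y \<in> A \<Longrightarrow> z \<in> A \<Longrightarrow> le x z"
proof -
  have p: "porder_on A le" using fin_lattice by (simp add: fin_lattice_def)
  show "x \<in> A \<Longrightarrow> le x x" using p by (simp add: porder_on_def)
  show "le x y \<Longrightarrow> le y x \<Longrightarrow> x \<in> A \<Longrightarrow> y \<in> A \<Longrightarrow> x = y" using p unfolding porder_on_def by blast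
  show "le x y \<Longrightarrow> le y z \<Longrightarrow> x \<in> A \<Longrightarrow> y \<in> A \<Longrightarrow> z \<in> A \<Longrightarrow> le x z"
    using p unfolding porder_on_def by blast
qed

text \<open>Maximal elements, covers from below, the top and the separation by meet-irreducible
  elements are all obtained by instantiating the locale with the reversed order.\<close>

lemma dual: "finlat A (\<lambda>x y. le y x)"
proof -
  have "porder_on A (\<lambda>x y. le y x)"
    unfolding porder_on_def using refl antisym trans by blast
  moreover have "is_lub A (\<lambda>x y. le y x) = is_glb A le" "is_glb A (\<lambda>x y. le y x) = is_lub A le"
    by (auto simp: fun_eq_iff is_lub_def is_glb_def)
  ultimately show ?thesis using fin_lattice by (simp add: finlat_def fin_lattice_def)
qed

lemma ljoin_eq: "is_lub A le a b s \<Longrightarrow> a \<in> A \<Longrightarrow> b \<in> A \<Longrightarrow> ljoin A le a b = s"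
  unfolding ljoin_def by (rule the_equality) (auto simp: is_lub_def intro: antisym)

lemma is_lub_ljoin:
  assumes "a \<in> A" "b \<in> A" shows "is_lub A le a b (ljoin A le a b)"
proof -
  obtain s where "is_lub A le a b s" using fin_lattice assms by (auto simp: fin_lattice_def)
  then show ?thesis using ljoin_eq assms by metis
qed

lemma join_closed: "a \<in> A \<Longrightarrow> b \<in> A \<Longrightarrow> ljoin A le a b \<in> A"
  and join_ub1: "a \<in> A \<Longrightarrow> b \<in> A \<Longrightarrow> le a (ljoin A le a b)"
  and join_ub2: "a \<in> A \<Longrightarrow> b \<in> A \<Longrightarrow> le b (ljoin A le a b)"
  and join_least: "le a z \<Longrightarrow> le b z \<Longrightarrow> a \<in> A \<Longrightarrow> b \<in> A \<Longrightarrow> z \<in> A \<Longrightarrow> le (ljoin A le a b) z"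
  using is_lub_ljoin by (auto simp: is_lub_def)

lemma join_le_iff:
  "a \<in> A \<Longrightarrow> b \<in> A \<Longrightarrow> z \<in> A \<Longrightarrow> le (ljoin A le a b) z \<longleftrightarrow> le a z \<and> le b z"
  by (meson join_closed join_ub1 join_ub2 join_least trans)

lemma join_absorb: "le a b \<Longrightarrow> a \<in> A \<Longrightarrow> b \<in> A \<Longrightarrow> ljoin A le a b = b"
  by (rule ljoin_eq) (auto simp: is_lub_def refl)

lemma join_commute: "a \<in> A \<Longrightarrow> b \<in> A \<Longrightarrow> ljoin A le a b = ljoin A le b a"
  by (rule ljoin_eq) (auto simp: is_lub_def join_closed join_ub1 join_ub2 join_least)

lemma card_down_less:
  assumes "le x y" "x \<noteq> y" "x \<in> A" "y \<in> A"
  shows "card {z \<in> A. le z x} < card {z \<in> A. le z y}"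
proof (rule psubset_card_mono)
  have "y \<in> {z \<in> A. le z y}" "y \<notin> {z \<in> A. le z x}" using assms refl antisym by auto
  moreover have "{z \<in> A. le z x} \<subseteq> {z \<in> A. le z y}" using assms trans by blast
  ultimately show "{z \<in> A. le z x} \<subset> {z \<in> A. le z y}" by blast
qed (use finite_carrier in simp)

lemma ex_minimal:
  assumes "S \<subseteq> A" "S \<noteq> {}"
  obtains x where "x \<in> S" "\<And>y. y \<in> S \<Longrightarrow> le y x \<Longrightarrow> y = x"
proof -
  obtain x where x: "x \<in> S" "\<forall>y. y \<in> S \<longrightarrow> card {z \<in> A. le z x} \<le> card {z \<in> A. le z y}"
    using ex_has_least_nat[of "\<lambda>x. x \<in> S" _ "\<lambda>x. card {z \<in> A. le z x}"] assms(2) by blast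
  show thesis
  proof (rule that[OF x(1)])
    fix y assume "y \<in> S" "le y x"
    then show "y = x" using x card_down_less[of y x] assms(1) by force
  qed
qed

lemma ex_maximal:
  assumes "S \<subseteq> A" "S \<noteq> {}"
  obtains x where "x \<in> S" "\<And>y. y \<in> S \<Longrightarrow> le x y \<Longrightarrow> y = x"
  by (rule finlat.ex_minimal[OF dual assms]) (rule that)

text \<open>Take j minimal among the elements below a and not below b. If j were a join of two
  smaller elements, minimality would put both below b, and then j as well.\<close>

lemma join_irr_separates:
  assumes "a \<in> A" "b \<in> A" "\<not> le a b"
  obtains j where "join_irr A le j" "le j a" "\<not> le j b"
proof -
  let ?S = "{x \<in> A. le x a \<and> \<not> le x b}"
  obtain j where j: "j \<in> ?S" and min: "\<And>y. y \<in> ?S \<Longrightarrow> le y j \<Longrightarrow> y = j"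
    using ex_minimal[of ?S] assms refl by blast
  have "join_irr A le j"
    unfolding join_irr_def
  proof (intro conjI ballI impI)
    show "j \<in> A" using j by simp
    fix x y assume xy: "x \<in> A" "y \<in> A" "ljoin A le x y = j"
    have xj: "le x j" "le y j" using xy join_ub1 join_ub2 by auto
    then have "le x a" "le y a" using j xy assms trans by blast+
    moreover have "\<not> (le x b \<and> le y b)" using join_least xy j assms by auto
    ultimately have "x \<in> ?S \<or> y \<in> ?S" using xy by auto
    then show "x = j \<or> y = j" using min xj by blast
  qed
  then show thesis using that j by blast
qed

lemma meet_irr_separates:
  assumes "a \<in> A" "b \<in> A" "\<not> le a b"
  obtains u where "meet_irr A le u" "le b u" "\<not> le a u"
proof -
  have "meet_irr A le = join_irr A (\<lambda>x y. le y x)"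
    by (auto simp: fun_eq_iff meet_irr_def join_irr_def lmeet_def ljoin_def is_glb_def is_lub_def)
  then show thesis using finlat.join_irr_separates[OF dual assms(2,1,3)] that by metis
qed

lemma ex_cover_above:
  assumes "le a b" "a \<noteq> b" "a \<in> A" "b \<in> A"
  obtains x where "covers A le a x" "le x b"
proof -
  let ?S = "{x \<in> A. le a x \<and> x \<noteq> a \<and> le x b}"
  obtain x where x: "x \<in> ?S" and min: "\<And>y. y \<in> ?S \<Longrightarrow> le y x \<Longrightarrow> y = x"
    using ex_minimal[of ?S] assms refl by blast
  have "covers A le a x"
    unfolding covers_def
  proof (intro conjI ballI impI)
    fix c assume "c \<in> A" "le a c \<and> le c x"
    then show "c = a \<or> c = x" using min[of c] x trans[of c x b] assms by blast
  qed (use x assms in auto)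
  then show thesis using that x by blast
qed

lemma covers_dual: "covers A (\<lambda>x y. le y x) b a \<longleftrightarrow> covers A le a b"
  by (auto simp: covers_def)

lemma ex_cover_below:
  assumes "le a b" "a \<noteq> b" "a \<in> A" "b \<in> A"
  obtains x where "covers A le x b" "le a x"
  by (rule finlat.ex_cover_above[OF dual, of a b]) (use assms that covers_dual in auto)

lemma ex_bottom: obtains z where "z \<in> A" "\<And>x. x \<in> A \<Longrightarrow> le z x"
proof -
  obtain z where z: "z \<in> A" "\<And>y. y \<in> A \<Longrightarrow> le y z \<Longrightarrow> y = z"
    using ex_minimal[of A] carrier_nonempty by blast
  have "le z x" if "x \<in> A" for x
  proof -
    obtain s where "is_glb A le z x s" using fin_lattice z(1) \<open>x \<in> A\<close> unfolding fin_lattice_def by blast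
    then show ?thesis using z(2)[of s] by (auto simp: is_glb_def)
  qed
  then show thesis using that z(1) by blast
qed

lemma ex_top: obtains z where "z \<in> A" "\<And>x. x \<in> A \<Longrightarrow> le x z"
  by (rule finlat.ex_bottom[OF dual]) (rule that)

lemma ltop_eq: "z \<in> A \<Longrightarrow> (\<And>x. x \<in> A \<Longrightarrow> le x z) \<Longrightarrow> ltop A le = z"
  unfolding ltop_def by (rule the_equality) (auto intro: antisym)

section \<open>Maximal chains and their enumeration\<close>

lemma extend_to_maximal_chain:
  assumes "is_chain A le K"
  obtains C where "maximal_chain A le C" "K \<subseteq> C"
proof -
  have fin: "finite {C. is_chain A le C \<and> K \<subseteq> C}"
    by (rule finite_subset[of _ "Pow A"]) (use finite_carrier in \<open>auto simp: is_chain_def\<close>)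
  have "{C. is_chain A le C \<and> K \<subseteq> C} \<noteq> {}" using assms by auto
  then obtain C where C: "is_chain A le C" "K \<subseteq> C"
    "\<And>D. is_chain A le D \<Longrightarrow> K \<subseteq> D \<Longrightarrow> C \<subseteq> D \<Longrightarrow> D = C"
    using finite_has_maximal[OF fin] by (metis (mono_tags, lifting) mem_Collect_eq)
  have "maximal_chain A le C"
    unfolding maximal_chain_def using C(1,2) C(3)[OF _ order_trans[OF C(2)]] by simp
  then show thesis using that C(2) by simp
qed

lemma maximal_chainD:
  assumes "maximal_chain A le C"
  shows "C \<subseteq> A" "\<And>x y. x \<in> C \<Longrightarrow> y \<in> C \<Longrightarrow> le x y \<or> le y x" "finite C"
    and maximal_chain_memI: "\<And>x. x \<in> A \<Longrightarrow> (\<And>y. y \<in> C \<Longrightarrow> le x y \<or> le y x) \<Longrightarrow> x \<in> C"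
proof -
  show s: "C \<subseteq> A" and c: "\<And>x y. x \<in> C \<Longrightarrow> y \<in> C \<Longrightarrow> le x y \<or> le y x"
    using assms by (auto simp: maximal_chain_def is_chain_def)
  show "finite C" using s finite_carrier finite_subset by blast
  fix x assume x: "x \<in> A" "\<And>y. y \<in> C \<Longrightarrow> le x y \<or> le y x"
  have "is_chain A le (insert x C)" using s c x refl by (auto simp: is_chain_def)
  then show "x \<in> C" using assms unfolding maximal_chain_def by blast
qed

end

text \<open>Lists a maximal chain from bottom to top. Coverings together with the two extreme
  elements already force maximality (\<open>enum_chain_maximal\<close>), and the position in the
  list is the \<open>chain_idx\<close> used for permutations of diagrams
  (\<open>enum_chain_idx\<close>).\<close>

definition enum_chain :: "'a set \<Rightarrow> ('a \<Rightarrow> 'a \<Rightarrow> bool) \<Rightarrow> (nat \<Rightarrow> 'a) \<Rightarrow> nat \<Rightarrow> bool" where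
  "enum_chain A le c m \<longleftrightarrow> (\<forall>i\<le>m. c i \<in> A) \<and> (\<forall>i\<le>m. \<forall>j\<le>m. le (c i) (c j) \<longleftrightarrow> i \<le> j) \<and>
     (\<forall>i<m. covers A le (c i) (c (Suc i))) \<and> (\<forall>x\<in>A. le (c 0) x \<and> le x (c m))"

lemma enum_chainD:
  assumes "enum_chain A le c m"
  shows "\<And>i. i \<le> m \<Longrightarrow> c i \<in> A" "\<And>i j. i \<le> m \<Longrightarrow> j \<le> m \<Longrightarrow> le (c i) (c j) \<longleftrightarrow> i \<le> j"
    "\<And>i. i < m \<Longrightarrow> covers A le (c i) (c (Suc i))"
    "\<And>x. x \<in> A \<Longrightarrow> le (c 0) x" "\<And>x. x \<in> A \<Longrightarrow> le x (c m)"
  using assms by (auto simp: enum_chain_def)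

context finlat begin

lemma enum_chain_inj:
  assumes "enum_chain A le c m" shows "inj_on c {..m}"
proof (rule inj_onI)
  fix i j assume "i \<in> {..m}" "j \<in> {..m}" "c i = c j"
  then show "i = j" using enum_chainD(2)[OF assms, of i j] enum_chainD(2)[OF assms, of j i]
      enum_chainD(2)[OF assms, of i i] by simp
qed

lemma enum_chain_idx:
  assumes "enum_chain A le c m" "i \<le> m" shows "chain_idx le (c ` {..m}) (c i) = i"
proof -
  note le = enum_chainD(2)[OF assms(1)]
  have "{y \<in> c ` {..m}. le y (c i) \<and> y \<noteq> c i} = c ` {..<i}"
  proof -
    have "y \<in> c ` {..<i}" if "y \<in> c ` {..m}" "le y (c i)" "y \<noteq> c i" for y
    proof -
      obtain j where j: "y = c j" "j \<le> m" using \<open>y \<in> c ` {..m}\<close> by auto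
      then have "j \<le> i" "j \<noteq> i" using le that assms(2) by auto
      then show ?thesis using j by auto
    qed
    moreover have "c j \<noteq> c i \<and> le (c j) (c i)" if "j < i" for j
      using le[of j i] le[of i j] le[of i i] that assms(2) by force
    ultimately show ?thesis using assms(2) by auto
  qed
  moreover have "inj_on c {..<i}"
    by (rule inj_on_subset[OF enum_chain_inj[OF assms(1)]]) (use assms(2) in auto)
  ultimately show ?thesis unfolding chain_idx_def by (simp add: card_image)
qed

text \<open>The rank \<open>chain_idx\<close> is strictly monotone on C, hence a bijection onto an
  initial segment of the naturals, and its inverse is the enumeration. An element between two
  neighbours is comparable with all of C and so belongs to C, which gives the coverings.\<close>

lemma maximal_chain_enum:
  assumes C: "maximal_chain A le C"
  obtains c m where "enum_chain A le c m" "C = c ` {..m}"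
proof -
  note CA = maximal_chainD(1)[OF C] and lin = maximal_chainD(2)[OF C] and fin = maximal_chainD(3)[OF C]
  let ?r = "chain_idx le C"
  have less: "?r x < ?r y" if "x \<in> C" "y \<in> C" "le x y" "x \<noteq> y" for x y
    unfolding chain_idx_def
  proof (rule psubset_card_mono)
    show "finite {z \<in> C. le z y \<and> z \<noteq> y}" using fin by simp
    have "x \<in> {z \<in> C. le z y \<and> z \<noteq> y}" using that by simp
    moreover have "{z \<in> C. le z x \<and> z \<noteq> x} \<subseteq> {z \<in> C. le z y \<and> z \<noteq> y}"
      using that CA trans antisym by blast
    ultimately show "{z \<in> C. le z x \<and> z \<noteq> x} \<subset> {z \<in> C. le z y \<and> z \<noteq> y}" by blast
  qed
  have inj: "inj_on ?r C" using less lin unfolding inj_on_def by (metis less_irrefl)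
  obtain z where z: "z \<in> A" "\<And>x. x \<in> A \<Longrightarrow> le z x" using ex_bottom by blast
  obtain t where t: "t \<in> A" "\<And>x. x \<in> A \<Longrightarrow> le x t" using ex_top by blast
  have zC: "z \<in> C" and tC: "t \<in> C" using maximal_chain_memI[OF C] z t CA by blast+
  define m where "m = card C - 1"
  have cardC: "card C = Suc m"
  proof -
    have "card C \<noteq> 0" using zC fin by auto
    then show ?thesis by (simp add: m_def)
  qed
  have "?r x \<le> m" if "x \<in> C" for x
  proof -
    have "?r x \<le> card (C - {x})" unfolding chain_idx_def by (rule card_mono) (use fin in auto)
    then show ?thesis using cardC that fin by simp
  qed
  then have "?r ` C \<subseteq> {..m}" by auto
  then have img: "?r ` C = {..m}"
    by (rule card_subset_eq[rotated]) (simp_all add: card_image[OF inj] cardC)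
  define c where "c = inv_into C ?r"
  have c: "c i \<in> C" "?r (c i) = i" if "i \<le> m" for i
    using that img inv_into_into[of i ?r C] f_inv_into_f[of i ?r C] unfolding c_def by auto
  have cr: "c (?r x) = x" "?r x \<le> m" if "x \<in> C" for x
    using that inj img unfolding c_def by (auto simp: inv_into_f_f)
  have le_iff: "le (c i) (c j) \<longleftrightarrow> i \<le> j" if "i \<le> m" "j \<le> m" for i j
  proof -
    have "c i = c j \<longleftrightarrow> i = j" using c that by metis
    moreover have "le (c i) (c i)" using c that CA refl by blast
    moreover have "c i \<noteq> c j \<Longrightarrow> le (c i) (c j) \<Longrightarrow> i < j" "c i \<noteq> c j \<Longrightarrow> le (c j) (c i) \<Longrightarrow> j < i"
      using less[of "c i" "c j"] less[of "c j" "c i"] c that by auto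
    moreover have "le (c i) (c j) \<or> le (c j) (c i)" using lin c that by blast
    ultimately show ?thesis by (cases "i = j") auto
  qed
  have cov: "covers A le (c i) (c (Suc i))" if "i < m" for i
    unfolding covers_def
  proof (intro conjI ballI impI)
    show "c i \<in> A" "c (Suc i) \<in> A" using c that CA by auto
    show "le (c i) (c (Suc i))" using le_iff that by simp
    show "c i \<noteq> c (Suc i)" using le_iff[of "Suc i" i] le_iff[of i i] that by force
    fix x assume x: "x \<in> A" "le (c i) x \<and> le x (c (Suc i))"
    have "x \<in> C"
    proof (rule maximal_chain_memI[OF C x(1)])
      fix y assume y: "y \<in> C"
      define j where "j = ?r y"
      have j: "y = c j" "j \<le> m" using cr y j_def by auto
      show "le x y \<or> le y x"
      proof (cases "j \<le> i")
        case True
        then have "le y (c i)" using j that le_iff by simp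
        then show ?thesis using x trans[of y "c i" x] CA y c(1)[of i] that by auto
      next
        case False
        then have "le (c (Suc i)) y" using j that le_iff by simp
        then show ?thesis using x trans[of x "c (Suc i)" y] CA y c(1)[of "Suc i"] that by auto
      qed
    qed
    then obtain k where k: "x = c k" "k \<le> m" using cr by metis
    then have "i \<le> k" "k \<le> Suc i" using x le_iff that by auto
    then show "x = c i \<or> x = c (Suc i)" using k by (metis le_Suc_eq le_antisym)
  qed
  have c0: "c 0 = z" using cr[OF zC] le_iff[of "?r z" 0] z(2) c(1)[of 0] CA by auto
  have cm: "c m = t" using cr[OF tC] le_iff[of m "?r t"] t(2) c(1)[of m] CA by auto
  have "enum_chain A le c m"
    unfolding enum_chain_def using c CA le_iff cov c0 cm z t by auto
  moreover have "C = c ` {..m}"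
  proof
    show "C \<subseteq> c ` {..m}" using cr by (metis atMost_iff imageI subsetI)
    show "c ` {..m} \<subseteq> C" using c by auto
  qed
  ultimately show thesis using that by blast
qed

lemma enum_chain_locate:
  assumes c: "enum_chain A le c m" and x: "x \<in> A"
  obtains k where "k \<le> m" "\<And>i. i \<le> m \<Longrightarrow> le (c i) x \<longleftrightarrow> i \<le> k"
proof -
  let ?S = "{i. i \<le> m \<and> le (c i) x}"
  have "0 \<in> ?S" using enum_chainD(4)[OF c x] by simp
  then have M: "Max ?S \<in> ?S" by (intro Max_in) auto
  have "le (c i) x \<longleftrightarrow> i \<le> Max ?S" if "i \<le> m" for i
  proof
    assume "le (c i) x" then show "i \<le> Max ?S" using that by (intro Max_ge) auto
  next
    assume "i \<le> Max ?S"
    then have "le (c i) (c (Max ?S))" using that M enum_chainD(2)[OF c] by simp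
    then show "le (c i) x" using M trans[of "c i" "c (Max ?S)" x] enum_chainD(1)[OF c] that x by auto
  qed
  then show thesis using that M by blast
qed

lemma enum_chain_first_idx:
  assumes c: "enum_chain A le c m" and u: "u \<in> A" "k < m" "le (c k) u" "\<not> le (c (Suc k)) u"
  shows "first_idx le (c ` {..m}) u = Suc k"
proof -
  obtain k' where k': "\<And>i. i \<le> m \<Longrightarrow> le (c i) u \<longleftrightarrow> i \<le> k'" using enum_chain_locate[OF c u(1)] by blast
  have "k' = k" using k'[of k] k'[of "Suc k"] u by auto
  note le = enum_chainD(2)[OF c]
  have "(THE x. x \<in> c ` {..m} \<and> \<not> le x u \<and> (\<forall>y\<in>c ` {..m}. \<not> le y u \<longrightarrow> le x y)) = c (Suc k)"
  proof (rule the_equality)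
    show "c (Suc k) \<in> c ` {..m} \<and> \<not> le (c (Suc k)) u \<and> (\<forall>y\<in>c ` {..m}. \<not> le y u \<longrightarrow> le (c (Suc k)) y)"
      using u k' \<open>k' = k\<close> le by auto
    fix x assume x: "x \<in> c ` {..m} \<and> \<not> le x u \<and> (\<forall>y\<in>c ` {..m}. \<not> le y u \<longrightarrow> le x y)"
    then obtain i where i: "x = c i" "i \<le> m" by auto
    have "le x (c (Suc k))" using x u by auto
    then have "i \<le> Suc k" using i le u by auto
    moreover have "\<not> i \<le> k" using x i k' \<open>k' = k\<close> by auto
    ultimately show "x = c (Suc k)" using i by (simp add: le_Suc_eq)
  qed
  then show ?thesis unfolding first_idx_def using enum_chain_idx[OF c, of "Suc k"] u by simp
qed

lemma enum_chain_first_idx_iff: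
  assumes c: "enum_chain A le c m" and u: "u \<in> A" "u \<noteq> ltop A le"
  obtains k where "k < m" "first_idx le (c ` {..m}) u = Suc k" "\<And>i. i \<le> m \<Longrightarrow> le (c i) u \<longleftrightarrow> i \<le> k"
proof -
  obtain k where k: "k \<le> m" "\<And>i. i \<le> m \<Longrightarrow> le (c i) u \<longleftrightarrow> i \<le> k" using enum_chain_locate[OF c u(1)] by blast
  have "ltop A le = c m" using ltop_eq enum_chainD[OF c] by auto
  then have "k \<noteq> m" using k u antisym[of u "c m"] enum_chainD[OF c] by auto
  then have "k < m" using k by simp
  moreover have "first_idx le (c ` {..m}) u = Suc k"
    by (rule enum_chain_first_idx[OF c u(1) \<open>k < m\<close>]) (use k \<open>k < m\<close> in auto)
  ultimately show thesis using that k by blast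
qed

end

section \<open>Grid families and the quotient\<close>

text \<open>Abstracts from permutations so that the two chains play symmetric roles and can be
  exchanged. The cardinalities say that each step along a chain removes exactly one point. The
  common largest set \<open>c 0 = d 0\<close> is the bottom of the reversed order, and both chains
  end in the empty set, the top.\<close>

locale grid_family =
  fixes n :: nat and F :: "'s set set" and c d :: "nat \<Rightarrow> 's set"
  assumes F_eq: "F = {c i \<inter> d j | i j. i \<le> n \<and> j \<le> n}"
    and c_anti: "i \<le> j \<Longrightarrow> j \<le> n \<Longrightarrow> c j \<subseteq> c i" and d_anti: "i \<le> j \<Longrightarrow> j \<le> n \<Longrightarrow> d j \<subseteq> d i"
    and card_c: "i \<le> n \<Longrightarrow> card (c i) = n - i" and card_d: "i \<le> n \<Longrightarrow> card (d i) = n - i"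
    and finite_c0: "finite (c 0)" and c0_eq_d0: "c 0 = d 0"
begin

lemma swap: "grid_family n F d c"
proof
  show "F = {d i \<inter> c j | i j. i \<le> n \<and> j \<le> n}" unfolding F_eq by blast
qed (simp_all add: c_anti d_anti card_c card_d finite_c0 c0_eq_d0[symmetric])

lemma finite_c: "i \<le> n \<Longrightarrow> finite (c i)" and finite_d: "i \<le> n \<Longrightarrow> finite (d i)"
  using c_anti[of 0 i] d_anti[of 0 i] finite_c0 c0_eq_d0 by (auto intro: finite_subset)

lemma c_in: "i \<le> n \<Longrightarrow> c i \<in> F" and d_in: "i \<le> n \<Longrightarrow> d i \<in> F"
proof -
  assume i: "i \<le> n"
  have "c i = c i \<inter> d 0" "d i = c 0 \<inter> d i" using i c_anti[of 0 i] d_anti[of 0 i] c0_eq_d0 by auto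
  then show "c i \<in> F" "d i \<in> F" unfolding F_eq using i by blast+
qed

lemma finite_F: "finite F"
proof -
  have "F = (\<lambda>(i, j). c i \<inter> d j) ` ({..n} \<times> {..n})" unfolding F_eq by auto
  then show ?thesis by simp
qed

lemma finite_mem: "X \<in> F \<Longrightarrow> finite X"
  unfolding F_eq using finite_c by auto

lemma inter_closed:
  assumes "X \<in> F" "Y \<in> F" shows "X \<inter> Y \<in> F"
proof -
  obtain i j k l where ij: "X = c i \<inter> d j" "Y = c k \<inter> d l" "i \<le> n" "j \<le> n" "k \<le> n" "l \<le> n"
    using assms unfolding F_eq by blast
  have "c i \<inter> c k = c (max i k)" "d j \<inter> d l = d (max j l)"
    using ij c_anti[of i k] c_anti[of k i] d_anti[of j l] d_anti[of l j]
    by (auto simp: max_def)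
  then have "X \<inter> Y = c (max i k) \<inter> d (max j l)" using ij by blast
  then show ?thesis unfolding F_eq using ij by (metis (mono_tags, lifting) max.bounded_iff mem_Collect_eq)
qed

lemma c_step: assumes "i < n" obtains m where "c i = insert m (c (Suc i))" "m \<notin> c (Suc i)"
proof -
  have "card (c i - c (Suc i)) = 1"
    using assms card_Diff_subset[of "c (Suc i)" "c i"] finite_c c_anti[of i "Suc i"] card_c by simp
  then obtain m where "c i - c (Suc i) = {m}" by (auto simp: card_1_singleton_iff)
  then show thesis using that[of m] c_anti[of i "Suc i"] assms by auto
qed

text \<open>Each step along c removes at most one point from the intersection with
  \<open>d l\<close>. At the first step where the intersection changes, it loses exactly one
  point.\<close>

lemma drop_along_c:
  assumes "i \<le> k" "k \<le> n" "l \<le> n" "c k \<inter> d l \<noteq> c i \<inter> d l"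
  shows "\<exists>Z\<in>F. c k \<inter> d l \<subseteq> Z \<and> Z \<subset> c i \<inter> d l \<and> card (c i \<inter> d l) = Suc (card Z)"
  using assms(1,2,4)
proof (induction k rule: dec_induct)
  case base then show ?case by simp
next
  case (step k)
  show ?case
  proof (cases "c k \<inter> d l = c i \<inter> d l")
    case False
    then obtain Z where "Z \<in> F" "c k \<inter> d l \<subseteq> Z" "Z \<subset> c i \<inter> d l" "card (c i \<inter> d l) = Suc (card Z)"
      using step by auto
    moreover have "c (Suc k) \<subseteq> c k" using c_anti[of k "Suc k"] step by simp
    ultimately show ?thesis by blast
  next
    case True
    obtain m where m: "c k = insert m (c (Suc k))" "m \<notin> c (Suc k)" using c_step[of k] step by auto
    have ins: "c i \<inter> d l = insert m (c (Suc k) \<inter> d l)" using True m step.prems by auto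
    moreover have "finite (c (Suc k) \<inter> d l)" using finite_c step by auto
    ultimately have "card (c i \<inter> d l) = Suc (card (c (Suc k) \<inter> d l))" using m by simp
    moreover have "c (Suc k) \<inter> d l \<in> F" unfolding F_eq using step.prems assms(3) by blast
    ultimately show ?thesis using ins step.prems by blast
  qed
qed

text \<open>The source of all cardinality arguments: the family is graded by cardinality. Y can be
  written as \<open>c k \<inter> d l\<close> with both indices at least those of X, and of the two
  legs from X to \<open>c k \<inter> d j\<close> and on to Y at least one is proper; its first drop
  is the required Z.\<close>

lemma drop_one:
  assumes "X \<in> F" "Y \<in> F" "Y \<subset> X"
  obtains Z where "Z \<in> F" "Y \<subseteq> Z" "Z \<subset> X" "card X = Suc (card Z)"
proof -
  obtain i j i' j' where ij: "X = c i \<inter> d j" "Y = c i' \<inter> d j'" "i \<le> n" "j \<le> n" "i' \<le> n" "j' \<le> n"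
    using assms unfolding F_eq by blast
  define k where "k = max i i'"
  define l where "l = max j j'"
  have kl: "i \<le> k" "k \<le> n" "j \<le> l" "l \<le> n" using ij by (auto simp: k_def l_def)
  have "c i \<inter> c i' = c k" "d j \<inter> d j' = d l"
    using ij c_anti[of i i'] c_anti[of i' i] d_anti[of j j'] d_anti[of j' j]
    by (auto simp: max_def k_def l_def)
  then have Y: "Y = c k \<inter> d l" using ij assms by blast
  show thesis
  proof (cases "c k \<inter> d j = c i \<inter> d j")
    case False
    from drop_along_c[OF kl(1,2) ij(4) False] obtain Z where
      "Z \<in> F" "c k \<inter> d j \<subseteq> Z" "Z \<subset> X" "card X = Suc (card Z)" using ij by auto
    moreover have "Y \<subseteq> c k \<inter> d j" using Y d_anti[of j l] kl by auto
    ultimately show ?thesis using that by blast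
  next
    case True
    interpret s: grid_family n F d c by (rule swap)
    have "d l \<inter> c k \<noteq> d j \<inter> c k" using True Y assms ij by auto
    from s.drop_along_c[OF kl(3,4,2) this] True obtain Z where
      "Z \<in> F" "Y \<subseteq> Z" "Z \<subset> X" "card X = Suc (card Z)" using ij Y by (auto simp: Int_commute)
    then show ?thesis using that by blast
  qed
qed

lemma card_le: "X \<in> F \<Longrightarrow> card X \<le> n"
  unfolding F_eq using card_mono[OF finite_c0] card_c[of 0] c_anti[of 0] by (auto simp: le_infI1)

end

section \<open>Lattices isomorphic to a grid family\<close>

locale grid_rep = grid_family n F c d for n and F :: "'s set set" and c d +
  fixes A :: "'a set" and le :: "'a \<Rightarrow> 'a \<Rightarrow> bool" and g :: "'a \<Rightarrow> 's set"
  assumes iso: "lat_iso A le F (\<supseteq>) g"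
begin

lemma rep_swap: "grid_rep n F d c A le g"
  using swap iso by (simp add: grid_rep_def grid_rep_axioms_def)

lemma g_in: "a \<in> A \<Longrightarrow> g a \<in> F"
  and g_eq: "a \<in> A \<Longrightarrow> b \<in> A \<Longrightarrow> g a = g b \<longleftrightarrow> a = b"
  and g_le: "a \<in> A \<Longrightarrow> b \<in> A \<Longrightarrow> le a b \<longleftrightarrow> g b \<subseteq> g a"
  using iso by (auto simp: lat_iso_def bij_betw_def inj_on_def)

lemma g_surj: assumes "X \<in> F" obtains a where "a \<in> A" "g a = X"
  using iso assms that by (auto simp: lat_iso_def bij_betw_def)

lemma is_lub_iff: "a \<in> A \<Longrightarrow> b \<in> A \<Longrightarrow> s \<in> A \<Longrightarrow> g s = g a \<inter> g b \<Longrightarrow> is_lub A le a b s"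
  by (auto simp: is_lub_def g_le)

lemma rep_fin_lattice: "fin_lattice A le"
  unfolding fin_lattice_def
proof (intro conjI ballI)
  show "finite A" using iso finite_F by (auto simp: lat_iso_def dest: bij_betw_finite)
  show "A \<noteq> {}" using g_surj[OF c_in[of 0]] by auto
  show "porder_on A le" unfolding porder_on_def by (auto simp: g_le g_eq[symmetric])
  fix a b assume ab: "a \<in> A" "b \<in> A"
  obtain s where "s \<in> A" "g s = g a \<inter> g b" using g_surj inter_closed ab g_in by metis
  then show "\<exists>s. is_lub A le a b s" using is_lub_iff ab by blast
  \<comment> \<open>The union of the two sets need not belong to F. The meet is the least member
    containing both, found as a containing member of least cardinality; it is least because F is
    closed under intersection.\<close>
  define S where "S = {X \<in> F. g a \<union> g b \<subseteq> X}"
  have "X \<subseteq> c 0" if "X \<in> F" for X using that c_anti[of 0] unfolding F_eq by blast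
  then have "c 0 \<in> S" using ab g_in c_in[of 0] unfolding S_def by blast
  then obtain Z where Z: "Z \<in> S" "\<And>X. X \<in> S \<Longrightarrow> card Z \<le> card X"
    using ex_has_least_nat[of "\<lambda>X. X \<in> S" _ card] by blast
  have sub: "Z \<subseteq> X" if "X \<in> S" for X
  proof -
    have "Z \<inter> X \<in> S" using that Z(1) inter_closed unfolding S_def by blast
    then have "card Z \<le> card (Z \<inter> X)" using Z(2) by blast
    then have "Z \<inter> X = Z" using card_seteq[of Z "Z \<inter> X"] finite_mem Z(1) unfolding S_def by auto
    then show ?thesis by auto
  qed
  obtain s where s: "s \<in> A" "g s = Z" using g_surj Z(1) S_def by auto
  have "is_glb A le a b s"
    unfolding is_glb_def using s ab Z(1) sub g_in by (auto simp: g_le S_def)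
  then show "\<exists>s. is_glb A le a b s" by blast
qed

sublocale finlat A le by unfold_locales (rule rep_fin_lattice)

lemma g_join:
  assumes ab: "a \<in> A" "b \<in> A" shows "g (ljoin A le a b) = g a \<inter> g b"
proof -
  obtain s where s: "s \<in> A" "g s = g a \<inter> g b" using g_surj inter_closed ab g_in by metis
  then show ?thesis using ljoin_eq[OF is_lub_iff] ab by auto
qed

lemma coversI:
  assumes "a \<in> A" "b \<in> A" "g b \<subseteq> g a" "card (g a) = Suc (card (g b))" shows "covers A le a b"
  unfolding covers_def
proof (intro conjI ballI impI)
  show "le a b" "a \<noteq> b" using assms g_le by auto
  fix z assume z: "z \<in> A" "le a z \<and> le z b"
  then have sub: "g b \<subseteq> g z" "g z \<subseteq> g a" using assms g_le by auto
  have "finite (g a)" "finite (g z)" using assms z finite_mem g_in by auto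
  then have "card (g b) \<le> card (g z)" "card (g z) \<le> card (g a)" using sub by (auto intro: card_mono)
  then have "g z = g a \<or> g z = g b"
    using assms(4) card_subset_eq[OF \<open>finite (g a)\<close> sub(2)] card_subset_eq[OF \<open>finite (g z)\<close> sub(1)]
    by (cases "card (g z) = card (g a)") auto
  then show "z = a \<or> z = b" using g_eq z assms by auto
qed (use assms in auto)

text \<open>\<open>drop_one\<close> places a member with one point fewer between the two sets, and
  the covering forces it to be \<open>g b\<close>.\<close>

lemma coversD:
  assumes "covers A le a b" shows "card (g a) = Suc (card (g b))" "g b \<subset> g a"
proof -
  have ab: "a \<in> A" "b \<in> A" "g b \<subseteq> g a" "a \<noteq> b" using assms g_le by (auto simp: covers_def)
  then show "g b \<subset> g a" using g_eq by blast
  then obtain Z where Z: "Z \<in> F" "g b \<subseteq> Z" "Z \<subset> g a" "card (g a) = Suc (card Z)"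
    using drop_one[of "g a" "g b"] ab g_in by metis
  obtain z where z: "z \<in> A" "g z = Z" using g_surj Z(1) by auto
  have "z = a \<or> z = b" using assms z Z ab g_le unfolding covers_def by auto
  then show "card (g a) = Suc (card (g b))" using z Z by auto
qed

text \<open>The sets of a and b differ in a single point m. Joining with x intersects both with
  \<open>g x\<close>, after which they differ at most in m.\<close>

lemma rep_semimodular: "semimodular A le"
  unfolding semimodular_def
proof (intro ballI impI)
  fix a b x assume abx: "a \<in> A" "b \<in> A" "x \<in> A" and cov: "covers A le a b"
  have fin: "finite (g a)" using finite_mem g_in abx by auto
  note D = coversD[OF cov]
  have "card (g a - g b) = 1" using D fin card_Diff_subset[of "g b" "g a"] finite_subset by fastforce
  then obtain m where m: "g a - g b = {m}" by (auto simp: card_1_singleton_iff)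
  let ?j = "ljoin A le a x" and ?k = "ljoin A le b x"
  have jk: "?j \<in> A" "?k \<in> A" using join_closed abx by auto
  show "?j = ?k \<or> covers A le ?j ?k"
  proof (cases "m \<in> g x")
    case False
    moreover have "g a = insert m (g b)" using m D(2) by auto
    ultimately have "g a \<inter> g x = g b \<inter> g x" by auto
    then have "g ?j = g ?k" using g_join abx by simp
    then show ?thesis using g_eq jk by auto
  next
    case True
    then have "g a \<inter> g x = insert m (g b \<inter> g x)" "m \<notin> g b \<inter> g x" using m D(2) by auto
    then have "g ?j = insert m (g ?k)" "m \<notin> g ?k" using g_join abx by simp_all
    moreover have "finite (g ?k)" using finite_mem g_in jk by auto
    ultimately show ?thesis using coversI[OF jk] by auto
  qed
qed

text \<open>Cardinality is injective on every chain and takes values in 0..n; the chain c attains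
  all of them.\<close>

lemma rep_lattice_length: "lattice_length A le n"
  unfolding lattice_length_def
proof (intro conjI allI impI)
  let ?C = "inv_into A g ` c ` {..n}"
  have gA: "g ` A = F" using iso by (simp add: lat_iso_def bij_betw_def)
  have inv: "inv_into A g X \<in> A" "g (inv_into A g X) = X" if "X \<in> F" for X
    using that gA inv_into_into[of X g A] f_inv_into_f[of X g A] by auto
  have "inj_on c {..n}" by (rule inj_onI) (metis atMost_iff card_c diff_diff_cancel)
  moreover have "inj_on (inv_into A g) (c ` {..n})"
    by (rule inj_on_subset[OF inj_on_inv_into[of F]]) (use gA c_in in auto)
  ultimately have "card ?C = n + 1" by (simp add: card_image)
  moreover have "is_chain A le ?C" unfolding is_chain_def
  proof (intro conjI ballI)
    show "?C \<subseteq> A" using inv c_in by auto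
    fix x y assume "x \<in> ?C" "y \<in> ?C"
    then obtain i j where "i \<le> n" "j \<le> n" "x = inv_into A g (c i)" "y = inv_into A g (c j)" by auto
    then show "le x y \<or> le y x" using inv c_in g_le c_anti[of i j] c_anti[of j i] by (cases "i \<le> j") auto
  qed
  ultimately show "\<exists>C. is_chain A le C \<and> finite C \<and> card C = n + 1" by blast
  fix K assume K: "is_chain A le K"
  then have KA: "K \<subseteq> A" by (auto simp: is_chain_def)
  show "finite K" using KA finite_carrier finite_subset by blast
  have "inj_on (\<lambda>x. card (g x)) K"
  proof (rule inj_onI)
    fix x y assume xy: "x \<in> K" "y \<in> K" "card (g x) = card (g y)"
    then have "g x \<subseteq> g y \<or> g y \<subseteq> g x" using K KA g_le unfolding is_chain_def by blast
    then have "g x = g y" using xy KA card_subset_eq finite_mem g_in by (metis subsetD)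
    then show "x = y" using g_eq xy KA by blast
  qed
  moreover have "(\<lambda>x. card (g x)) ` K \<subseteq> {..n}" using card_le g_in KA by auto
  ultimately have "card K \<le> card {..n}" by (intro card_inj_on_le) auto
  then show "card K \<le> n + 1" by simp
qed

lemma rep_enum_chain:
  assumes "\<And>i. i \<le> n \<Longrightarrow> e i \<in> A" "\<And>i. i \<le> n \<Longrightarrow> g (e i) = c i"
  shows "enum_chain A le e n"
  unfolding enum_chain_def
proof (intro conjI allI impI ballI)
  show "e i \<in> A" if "i \<le> n" for i using that assms by simp
  fix i j assume ij: "i \<le> n" "j \<le> n"
  have "c j \<subseteq> c i \<longleftrightarrow> i \<le> j"
    using c_anti[of i j] card_mono[of "c i" "c j"] card_c[of i] card_c[of j] finite_c[of i] ij by auto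
  then show "le (e i) (e j) \<longleftrightarrow> i \<le> j" using ij assms g_le by auto
next
  fix i assume "i < n"
  then show "covers A le (e i) (e (Suc i))"
    using assms c_anti[of i "Suc i"] card_c by (intro coversI) auto
next
  fix x assume x: "x \<in> A"
  then have "g x \<subseteq> c 0" using g_in[OF x] c_anti[of 0] unfolding F_eq by auto
  then show "le (e 0) x" using x assms g_le by auto
  have "c n = {}" using card_c[of n] finite_c[of n] by simp
  then show "le x (e n)" using x assms g_le by auto
qed

lemma rep_join_irr:
  assumes "join_irr A le x"
  shows "\<exists>i\<le>n. g x = c i \<or> g x = d i"
proof -
  have x: "x \<in> A" using assms by (simp add: join_irr_def)
  then obtain i j where ij: "g x = c i \<inter> d j" "i \<le> n" "j \<le> n" using g_in unfolding F_eq by blast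
  obtain a b where ab: "a \<in> A" "b \<in> A" "g a = c i" "g b = d j"
    using g_surj c_in d_in ij by metis
  have "ljoin A le a b = x" using g_join ab ij g_eq join_closed x by metis
  then have "a = x \<or> b = x" using assms ab by (auto simp: join_irr_def)
  then show ?thesis using ab ij by auto
qed

text \<open>Join-irreducible elements lie on one of two chains, and among three elements two share a
  chain.\<close>

lemma rep_slim: "slim A le"
  unfolding slim_def
proof
  assume "\<exists>x y z. join_irr A le x \<and> join_irr A le y \<and> join_irr A le z \<and>
      \<not> le x y \<and> \<not> le y x \<and> \<not> le x z \<and> \<not> le z x \<and> \<not> le y z \<and> \<not> le z y"
  then obtain x y z where J: "join_irr A le x" "join_irr A le y" "join_irr A le z"
    and nle: "\<not> le x y" "\<not> le y x" "\<not> le x z" "\<not> le z x" "\<not> le y z" "\<not> le z y" by blast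
  have A: "x \<in> A" "y \<in> A" "z \<in> A" using J by (auto simp: join_irr_def)
  define P where "P x \<longleftrightarrow> (\<exists>i\<le>n. g x = c i)" for x
  define Q where "Q x \<longleftrightarrow> (\<exists>i\<le>n. g x = d i)" for x
  have PQ: "P x \<or> Q x" "P y \<or> Q y" "P z \<or> Q z"
    using rep_join_irr J unfolding P_def Q_def by metis+
  have cmp: "le u v \<or> le v u" if "P u \<and> P v \<or> Q u \<and> Q v" "u \<in> A" "v \<in> A" for u v
  proof -
    have "g u \<subseteq> g v \<or> g v \<subseteq> g u"
      using that(1) c_anti d_anti unfolding P_def Q_def by (metis nat_le_linear)
    then show ?thesis using g_le that by auto
  qed
  show False using PQ cmp A nle by metis
qed

lemma rep_ssl: "ssl A le"
  using rep_fin_lattice rep_semimodular rep_slim by (simp add: ssl_def)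

end

text \<open>The indices of the meet-irreducible elements above \<open>c\<^sub>k \<or> d\<^sub>l\<close>, for \<open>x = (k, l)\<close>.\<close>
definition Uset :: "nat \<Rightarrow> (nat \<Rightarrow> nat) \<Rightarrow> nat \<times> nat \<Rightarrow> nat set" where
  "Uset n \<pi> x = {m \<in> {1..n}. fst x < m \<and> snd x < \<pi> m}"

definition Ufam :: "nat \<Rightarrow> (nat \<Rightarrow> nat) \<Rightarrow> nat set set" where
  "Ufam n \<pi> = Uset n \<pi> ` grid n"

text \<open>For m in \<open>{1..n}\<close> both m and \<open>\<pi> m\<close> are positive, so a
  coordinate 0 imposes no condition. The cardinality along the second chain is found by applying
  \<pi>, which maps that set onto \<open>{Suc i..n}\<close>.\<close>

lemma grid_family_Ufam:
  assumes "\<pi> permutes {1..n}"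
  shows "grid_family n (Ufam n \<pi>) (\<lambda>i. Uset n \<pi> (i, 0)) (\<lambda>j. Uset n \<pi> (0, j))"
proof
  have pos: "0 < \<pi> m" if "m \<in> {1..n}" for m using permutes_in_image[OF assms, of m] that by auto
  have "Uset n \<pi> (i, 0) \<inter> Uset n \<pi> (0, j) = Uset n \<pi> (i, j)" for i j
    using pos by (auto simp: Uset_def)
  then show "Ufam n \<pi> = {Uset n \<pi> (i, 0) \<inter> Uset n \<pi> (0, j) | i j. i \<le> n \<and> j \<le> n}"
    by (force simp: Ufam_def grid_def)
  fix i assume i: "i \<le> n"
  have "Uset n \<pi> (i, 0) = {Suc i..n}" using pos by (auto simp: Uset_def)
  then show "card (Uset n \<pi> (i, 0)) = n - i" by simp
  have "\<pi> ` Uset n \<pi> (0, i) = {Suc i..n}"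
  proof
    have "\<pi> m \<le> n" if "m \<in> {1..n}" for m using permutes_in_image[OF assms, of m] that by auto
    then show "\<pi> ` Uset n \<pi> (0, i) \<subseteq> {Suc i..n}" by (auto simp: Uset_def)
    show "{Suc i..n} \<subseteq> \<pi> ` Uset n \<pi> (0, i)"
    proof
      fix y assume y: "y \<in> {Suc i..n}"
      then have "y \<in> \<pi> ` {1..n}" using permutes_image[OF assms] by auto
      then show "y \<in> \<pi> ` Uset n \<pi> (0, i)" using y by (auto simp: Uset_def)
    qed
  qed
  moreover have "inj_on \<pi> (Uset n \<pi> (0, i))" using permutes_inj[OF assms] by (auto simp: inj_on_def)
  ultimately show "card (Uset n \<pi> (0, i)) = n - i" by (metis card_image card_atLeastAtMost diff_Suc_Suc)
qed (auto simp: Uset_def)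

section \<open>The join-congruence \<open>beta\<close> as a kernel\<close>

lemma Uset_grid_join: "Uset n \<pi> (grid_join x y) = Uset n \<pi> x \<inter> Uset n \<pi> y"
  by (auto simp: Uset_def grid_join_def)

lemma grid_join_in: "x \<in> grid n \<Longrightarrow> y \<in> grid n \<Longrightarrow> grid_join x y \<in> grid n"
  by (auto simp: grid_def grid_join_def)

text \<open>A unit step in the grid loses no index exactly when it is a translate of a generating
  pair under a join. Two points with equal \<open>Uset\<close> are both linked to their join by
  monotone paths made of such steps, because the sets along these paths are squeezed between equal
  ones.\<close>

lemma join_congruence_contains_kernel:
  assumes \<pi>: "\<pi> permutes {1..n}" and \<theta>: "join_congruence n \<theta>" "beta_gens n \<pi> \<subseteq> \<theta>"
    and xy: "x \<in> grid n" "y \<in> grid n" "Uset n \<pi> x = Uset n \<pi> y"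
  shows "(x, y) \<in> \<theta>"
proof -
  have eq: "equiv (grid n) \<theta>" and cong: "\<And>x y z. (x, y) \<in> \<theta> \<Longrightarrow> z \<in> grid n \<Longrightarrow> (grid_join x z, grid_join y z) \<in> \<theta>"
    using \<theta>(1) by (auto simp: join_congruence_def)
  have sym: "(a, b) \<in> \<theta> \<Longrightarrow> (b, a) \<in> \<theta>" and trans: "(a, b) \<in> \<theta> \<Longrightarrow> (b, e) \<in> \<theta> \<Longrightarrow> (a, e) \<in> \<theta>" for a b e
    using eq by (auto simp: equiv_def elim: symE transE)
  have refl: "a \<in> grid n \<Longrightarrow> (a, a) \<in> \<theta>" for a using eq by (auto simp: equiv_def refl_on_def)
  have range: "1 \<le> \<pi> i" "\<pi> i \<le> n" if "1 \<le> i" "i \<le> n" for i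
    using permutes_in_image[OF \<pi>, of i] that by auto
  \<comment> \<open>The step from k to \<open>Suc k\<close> could lose only the index
    \<open>Suc k\<close>, and does not lose it if \<open>\<pi> (Suc k) \<le> l\<close>; joining the
    generator of that index with (0, l) collapses the step. In the other direction,
    \<open>up\<close> uses the index i with \<open>\<pi> i = Suc l\<close> and joins with (k,
    0).\<close>
  have right: "((k, l), (Suc k, l)) \<in> \<theta>" if "k < n" "l \<le> n" "\<pi> (Suc k) \<le> l" for k l
  proof -
    have "((Suc k - 1, \<pi> (Suc k)), (Suc k, \<pi> (Suc k))) \<in> beta_gens n \<pi>"
      unfolding beta_gens_def using that by (intro UN_I[of "Suc k"]) auto
    then have "(grid_join (k, \<pi> (Suc k)) (0, l), grid_join (Suc k, \<pi> (Suc k)) (0, l)) \<in> \<theta>"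
      using \<theta>(2) that by (intro cong) (auto simp: grid_def)
    then show ?thesis using that by (simp add: grid_join_def max_def)
  qed
  have up: "((k, l), (k, Suc l)) \<in> \<theta>" if "l < n" "k \<le> n" "1 \<le> i" "i \<le> k" "\<pi> i = Suc l" for k l i
  proof -
    have "((i, \<pi> i - 1), (i, \<pi> i)) \<in> beta_gens n \<pi>"
      unfolding beta_gens_def using that by (intro UN_I[of i]) auto
    then have "(grid_join (i, l) (k, 0), grid_join (i, Suc l) (k, 0)) \<in> \<theta>"
      using \<theta>(2) that by (intro cong) (auto simp: grid_def)
    then show ?thesis using that by (simp add: grid_join_def max_def)
  qed
  have rights: "((k, l), (k', l)) \<in> \<theta>" if "k \<le> k'" "k' \<le> n" "l \<le> n" "Uset n \<pi> (k, l) \<subseteq> Uset n \<pi> (k', l)" for k k' l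
  proof -
    have small: "\<pi> j \<le> l" if "k < j" "j \<le> k'" for j
    proof (rule ccontr)
      assume "\<not> \<pi> j \<le> l"
      then have "j \<in> Uset n \<pi> (k, l)" using that \<open>k' \<le> n\<close> by (auto simp: Uset_def)
      then have "j \<in> Uset n \<pi> (k', l)" using \<open>Uset n \<pi> (k, l) \<subseteq> Uset n \<pi> (k', l)\<close> by blast
      then show False using that by (auto simp: Uset_def)
    qed
    have "j \<le> k' \<longrightarrow> ((k, l), (j, l)) \<in> \<theta>" if "k \<le> j" for j
      using that
    proof (induction j rule: dec_induct)
      case base show ?case using refl that \<open>k \<le> k'\<close> \<open>k' \<le> n\<close> \<open>l \<le> n\<close> by (auto simp: grid_def)
    next
      case (step j)
      then show ?case using right[of j l] small[of "Suc j"] \<open>k' \<le> n\<close> \<open>l \<le> n\<close> trans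
        by (meson Suc_leD Suc_le_lessD le_imp_less_Suc order_trans)
    qed
    then show ?thesis using that by simp
  qed
  have ups: "((k, l), (k, l')) \<in> \<theta>" if "l \<le> l'" "l' \<le> n" "k \<le> n" "Uset n \<pi> (k, l) \<subseteq> Uset n \<pi> (k, l')" for k l l'
  proof -
    have small: "\<exists>i\<ge>1. i \<le> k \<and> \<pi> i = j" if "l < j" "j \<le> l'" for j
    proof -
      have "j \<in> \<pi> ` {1..n}" using that \<open>l' \<le> n\<close> permutes_image[OF \<pi>] by auto
      then obtain i where i: "1 \<le> i" "i \<le> n" "\<pi> i = j" by auto
      have "\<not> k < i"
      proof
        assume "k < i"
        then have "i \<in> Uset n \<pi> (k, l)" using i that by (auto simp: Uset_def)
        then have "i \<in> Uset n \<pi> (k, l')" using \<open>Uset n \<pi> (k, l) \<subseteq> Uset n \<pi> (k, l')\<close> by blast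
        then show False using that i by (auto simp: Uset_def)
      qed
      then show ?thesis using i by auto
    qed
    have "j \<le> l' \<longrightarrow> ((k, l), (k, j)) \<in> \<theta>" if "l \<le> j" for j
      using that
    proof (induction j rule: dec_induct)
      case base show ?case using refl that \<open>l \<le> l'\<close> \<open>l' \<le> n\<close> \<open>k \<le> n\<close> by (auto simp: grid_def)
    next
      case (step j)
      show ?case
      proof
        assume j: "Suc j \<le> l'"
        then obtain i where "1 \<le> i" "i \<le> k" "\<pi> i = Suc j" using small[of "Suc j"] step by auto
        then have "((k, j), (k, Suc j)) \<in> \<theta>" using up j \<open>l' \<le> n\<close> \<open>k \<le> n\<close> by simp
        then show "((k, l), (k, Suc j)) \<in> \<theta>" using step j trans by auto
      qed
    qed
    then show ?thesis using that by simp
  qed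
  have above: "(a, b) \<in> \<theta>" if "a \<in> grid n" "b \<in> grid n" "fst a \<le> fst b" "snd a \<le> snd b"
    "Uset n \<pi> a = Uset n \<pi> b" for a b
  proof -
    obtain k l k' l' where ab: "a = (k, l)" "b = (k', l')" by (metis surj_pair)
    have le: "k \<le> k'" "k' \<le> n" "l \<le> l'" "l' \<le> n" using that ab by (auto simp: grid_def)
    have "Uset n \<pi> (k', l') \<subseteq> Uset n \<pi> (k', l)" "Uset n \<pi> (k', l) \<subseteq> Uset n \<pi> (k, l)"
      using le by (auto simp: Uset_def)
    then have "Uset n \<pi> (k, l) = Uset n \<pi> (k', l)" "Uset n \<pi> (k', l) = Uset n \<pi> (k', l')"
      using that(5) unfolding ab by simp_all
    then show ?thesis using le rights[of k k' l] ups[of l l' k'] trans unfolding ab by simp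
  qed
  have "grid_join x y \<in> grid n" using xy grid_join_in by blast
  moreover have "fst x \<le> fst (grid_join x y)" "snd x \<le> snd (grid_join x y)"
    "fst y \<le> fst (grid_join x y)" "snd y \<le> snd (grid_join x y)" by (auto simp: grid_join_def)
  moreover have "Uset n \<pi> (grid_join x y) = Uset n \<pi> x" using xy(3) by (simp add: Uset_grid_join)
  ultimately have "(x, grid_join x y) \<in> \<theta>" "(y, grid_join x y) \<in> \<theta>"
    using above[OF xy(1)] above[OF xy(2)] xy(3) by simp_all
  then show ?thesis using sym trans by blast
qed

text \<open>The kernel is a join-congruence since \<open>Uset\<close> turns joins into
  intersections. It contains the generators: lowering one coordinate of \<open>(i, \<pi> i)\<close>
  by one could admit only the index i, which the other coordinate still excludes.\<close>

lemma beta_eq_kernel: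
  assumes \<pi>: "\<pi> permutes {1..n}"
  shows "beta n \<pi> = {(x, y). x \<in> grid n \<and> y \<in> grid n \<and> Uset n \<pi> x = Uset n \<pi> y}" (is "_ = ?K")
proof
  have "equiv (grid n) ?K" by (auto simp: equiv_def refl_on_def sym_def trans_def)
  then have "join_congruence n ?K"
    by (auto simp: join_congruence_def grid_join_in Uset_grid_join)
  moreover have "beta_gens n \<pi> \<subseteq> ?K"
  proof -
    have "x \<in> grid n \<and> Uset n \<pi> x = Uset n \<pi> (i, \<pi> i)"
      if i: "i \<in> {1..n}" and x: "x \<in> {(i - 1, \<pi> i), (i, \<pi> i - 1), (i, \<pi> i)}" for i x
    proof -
      have r: "\<pi> i \<in> {1..n}" using permutes_in_image[OF \<pi>] i by blast
      have "\<pi> m = \<pi> i \<longleftrightarrow> m = i" for m using permutes_inj[OF \<pi>] by (auto dest: injD)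
      moreover have "\<pi> i - 1 < p \<longleftrightarrow> \<pi> i < p \<or> p = \<pi> i" "i - 1 < p \<longleftrightarrow> i < p \<or> p = i" for p using r i by auto
      ultimately show ?thesis using x i r by (auto simp: Uset_def grid_def)
    qed
    then show ?thesis unfolding beta_gens_def by (clarsimp) (metis insertCI)
  qed
  ultimately show "beta n \<pi> \<subseteq> ?K" unfolding beta_def by blast
  show "?K \<subseteq> beta n \<pi>" unfolding beta_def using join_congruence_contains_kernel[OF \<pi>] by blast
qed

text \<open>All members of a class have the same \<open>Uset\<close>, so the union returns this
  common value without choosing a representative.\<close>

definition Uclass :: "nat \<Rightarrow> (nat \<Rightarrow> nat) \<Rightarrow> (nat \<times> nat) set \<Rightarrow> nat set" where
  "Uclass n \<pi> X = \<Union> (Uset n \<pi> ` X)"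

lemma beta_class_iff:
  assumes "\<pi> permutes {1..n}" "x \<in> grid n"
  shows "y \<in> beta n \<pi> `` {x} \<longleftrightarrow> y \<in> grid n \<and> Uset n \<pi> y = Uset n \<pi> x"
  using assms by (auto simp: beta_eq_kernel)

lemma Uclass_beta:
  assumes "\<pi> permutes {1..n}" "x \<in> grid n" shows "Uclass n \<pi> (beta n \<pi> `` {x}) = Uset n \<pi> x"
proof -
  have "x \<in> beta n \<pi> `` {x}" "\<And>y. y \<in> beta n \<pi> `` {x} \<Longrightarrow> Uset n \<pi> y = Uset n \<pi> x"
    unfolding beta_class_iff[OF assms] using assms(2) by simp_all
  then have "Uset n \<pi> ` (beta n \<pi> `` {x}) = {Uset n \<pi> x}" by blast
  then show ?thesis by (simp add: Uclass_def)
qed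

lemma quot_iso_Ufam:
  assumes \<pi>: "\<pi> permutes {1..n}"
  shows "lat_iso (quot_carrier n \<pi>) (quot_le n \<pi>) (Ufam n \<pi>) (\<supseteq>) (Uclass n \<pi>)"
proof -
  have carr: "quot_carrier n \<pi> = (\<lambda>x. beta n \<pi> `` {x}) ` grid n"
    by (auto simp: quot_carrier_def quotient_def)
  have "inj_on (Uclass n \<pi>) (quot_carrier n \<pi>)"
    unfolding carr
  proof (rule inj_onI, clarify)
    fix a b a' b' assume xy: "(a, b) \<in> grid n" "(a', b') \<in> grid n"
      "Uclass n \<pi> (beta n \<pi> `` {(a, b)}) = Uclass n \<pi> (beta n \<pi> `` {(a', b')})"
    then show "beta n \<pi> `` {(a, b)} = beta n \<pi> `` {(a', b')}"
      using beta_class_iff[OF \<pi>] by (auto simp: Uclass_beta[OF \<pi>])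
  qed
  moreover have "Uclass n \<pi> ` quot_carrier n \<pi> = Ufam n \<pi>"
    unfolding carr Ufam_def image_image using Uclass_beta[OF \<pi>] by simp
  moreover have "quot_le n \<pi> (beta n \<pi> `` {x}) (beta n \<pi> `` {y}) \<longleftrightarrow> Uset n \<pi> y \<subseteq> Uset n \<pi> x"
    if xy: "x \<in> grid n" "y \<in> grid n" for x y
  proof
    assume "quot_le n \<pi> (beta n \<pi> `` {x}) (beta n \<pi> `` {y})"
    then obtain x' y' where "Uset n \<pi> x' = Uset n \<pi> x" "Uset n \<pi> y' = Uset n \<pi> y"
      "Uset n \<pi> (grid_join x' y') = Uset n \<pi> y"
      unfolding quot_le_def Bex_def beta_class_iff[OF \<pi> xy(1)] beta_class_iff[OF \<pi> xy(2)] by blast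
    then show "Uset n \<pi> y \<subseteq> Uset n \<pi> x" unfolding Uset_grid_join by blast
  next
    assume "Uset n \<pi> y \<subseteq> Uset n \<pi> x"
    then have "grid_join x y \<in> beta n \<pi> `` {y}"
      unfolding beta_class_iff[OF \<pi> xy(2)] using xy grid_join_in Uset_grid_join by blast
    moreover have "x \<in> beta n \<pi> `` {x}" "y \<in> beta n \<pi> `` {y}" using beta_class_iff[OF \<pi>] xy by simp_all
    ultimately show "quot_le n \<pi> (beta n \<pi> `` {x}) (beta n \<pi> `` {y})" unfolding quot_le_def by blast
  qed
  ultimately show ?thesis
    unfolding lat_iso_def bij_betw_def by (auto simp: carr Uclass_beta[OF \<pi>])
qed

section \<open>Lattices generated by two chains\<close>

text \<open>The index of the largest member of the chain below a, used as a coordinate of a. For a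
  in the carrier the choice is unique by \<open>enum_chain_locate\<close>.\<close>

definition lev :: "('a \<Rightarrow> 'a \<Rightarrow> bool) \<Rightarrow> (nat \<Rightarrow> 'a) \<Rightarrow> nat \<Rightarrow> 'a \<Rightarrow> nat" where
  "lev le c m a = (SOME k. k \<le> m \<and> (\<forall>i\<le>m. le (c i) a \<longleftrightarrow> i \<le> k))"

context finlat begin

lemma lev:
  assumes "enum_chain A le c m" "a \<in> A"
  shows lev_le: "lev le c m a \<le> m" and le_iff_lev: "\<And>i. i \<le> m \<Longrightarrow> le (c i) a \<longleftrightarrow> i \<le> lev le c m a"
proof -
  have "\<exists>k. k \<le> m \<and> (\<forall>i\<le>m. le (c i) a \<longleftrightarrow> i \<le> k)" using enum_chain_locate[OF assms] by metis
  from someI_ex[OF this] have "lev le c m a \<le> m \<and> (\<forall>i\<le>m. le (c i) a \<longleftrightarrow> i \<le> lev le c m a)"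
    unfolding lev_def .
  then show "lev le c m a \<le> m" "\<And>i. i \<le> m \<Longrightarrow> le (c i) a \<longleftrightarrow> i \<le> lev le c m a" by blast+
qed

lemma lev_enum: "enum_chain A le c m \<Longrightarrow> i \<le> m \<Longrightarrow> lev le c m (c i) = i"
  using lev[of c m "c i"] enum_chainD(1,2)[of A le c m] by (meson le_antisym order_refl)

lemma first_idx_lev:
  assumes "enum_chain A le c m" "u \<in> A" "u \<noteq> ltop A le"
  shows "first_idx le (c ` {..m}) u = Suc (lev le c m u)" "lev le c m u < m"
proof -
  obtain k where k: "k < m" "first_idx le (c ` {..m}) u = Suc k" "\<And>i. i \<le> m \<Longrightarrow> le (c i) u \<longleftrightarrow> i \<le> k"
    using enum_chain_first_idx_iff[OF assms] by blast
  have "lev le c m u = k" using lev[OF assms(1,2)] k(1,3) by (meson le_antisym less_imp_le order_refl)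
  then show "first_idx le (c ` {..m}) u = Suc (lev le c m u)" "lev le c m u < m" using k by auto
qed

text \<open>Two distinct covers of u would have u as their meet: a common lower bound joined with u
  stays below both covers, and thus equals u.\<close>

lemma meet_irr_unique_cover:
  assumes u: "meet_irr A le u" and x: "covers A le u x" and y: "covers A le u y"
  shows "x = y"
proof (rule ccontr)
  assume "x \<noteq> y"
  have A: "u \<in> A" "x \<in> A" "y \<in> A" "le u x" "le u y" "x \<noteq> u" "y \<noteq> u" using x y by (auto simp: covers_def)
  have glb: "is_glb A le x y u"
    unfolding is_glb_def
  proof (intro conjI ballI impI)
    fix z assume z: "z \<in> A" "le z x \<and> le z y"
    let ?w = "ljoin A le u z"
    have w: "?w \<in> A" "le u ?w" "le ?w x" "le ?w y" "le z ?w"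
      using z A join_closed join_ub1 join_ub2 join_least by auto
    have "?w = u \<or> ?w = x" "?w = u \<or> ?w = y" using w x y by (auto simp: covers_def)
    then have "?w = u" using \<open>x \<noteq> y\<close> by auto
    then show "le z u" using w by simp
  qed (use A in auto)
  have "lmeet A le x y = u"
    unfolding lmeet_def
  proof (rule the_equality, rule glb)
    fix s assume "is_glb A le x y s"
    then show "s = u" using glb antisym unfolding is_glb_def by blast
  qed
  then show False using u A by (auto simp: meet_irr_def)
qed

end

text \<open>The two lengths are kept apart because their equality is a consequence of semimodularity
  (\<open>same_length\<close>); order coordinates and the planar drawing are available before
  that.\<close>

locale two_chains = finlat A le for A :: "'a set" and le +
  fixes c d :: "nat \<Rightarrow> 'a" and m m' :: nat
  assumes enum_c: "enum_chain A le c m" and enum_d: "enum_chain A le d m'"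
    and join_irr_chains: "join_irr A le j \<Longrightarrow> j \<in> c ` {..m} \<or> j \<in> d ` {..m'}"
begin

lemma two_chains_swap: "two_chains A le d c m' m"
  by unfold_locales (use enum_c enum_d join_irr_chains in auto)

abbreviation "X \<equiv> lev le c m"
abbreviation "Y \<equiv> lev le d m'"

lemmas c_in = enum_chainD(1)[OF enum_c] and d_in = enum_chainD(1)[OF enum_d]
lemmas c_le_iff = enum_chainD(2)[OF enum_c]
lemmas X_le = lev_le[OF enum_c] and Y_le = lev_le[OF enum_d]
lemmas le_iff_X = le_iff_lev[OF enum_c] and le_iff_Y = le_iff_lev[OF enum_d]

text \<open>If a were not below b, a join-irreducible element would separate them. It lies on one of
  the two chains, so the corresponding coordinate of a would exceed that of b.\<close>

lemma le_iff_coords: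
  assumes ab: "a \<in> A" "b \<in> A"
  shows "le a b \<longleftrightarrow> X a \<le> X b \<and> Y a \<le> Y b"
proof
  assume "le a b"
  have "le (c (X a)) a" "le (d (Y a)) a" using le_iff_X le_iff_Y X_le Y_le ab by simp_all
  then have "le (c (X a)) b" "le (d (Y a)) b"
    using trans[of _ a b] \<open>le a b\<close> ab c_in d_in X_le Y_le by blast+
  then show "X a \<le> X b \<and> Y a \<le> Y b" using le_iff_X le_iff_Y X_le Y_le ab by simp
next
  assume le: "X a \<le> X b \<and> Y a \<le> Y b"
  show "le a b"
  proof (rule ccontr)
    assume "\<not> le a b"
    then obtain j where j: "join_irr A le j" "le j a" "\<not> le j b" using join_irr_separates ab by blast
    from join_irr_chains[OF j(1)] show False
    proof
      assume "j \<in> c ` {..m}"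
      then obtain i where "j = c i" "i \<le> m" by auto
      then show False using j le le_iff_X[OF ab(1), of i] le_iff_X[OF ab(2), of i] by auto
    next
      assume "j \<in> d ` {..m'}"
      then obtain i where "j = d i" "i \<le> m'" by auto
      then show False using j le le_iff_Y[OF ab(1), of i] le_iff_Y[OF ab(2), of i] by auto
    qed
  qed
qed

lemma join_coords:
  assumes "a \<in> A" shows "ljoin A le (c (X a)) (d (Y a)) = a"
proof -
  have in_A: "c (X a) \<in> A" "d (Y a) \<in> A" using c_in d_in X_le Y_le assms by blast+
  let ?s = "ljoin A le (c (X a)) (d (Y a))"
  have s: "?s \<in> A" using join_closed in_A by blast
  have "le ?s a" using in_A assms le_iff_X le_iff_Y X_le Y_le by (intro join_least) auto
  moreover have "X a \<le> X ?s" "Y a \<le> Y ?s"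
    using le_iff_X[OF s X_le[OF assms]] le_iff_Y[OF s Y_le[OF assms]] in_A join_ub1 join_ub2 by blast+
  then have "le a ?s" using le_iff_coords assms s by blast
  ultimately show ?thesis using antisym s assms by blast
qed

text \<open>The top satisfies \<open>meet_irr\<close>, so it has to be excluded; it is also the
  element at which \<open>first_idx\<close> has no chain member to point to.\<close>

definition M where "M = {u. meet_irr A le u \<and> u \<noteq> ltop A le}"

lemma M_in: "u \<in> M \<Longrightarrow> u \<in> A" by (auto simp: M_def meet_irr_def)

lemma ltop_enum: "ltop A le = c m"
  using ltop_eq enum_chainD[OF enum_c] by auto

lemma meet_irr_separates_M:
  assumes "a \<in> A" "b \<in> A" "\<not> le a b"
  obtains u where "u \<in> M" "le b u" "\<not> le a u"
proof -
  obtain u where u: "meet_irr A le u" "le b u" "\<not> le a u" using meet_irr_separates[OF assms] by blast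
  have "u \<noteq> ltop A le" using u ltop_enum enum_chainD(5)[OF enum_c] assms by auto
  then show thesis using that u by (auto simp: M_def)
qed

end

locale semimodular_two_chains = two_chains +
  assumes semimodular: "semimodular A le"
begin

lemma semimodular_two_chains_swap: "semimodular_two_chains A le d c m' m"
  using two_chains_swap semimodular
  by (simp add: semimodular_two_chains_def semimodular_two_chains_axioms_def)

lemma X_less: "u \<in> M \<Longrightarrow> X u < m"
  using first_idx_lev(2)[OF enum_c] M_in by (auto simp: M_def)

text \<open>Elements with equal X are comparable through Y. If u < v share X = i, semimodularity
  makes \<open>c (Suc i) \<or> u\<close> a cover of u, and a meet-irreducible u has only one cover.
  That cover lies below v, so \<open>c (Suc i)\<close> lies below v, contrary to X v = i.\<close>

lemma X_inj_M: "inj_on X M"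
proof -
  have "u = v" if uv: "u \<in> M" "v \<in> M" "X u = X v" "le u v" for u v
  proof (rule ccontr)
    assume "u \<noteq> v"
    have A: "u \<in> A" "v \<in> A" using uv M_in by auto
    define i where "i = X u"
    have i: "i < m" "le (c i) u" "\<not> le (c (Suc i)) u" "\<not> le (c (Suc i)) v"
      using le_iff_X[OF A(1), of i] le_iff_X[OF A(1), of "Suc i"] le_iff_X[OF A(2), of "Suc i"] uv X_less[OF uv(1)]
      unfolding i_def by auto
    have ciA: "c i \<in> A" "c (Suc i) \<in> A" using c_in i by auto
    let ?s = "ljoin A le (c (Suc i)) u"
    have sA: "?s \<in> A" and "le (c (Suc i)) ?s" using join_closed join_ub1 ciA A by auto
    have "ljoin A le (c i) u = u" using join_absorb i ciA A by auto
    moreover have "?s \<noteq> u" using i \<open>le (c (Suc i)) ?s\<close> by auto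
    ultimately have s: "covers A le u ?s"
      using semimodular enum_chainD(3)[OF enum_c i(1)] ciA A unfolding semimodular_def by metis
    obtain x where x: "covers A le u x" "le x v" using ex_cover_above[of u v] uv A \<open>u \<noteq> v\<close> by blast
    have "?s = x" using meet_irr_unique_cover s x uv by (auto simp: M_def)
    then have "le (c (Suc i)) v" using x \<open>le (c (Suc i)) ?s\<close> trans ciA sA A by blast
    then show False using i by blast
  qed
  moreover have "le u v \<or> le v u" if "u \<in> M" "v \<in> M" "X u = X v" for u v
    using le_iff_coords M_in that by (metis nat_le_linear order_refl)
  ultimately show ?thesis unfolding inj_on_def by metis
qed

text \<open>Separating \<open>c (Suc i)\<close> from \<open>c i\<close> by a meet-irreducible
  element produces one with X = i.\<close>

lemma X_image_M: "X ` M = {..<m}"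
proof
  show "X ` M \<subseteq> {..<m}" using X_less by auto
  show "{..<m} \<subseteq> X ` M"
  proof
    fix i assume "i \<in> {..<m}"
    then have i: "i < m" by simp
    then obtain u where u: "u \<in> M" "le (c i) u" "\<not> le (c (Suc i)) u"
      using meet_irr_separates_M[of "c (Suc i)" "c i"] c_in c_le_iff by auto
    then have "X u = i" using le_iff_X[OF M_in[OF u(1)], of i] le_iff_X[OF M_in[OF u(1)], of "Suc i"] i by auto
    then show "i \<in> X ` M" using u by blast
  qed
qed

text \<open>Both lengths count the set M.\<close>

lemma same_length: "m' = m"
proof -
  interpret s: semimodular_two_chains A le d c m' m by (rule semimodular_two_chains_swap)
  have "card M = m" using card_image[OF X_inj_M] X_image_M by simp
  moreover have "card s.M = m'" using card_image[OF s.X_inj_M] s.X_image_M by simp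
  ultimately show ?thesis by simp
qed

text \<open>M is numbered by each of the two chains; \<pi> translates the first numbering into the
  second. An element is sent to the first numbers of the members of M above it, which determines it
  by meet-irreducible separation.\<close>

lemma representation:
  obtains \<pi> g where "\<pi> permutes {1..m}" "lat_iso A le (Ufam m \<pi>) (\<supseteq>) g"
    "\<And>i. i \<le> m \<Longrightarrow> g (c i) = Uset m \<pi> (i, 0)" "\<And>i. i \<le> m \<Longrightarrow> g (d i) = Uset m \<pi> (0, i)"
    "\<And>i. i \<in> {1..m} \<Longrightarrow> \<exists>!u. meet_irr A le u \<and> u \<noteq> ltop A le \<and> first_idx le (c ` {..m}) u = i"
    "\<And>u. meet_irr A le u \<Longrightarrow> u \<noteq> ltop A le \<Longrightarrow> \<pi> (first_idx le (c ` {..m}) u) = first_idx le (d ` {..m'}) u"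
proof -
  interpret s: semimodular_two_chains A le d c m' m by (rule semimodular_two_chains_swap)
  define \<phi> \<psi> where "\<phi> = Suc \<circ> X" and "\<psi> = Suc \<circ> Y"
  have fst: "first_idx le (c ` {..m}) u = \<phi> u" "first_idx le (d ` {..m'}) u = \<psi> u" if "u \<in> M" for u
    using that first_idx_lev(1)[OF enum_c, of u] first_idx_lev(1)[OF enum_d, of u] M_in
    by (auto simp: \<phi>_def \<psi>_def M_def)
  have Suc_m: "Suc ` {..<m} = {1..m}" using image_Suc_lessThan by simp
  have "\<phi> ` M = Suc ` X ` M" "\<psi> ` M = Suc ` Y ` M" by (auto simp: \<phi>_def \<psi>_def)
  moreover have "Y ` M = {..<m}" "inj_on Y M" using s.X_image_M s.X_inj_M unfolding same_length .
  ultimately have \<phi>: "bij_betw \<phi> M {1..m}" and \<psi>: "bij_betw \<psi> M {1..m}"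
    using X_inj_M X_image_M Suc_m unfolding bij_betw_def \<phi>_def \<psi>_def by (simp_all add: comp_inj_on)
  \<comment> \<open>The identity outside \<open>{1..m}\<close> is what \<open>permutes\<close>
    demands.\<close>
  define \<pi> where "\<pi> i = (if i \<in> {1..m} then \<psi> (inv_into M \<phi> i) else i)" for i
  have "bij_betw (\<psi> \<circ> inv_into M \<phi>) {1..m} {1..m}"
    using bij_betw_trans[OF bij_betw_inv_into[OF \<phi>] \<psi>] .
  then have "bij_betw \<pi> {1..m} {1..m}"
    by (rule bij_betw_cong[THEN iffD1, rotated]) (simp add: \<pi>_def)
  then have perm: "\<pi> permutes {1..m}" by (rule bij_imp_permutes) (auto simp: \<pi>_def)
  have \<phi>M: "\<phi> u \<in> {1..m}" "\<pi> (\<phi> u) = \<psi> u" if "u \<in> M" for u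
  proof -
    show "\<phi> u \<in> {1..m}" using \<phi> that by (auto simp: bij_betw_def)
    then show "\<pi> (\<phi> u) = \<psi> u" using bij_betw_inv_into_left[OF \<phi> that] by (simp add: \<pi>_def)
  qed
  define g where "g a = \<phi> ` {u \<in> M. le a u}" for a
  have gle: "le a b \<longleftrightarrow> g b \<subseteq> g a" if ab: "a \<in> A" "b \<in> A" for a b
  proof -
    have "g b \<subseteq> g a \<longleftrightarrow> {u \<in> M. le b u} \<subseteq> {u \<in> M. le a u}"
      unfolding g_def by (rule inj_on_image_subset_iff[of \<phi> M]) (use \<phi> in \<open>auto simp: bij_betw_def\<close>)
    also have "\<dots> \<longleftrightarrow> le a b"
    proof
      assume sub: "{u \<in> M. le b u} \<subseteq> {u \<in> M. le a u}"
      show "le a b"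
      proof (rule ccontr)
        assume "\<not> le a b"
        then obtain u where "u \<in> M" "le b u" "\<not> le a u" using meet_irr_separates_M ab by blast
        then show False using sub by blast
      qed
    next
      assume "le a b"
      then show "{u \<in> M. le b u} \<subseteq> {u \<in> M. le a u}" using trans that M_in by blast
    qed
    finally show ?thesis by blast
  qed
  \<comment> \<open>A member u of M is above the join iff it is above both parts, that is, iff
    \<open>k \<le> X u\<close> and \<open>l \<le> Y u\<close>. The shift by \<open>Suc\<close> in
    both numberings turns these into the strict inequalities of \<open>Uset\<close>.\<close>
  have gjoin: "g (ljoin A le (c k) (d l)) = Uset m \<pi> (k, l)" if kl: "k \<le> m" "l \<le> m" for k l
  proof -
    have "le (ljoin A le (c k) (d l)) u \<longleftrightarrow> k < \<phi> u \<and> l < \<psi> u" if "u \<in> M" for u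
      using join_le_iff[of "c k" "d l" u] c_in d_in kl same_length M_in[OF that]
        le_iff_X[OF M_in[OF that], of k] le_iff_Y[OF M_in[OF that], of l]
      by (auto simp: \<phi>_def \<psi>_def)
    then have "g (ljoin A le (c k) (d l)) = \<phi> ` {u \<in> M. k < \<phi> u \<and> l < \<psi> u}"
      unfolding g_def by (metis (mono_tags, lifting) Collect_cong)
    also have "\<dots> = Uset m \<pi> (k, l)"
    proof
      show "\<phi> ` {u \<in> M. k < \<phi> u \<and> l < \<psi> u} \<subseteq> Uset m \<pi> (k, l)" using \<phi>M by (auto simp: Uset_def)
      show "Uset m \<pi> (k, l) \<subseteq> \<phi> ` {u \<in> M. k < \<phi> u \<and> l < \<psi> u}"
      proof
        fix i assume i: "i \<in> Uset m \<pi> (k, l)"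
        then have "i \<in> \<phi> ` M" using \<phi> by (auto simp: Uset_def bij_betw_def)
        then show "i \<in> \<phi> ` {u \<in> M. k < \<phi> u \<and> l < \<psi> u}" using i \<phi>M by (auto simp: Uset_def)
      qed
    qed
    finally show ?thesis .
  qed
  have "inj_on g A" using gle antisym by (auto simp: inj_on_def)
  moreover have "g ` A = Ufam m \<pi>"
  proof
    show "g ` A \<subseteq> Ufam m \<pi>"
    proof
      fix S assume "S \<in> g ` A"
      then obtain a where a: "a \<in> A" "S = g a" by blast
      then have "S = Uset m \<pi> (X a, Y a)" using gjoin[of "X a" "Y a"] join_coords X_le Y_le same_length by simp
      then show "S \<in> Ufam m \<pi>" unfolding Ufam_def grid_def using X_le[OF a(1)] Y_le[OF a(1)] same_length by auto
    qed
    show "Ufam m \<pi> \<subseteq> g ` A"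
    proof
      fix S assume "S \<in> Ufam m \<pi>"
      then obtain k l where kl: "k \<le> m" "l \<le> m" "S = Uset m \<pi> (k, l)" by (auto simp: Ufam_def grid_def)
      then have "S = g (ljoin A le (c k) (d l))" using gjoin by simp
      then show "S \<in> g ` A" using join_closed c_in d_in kl same_length by blast
    qed
  qed
  ultimately have iso: "lat_iso A le (Ufam m \<pi>) (\<supseteq>) g"
    using gle by (auto simp: lat_iso_def bij_betw_def)
  show thesis
  proof (rule that[OF perm iso])
    fix i assume i: "i \<le> m"
    have "ljoin A le (c i) (d 0) = c i"
      using join_commute[of "c i" "d 0"] join_absorb[of "d 0" "c i"] enum_chainD(4)[OF enum_d] c_in[OF i] d_in[of 0] by simp
    then show "g (c i) = Uset m \<pi> (i, 0)" using gjoin[OF i, of 0] by simp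
    have "ljoin A le (c 0) (d i) = d i"
      using join_absorb[of "c 0" "d i"] enum_chainD(4)[OF enum_c] d_in[of i] c_in[of 0] i same_length by simp
    then show "g (d i) = Uset m \<pi> (0, i)" using gjoin[OF _ i, of 0] by simp
  next
    fix i assume "i \<in> {1..m}"
    then have "\<exists>!u. u \<in> M \<and> \<phi> u = i" using \<phi> unfolding bij_betw_def inj_on_def by (metis imageE)
    then show "\<exists>!u. meet_irr A le u \<and> u \<noteq> ltop A le \<and> first_idx le (c ` {..m}) u = i"
      using fst unfolding M_def by (metis (mono_tags, lifting) mem_Collect_eq)
  next
    fix u assume "meet_irr A le u" "u \<noteq> ltop A le"
    then have "u \<in> M" by (simp add: M_def)
    then show "\<pi> (first_idx le (c ` {..m}) u) = first_idx le (d ` {..m'}) u" using fst \<phi>M by simp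
  qed
qed

end

lemma lattice_length_unique: "lattice_length A le n \<Longrightarrow> lattice_length A le m \<Longrightarrow> n = m"
  unfolding lattice_length_def by (metis add_le_cancel_right le_antisym)

lemma ssl_representation:
  assumes "ssl A le" "lattice_length A le n" "maximal_chain A le C" "maximal_chain A le D"
    and J: "\<And>j. join_irr A le j \<Longrightarrow> j \<in> C \<union> D"
  obtains c d \<pi> g where "enum_chain A le c n" "C = c ` {..n}" "enum_chain A le d n" "D = d ` {..n}"
    "\<pi> permutes {1..n}" "lat_iso A le (Ufam n \<pi>) (\<supseteq>) g"
    "\<And>i. i \<le> n \<Longrightarrow> g (c i) = Uset n \<pi> (i, 0)" "\<And>i. i \<le> n \<Longrightarrow> g (d i) = Uset n \<pi> (0, i)"
    "\<And>i. i \<in> {1..n} \<Longrightarrow> \<exists>!u. meet_irr A le u \<and> u \<noteq> ltop A le \<and> first_idx le C u = i"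
    "\<And>u. meet_irr A le u \<Longrightarrow> u \<noteq> ltop A le \<Longrightarrow> \<pi> (first_idx le C u) = first_idx le D u"
proof -
  interpret finlat A le using assms(1) by unfold_locales (simp add: ssl_def)
  obtain c m where c: "enum_chain A le c m" "C = c ` {..m}" using maximal_chain_enum assms(3) by blast
  obtain d m' where d: "enum_chain A le d m'" "D = d ` {..m'}" using maximal_chain_enum assms(4) by blast
  interpret semimodular_two_chains A le c d m m'
    by unfold_locales (use c d J assms(1) in \<open>auto simp: ssl_def\<close>)
  obtain \<pi> g where R: "\<pi> permutes {1..m}" "lat_iso A le (Ufam m \<pi>) (\<supseteq>) g"
    "\<And>i. i \<le> m \<Longrightarrow> g (c i) = Uset m \<pi> (i, 0)" "\<And>i. i \<le> m \<Longrightarrow> g (d i) = Uset m \<pi> (0, i)"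
    "\<And>i. i \<in> {1..m} \<Longrightarrow> \<exists>!u. meet_irr A le u \<and> u \<noteq> ltop A le \<and> first_idx le (c ` {..m}) u = i"
    "\<And>u. meet_irr A le u \<Longrightarrow> u \<noteq> ltop A le \<Longrightarrow> \<pi> (first_idx le (c ` {..m}) u) = first_idx le (d ` {..m'}) u"
    using representation by blast
  interpret r: grid_rep m "Ufam m \<pi>" "\<lambda>i. Uset m \<pi> (i, 0)" "\<lambda>j. Uset m \<pi> (0, j)" A le g
    using grid_family_Ufam[OF R(1)] R(2) by (simp add: grid_rep_def grid_rep_axioms_def)
  have "n = m" using lattice_length_unique assms(2) r.rep_lattice_length by blast
  then show thesis using that[of c d \<pi> g] c d R same_length by simp
qed

text \<open>Dilworth's theorem for width two, by removing a maximal element a and covering the rest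
  T by chains P and Q. Let p and q be the largest elements of P and of Q that are incomparable to
  something in T. They are incomparable to each other, so a lies above one of them, say p; then a
  can be placed on top of the part of P up to p, and what remains is a chain.\<close>

lemma two_chain_cover:
  assumes "finite S" "porder_on S le"
    and "\<And>x y z. x \<in> S \<Longrightarrow> y \<in> S \<Longrightarrow> z \<in> S \<Longrightarrow>
      le x y \<or> le y x \<or> le x z \<or> le z x \<or> le y z \<or> le z y"
  shows "\<exists>P Q. S = P \<union> Q \<and> is_chain S le P \<and> is_chain S le Q"
  using assms
proof (induction S rule: finite_psubset_induct)
  case (psubset S)
  have refl: "\<And>x. x \<in> S \<Longrightarrow> le x x"
    and antisym: "\<And>x y. x \<in> S \<Longrightarrow> y \<in> S \<Longrightarrow> le x y \<Longrightarrow> le y x \<Longrightarrow> x = y"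
    and trans: "\<And>x y z. x \<in> S \<Longrightarrow> y \<in> S \<Longrightarrow> z \<in> S \<Longrightarrow> le x y \<Longrightarrow> le y z \<Longrightarrow> le x z"
    using psubset.prems(1) unfolding porder_on_def by blast+
  have max_ex: "\<exists>x\<in>T. \<forall>y\<in>T. le x y \<longrightarrow> y = x" if "T \<subseteq> S" "T \<noteq> {}" for T
  proof -
    have "finite T" using that psubset.hyps finite_subset by blast
    then show ?thesis using that(2,1)
    proof (induction T rule: finite_ne_induct)
      case (singleton x) then show ?case by simp
    next
      case (insert a T)
      then obtain x where x: "x \<in> T" "\<forall>y\<in>T. le x y \<longrightarrow> y = x" by auto
      have S: "a \<in> S" "T \<subseteq> S" using insert.prems by auto
      show ?case
      proof (cases "le x a")
        case True
        have "\<forall>y\<in>insert a T. le a y \<longrightarrow> y = a"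
        proof (intro ballI impI)
          fix y assume y: "y \<in> insert a T" "le a y"
          show "y = a"
          proof (cases "y = a")
            case False
            then have yT: "y \<in> T" using y by simp
            have "le x y" using trans[of x a y] True y x S yT by blast
            then have "y = x" using x yT by blast
            then show ?thesis using antisym[of x a] True y x S by blast
          qed simp
        qed
        then show ?thesis by blast
      next
        case False then show ?thesis using x by blast
      qed
    qed
  qed
  show ?case
  proof (cases "S = {}")
    case True then show ?thesis by (auto simp: is_chain_def)
  next
    case False
    then obtain a where a: "a \<in> S" "\<And>y. y \<in> S \<Longrightarrow> le a y \<Longrightarrow> y = a" using max_ex[of S] by blast
    define T where "T = S - {a}"
    have TS: "T \<subset> S" "T \<subseteq> S" using a T_def by auto
    have "porder_on T le" using TS(2) refl antisym trans unfolding porder_on_def by blast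
    moreover have "le x y \<or> le y x \<or> le x z \<or> le z x \<or> le y z \<or> le z y" if "x \<in> T" "y \<in> T" "z \<in> T" for x y z
      using psubset.prems(2) that TS by blast
    ultimately obtain P Q where PQ: "T = P \<union> Q" "is_chain T le P" "is_chain T le Q"
      using psubset.IH[OF TS(1)] by blast
    show ?thesis
    proof (cases "is_chain S le T")
      case True
      moreover have "is_chain S le {a}" using a refl by (auto simp: is_chain_def)
      ultimately show ?thesis using a T_def by (intro exI[of _ "{a}"] exI[of _ T]) auto
    next
      case False
      define inc where "inc x y \<longleftrightarrow> \<not> le x y \<and> \<not> le y x" for x y
      define I where "I P = {x \<in> P. \<exists>y\<in>T. inc x y}" for P
      have linP: "\<And>x y. x \<in> P \<Longrightarrow> y \<in> P \<Longrightarrow> \<not> inc x y" and linQ: "\<And>x y. x \<in> Q \<Longrightarrow> y \<in> Q \<Longrightarrow> \<not> inc x y"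
        using PQ unfolding is_chain_def inc_def by blast+
      have inc_sym: "inc x y \<longleftrightarrow> inc y x" for x y by (auto simp: inc_def)
      obtain x y where xy: "x \<in> T" "y \<in> T" "inc x y"
        using False TS unfolding is_chain_def inc_def by blast
      then have ne: "I P \<noteq> {}" "I Q \<noteq> {}" using PQ(1) linP linQ inc_sym unfolding I_def by blast+
      have sub: "I P \<subseteq> S" "I Q \<subseteq> S" using PQ(1) TS unfolding I_def by auto
      obtain p where p: "p \<in> I P" "\<And>z. z \<in> I P \<Longrightarrow> le p z \<Longrightarrow> z = p" using max_ex[OF sub(1) ne(1)] by blast
      obtain q where q: "q \<in> I Q" "\<And>z. z \<in> I Q \<Longrightarrow> le q z \<Longrightarrow> z = q" using max_ex[OF sub(2) ne(2)] by blast
      have ple: "le z p" if "z \<in> I P" for z using that p linP[of z p] sub refl unfolding I_def inc_def by blast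
      have qle: "le z q" if "z \<in> I Q" for z using that q linQ[of z q] sub refl unfolding I_def inc_def by blast
      obtain y where y: "y \<in> T" "inc p y" using p unfolding I_def by blast
      obtain x where x: "x \<in> T" "inc q x" using q unfolding I_def by blast
      have pT: "p \<in> P" "p \<in> T" "p \<in> S" "q \<in> Q" "q \<in> T" "q \<in> S" using p q PQ(1) TS unfolding I_def by auto
      have "y \<in> Q" "x \<in> P" using x y PQ(1) linP[of p y] linQ[of q x] pT by auto
      moreover have "inc y p" "inc x q" using x y inc_sym by blast+
      ultimately have "y \<in> I Q" "x \<in> I P" using pT unfolding I_def by auto
      then have yx: "le y q" "le x p" "y \<in> S" "x \<in> S" using ple qle sub by auto
      \<comment> \<open>Some x in P is incomparable to q, and x lies below p by the choice of p; so
        p below q would put x below q. The converse is symmetric.\<close>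
      have "\<not> le p q" using trans[of x p q] yx x pT unfolding inc_def by blast
      moreover have "\<not> le q p" using trans[of y q p] yx y pT unfolding inc_def by blast
      moreover have "\<not> le a p" "\<not> le a q" using a(2) pT T_def by auto
      ultimately have pqa: "le p a \<or> le q a" using psubset.prems(2)[of a p q] a pT by blast
      have split: "\<exists>K L. S = K \<union> L \<and> is_chain S le K \<and> is_chain S le L"
        if "le p a" and R: "R \<subseteq> T" "\<And>x y. x \<in> R \<Longrightarrow> y \<in> R \<Longrightarrow> le x y \<or> le y x" "p \<in> R"
          and top: "\<And>z. z \<in> I R \<Longrightarrow> le z p"
          and two: "\<And>x y. x \<in> T \<Longrightarrow> y \<in> T \<Longrightarrow> inc x y \<Longrightarrow> x \<in> R \<or> y \<in> R" for p R
      proof -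
        \<comment> \<open>Of any incomparable pair in T one member lies in R, hence below p, hence
          in K. This is why the complement of K is a chain.\<close>
        define K where "K = insert a {z \<in> R. le z p}"
        have RS: "R \<subseteq> S" using R TS by blast
        have "le z a" if "z \<in> R" "le z p" for z using trans[of z p a] that \<open>le p a\<close> R(3) RS a by blast
        then have "is_chain S le K" using R(2) RS a refl unfolding is_chain_def K_def by auto
        moreover have "is_chain S le (S - K)"
          unfolding is_chain_def
        proof (intro conjI ballI)
          fix x y assume xy: "x \<in> S - K" "y \<in> S - K"
          then have T: "x \<in> T" "y \<in> T" using T_def K_def by auto
          show "le x y \<or> le y x"
          proof (rule ccontr)
            assume "\<not> (le x y \<or> le y x)"
            then have "inc x y" "inc y x" by (auto simp: inc_def)
            then have "x \<in> I R \<or> y \<in> I R" using two T unfolding I_def by blast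
            then have "x \<in> K \<or> y \<in> K" using top unfolding K_def I_def by blast
            then show False using xy by blast
          qed
        qed blast
        moreover have "K \<subseteq> S" using RS a K_def by auto
        ultimately show ?thesis by (intro exI[of _ K] exI[of _ "S - K"]) blast
      qed
      have twoP: "x \<in> P \<or> y \<in> P" "x \<in> Q \<or> y \<in> Q" if "x \<in> T" "y \<in> T" "inc x y" for x y
        using that PQ(1) linP linQ by blast+
      from pqa show ?thesis
      proof
        assume "le p a"
        then show ?thesis
          using PQ pT ple twoP(1) by (intro split[of p P]) (auto simp: is_chain_def)
      next
        assume "le q a"
        then show ?thesis
          using PQ pT qle twoP(2) by (intro split[of q Q]) (auto simp: is_chain_def)
      qed
    qed
  qed
qed

lemma (in finlat) slim_two_chains:
  assumes "slim A le"
  obtains C D where "maximal_chain A le C" "maximal_chain A le D" "\<And>j. join_irr A le j \<Longrightarrow> j \<in> C \<union> D"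
proof -
  let ?J = "Collect (join_irr A le)"
  have JA: "?J \<subseteq> A" by (auto simp: join_irr_def)
  have "finite ?J" using JA finite_carrier finite_subset by blast
  moreover have "porder_on ?J le" using JA refl antisym trans unfolding porder_on_def by blast
  moreover have "le x y \<or> le y x \<or> le x z \<or> le z x \<or> le y z \<or> le z y" if "x \<in> ?J" "y \<in> ?J" "z \<in> ?J" for x y z
    using assms that unfolding slim_def by blast
  ultimately obtain P Q where PQ: "?J = P \<union> Q" "is_chain ?J le P" "is_chain ?J le Q"
    using two_chain_cover[of ?J le] by blast
  then have "is_chain A le P" "is_chain A le Q" using JA unfolding is_chain_def by blast+
  then obtain C D where "maximal_chain A le C" "P \<subseteq> C" "maximal_chain A le D" "Q \<subseteq> D"
    using extend_to_maximal_chain by metis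
  then show thesis using that[of C D] PQ(1) by blast
qed

section \<open>Dominance drawings\<close>

text \<open>Reflection in the vertical axis carries the existence and uniqueness of left boundaries,
  and the boundary computation for the drawing, over to the right side.\<close>

definition mirror :: "real \<times> real \<Rightarrow> real \<times> real" where
  "mirror q = (- fst q, snd q)"

lemma mirror_simps [simp]: "fst (mirror q) = - fst q" "snd (mirror q) = snd q" "mirror (mirror q) = q"
  by (simp_all add: mirror_def)

lemma mirror_eq_iff [simp]: "mirror q = mirror r \<longleftrightarrow> q = r"
  by (metis mirror_simps(3))

lemma closed_segment_mirror: "closed_segment (mirror a) (mirror b) = mirror ` closed_segment a b"
proof -
  have "linear mirror" by (rule linearI) (simp_all add: mirror_def)
  then show ?thesis by (rule closed_segment_linear_image)
qed

lemma planar_diagram_mirror: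
  assumes "planar_diagram A le p" shows "planar_diagram A le (mirror \<circ> p)"
proof -
  have "mirror q \<in> mirror ` S \<longleftrightarrow> q \<in> S" for q S by (auto simp: image_iff)
  moreover have "mirror ` S \<inter> mirror ` T \<subseteq> (mirror \<circ> p) ` R \<longleftrightarrow> S \<inter> T \<subseteq> p ` R" for S T R
  proof -
    have "inj mirror" by (auto intro: injI)
    then show ?thesis
      by (metis image_Int image_comp inj_image_subset_iff)
  qed
  moreover have "inj_on (mirror \<circ> p) A" using assms by (auto simp: planar_diagram_def inj_on_def)
  ultimately show ?thesis
    using assms unfolding planar_diagram_def by (simp add: closed_segment_mirror)
qed

lemma chain_pathI:
  "a \<in> C \<Longrightarrow> b \<in> C \<Longrightarrow> covers A le a b \<Longrightarrow> q \<in> closed_segment (p a) (p b) \<Longrightarrow> q \<in> chain_path A le p C"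
  unfolding chain_path_def by blast

lemma chain_pathE:
  assumes "q \<in> chain_path A le p C"
  obtains a b where "a \<in> C" "b \<in> C" "covers A le a b" "q \<in> closed_segment (p a) (p b)"
  using assms unfolding chain_path_def by blast

lemma chain_path_mirror: "chain_path A le (mirror \<circ> p) C = mirror ` chain_path A le p C"
  unfolding chain_path_def by (auto simp: closed_segment_mirror)

lemma left_boundary_mirror: "left_boundary A le (mirror \<circ> p) C \<longleftrightarrow> right_boundary A le p C"
  unfolding right_boundary_def left_boundary_def by (simp add: chain_path_mirror)

text \<open>Both segments leave a in the direction of q. The one on which q has the larger parameter
  is the shorter one, and its end is obtained from the other segment by the ratio of the two
  parameters.\<close>

lemma closed_segments_overlap:
  fixes a b d q :: "'v::real_vector"
  assumes "q \<in> closed_segment a b" "q \<in> closed_segment a d" "q \<noteq> a"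
  shows "d \<in> closed_segment a b \<or> b \<in> closed_segment a d"
proof -
  have aux: "d \<in> closed_segment a b"
    if "0 \<le> s" "s \<le> t" "t \<le> 1" "q = a + s *\<^sub>R (b - a)" "q = a + t *\<^sub>R (d - a)" "q \<noteq> a" for s t b d
  proof -
    have "t > 0" using that by (cases "t = 0") auto
    have "t *\<^sub>R (d - a) = s *\<^sub>R (b - a)" using that by simp
    then have "(1 / t) *\<^sub>R t *\<^sub>R (d - a) = (1 / t) *\<^sub>R s *\<^sub>R (b - a)" by simp
    then have "d - a = (s / t) *\<^sub>R (b - a)" using \<open>t > 0\<close> by simp
    then have "d = (1 - s / t) *\<^sub>R a + (s / t) *\<^sub>R b"
      by (simp add: algebra_simps)
    moreover have "0 \<le> s / t" "s / t \<le> 1" using that \<open>t > 0\<close> by auto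
    ultimately show ?thesis unfolding in_segment by blast
  qed
  obtain s where s: "0 \<le> s" "s \<le> 1" "q = a + s *\<^sub>R (b - a)"
    using assms(1) unfolding in_segment by (auto simp: algebra_simps)
  obtain t where t: "0 \<le> t" "t \<le> 1" "q = a + t *\<^sub>R (d - a)"
    using assms(2) unfolding in_segment by (auto simp: algebra_simps)
  show ?thesis using aux[of s t b d] aux[of t s d b] s t assms(3) by (metis linear)
qed

text \<open>The product order of the plane turned by 45 degrees, so that larger elements are drawn
  higher.\<close>

definition dominated :: "real \<times> real \<Rightarrow> real \<times> real \<Rightarrow> bool" where
  "dominated q r \<longleftrightarrow> snd q - fst q \<le> snd r - fst r \<and> snd q + fst q \<le> snd r + fst r"

lemma dominated_trans: "dominated q r \<Longrightarrow> dominated r s \<Longrightarrow> dominated q s"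
  by (auto simp: dominated_def)

lemma dominated_antisym: "dominated q r \<Longrightarrow> dominated r q \<Longrightarrow> q = r"
  by (auto simp: dominated_def prod_eq_iff)

lemma dominated_segment:
  assumes "dominated a b" "q \<in> closed_segment a b"
  shows "dominated a q" "dominated q b"
proof -
  obtain u where u: "0 \<le> u" "u \<le> 1" "q = (1 - u) *\<^sub>R a + u *\<^sub>R b" using assms(2) by (auto simp: in_segment)
  let ?s = "(snd b - fst b) - (snd a - fst a)" and ?t = "(snd b + fst b) - (snd a + fst a)"
  have st: "0 \<le> ?s" "0 \<le> ?t" using assms(1) by (auto simp: dominated_def)
  have q: "snd q - fst q = (snd a - fst a) + u * ?s" "snd q - fst q = (snd b - fst b) - (1 - u) * ?s"
    "snd q + fst q = (snd a + fst a) + u * ?t" "snd q + fst q = (snd b + fst b) - (1 - u) * ?t"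
    unfolding u(3) by (simp_all add: algebra_simps)
  have "0 \<le> u * ?s" "0 \<le> (1 - u) * ?s" "0 \<le> u * ?t" "0 \<le> (1 - u) * ?t"
    using u st by (intro mult_nonneg_nonneg; simp)+
  then show "dominated a q" "dominated q b" unfolding dominated_def using q by linarith+
qed

text \<open>A common point of the edges ab and cd lies above a and c and below b and d, so a \<le> d
  and c \<le> b. Then a \<or> c is squeezed into both coverings and is an end of each, and the edges
  share a vertex. With a common lower or upper end, a further common point would make the segments
  overlap and put a vertex on a foreign edge.\<close>

lemma planar_diagram_dominance:
  assumes fl: "fin_lattice A le" and dom: "\<And>a b. a \<in> A \<Longrightarrow> b \<in> A \<Longrightarrow> le a b \<longleftrightarrow> dominated (p a) (p b)"
  shows "planar_diagram A le p"
proof -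
  interpret finlat A le by unfold_locales (rule fl)
  have inj: "inj_on p A"
    by (rule inj_onI) (metis antisym dom refl)
  have between: "le a x \<and> le x b" if "le a b" "a \<in> A" "b \<in> A" "x \<in> A" "p x \<in> closed_segment (p a) (p b)" for a b x
    using that dom dominated_segment by blast
  show ?thesis
    unfolding planar_diagram_def
  proof (intro conjI allI impI)
    fix a b assume ab: "covers A le a b"
    then have "a \<in> A" "b \<in> A" "dominated (p a) (p b)" "p a \<noteq> p b"
      using dom inj by (auto simp: covers_def inj_on_def)
    then show "snd (p a) < snd (p b)" by (auto simp: dominated_def prod_eq_iff)
  next
    fix a b x assume ab: "covers A le a b" and x: "x \<in> A" "x \<noteq> a" "x \<noteq> b"
    show "p x \<notin> closed_segment (p a) (p b)"
    proof
      assume "p x \<in> closed_segment (p a) (p b)"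
      then have "le a x \<and> le x b" using between[of a b x] ab x by (auto simp: covers_def)
      then show False using ab x by (auto simp: covers_def)
    qed
  next
    fix a b c d assume ab: "covers A le a b" and cd: "covers A le c d" and ne: "(a, b) \<noteq> (c, d)"
    have A: "a \<in> A" "b \<in> A" "c \<in> A" "d \<in> A" "le a b" "le c d" using ab cd by (auto simp: covers_def)
    have D: "dominated (p a) (p b)" "dominated (p c) (p d)" using A dom by blast+
    show "closed_segment (p a) (p b) \<inter> closed_segment (p c) (p d) \<subseteq> p ` ({a, b} \<inter> {c, d})"
    proof
      fix q assume "q \<in> closed_segment (p a) (p b) \<inter> closed_segment (p c) (p d)"
      then have q: "q \<in> closed_segment (p a) (p b)" "q \<in> closed_segment (p c) (p d)" by auto
      note aq = dominated_segment[OF D(1) q(1)] and cq = dominated_segment[OF D(2) q(2)]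
      have "le a d" "le c b" using aq cq dominated_trans dom A by blast+
      let ?j = "ljoin A le a c"
      have j: "?j \<in> A" "le a ?j" "le c ?j" "le ?j b" "le ?j d"
        using A \<open>le a d\<close> \<open>le c b\<close> join_closed join_ub1 join_ub2 join_least by auto
      have "?j = a \<or> ?j = b" "?j = c \<or> ?j = d" using j ab cd by (auto simp: covers_def)
      then consider "a = c" | "a = d" | "b = c" | "b = d" by metis
      then show "q \<in> p ` ({a, b} \<inter> {c, d})"
      proof cases
        case 1
        have "q = p a"
        proof (rule ccontr)
          assume "q \<noteq> p a"
          then have "p d \<in> closed_segment (p a) (p b) \<or> p b \<in> closed_segment (p a) (p d)"
            using closed_segments_overlap q 1 by blast
          then have "le d b \<or> le b d" using between[of a b d] between[of a d b] A 1 by blast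
          then show False using ab cd 1 ne unfolding covers_def by blast
        qed
        then show ?thesis using 1 by auto
      next
        case 2
        then have "q = p a" using aq cq dominated_antisym by blast
        then show ?thesis using 2 by auto
      next
        case 3
        then have "q = p b" using aq cq dominated_antisym by blast
        then show ?thesis using 3 by auto
      next
        case 4
        have "q = p b"
        proof (rule ccontr)
          assume "q \<noteq> p b"
          moreover have "q \<in> closed_segment (p b) (p a)" "q \<in> closed_segment (p b) (p c)"
            using q 4 by (auto simp: closed_segment_commute)
          ultimately have "p c \<in> closed_segment (p b) (p a) \<or> p a \<in> closed_segment (p b) (p c)"
            using closed_segments_overlap by blast
          then have "le a c \<or> le c a"
            using between[of a b c] between[of c b a] A 4 by (auto simp: closed_segment_commute)
          then show False using ab cd 4 ne unfolding covers_def by blast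
        qed
        then show ?thesis using 4 by auto
      qed
    qed
  qed (use fl inj in auto)
qed

lemma (in finlat) enum_chain_maximal:
  assumes c: "enum_chain A le c m" shows "maximal_chain A le (c ` {..m})"
  unfolding maximal_chain_def
proof (intro conjI allI impI)
  show "is_chain A le (c ` {..m})"
    unfolding is_chain_def using enum_chainD(1,2)[OF c] by (auto simp: nat_le_linear)
  fix D assume D: "is_chain A le D \<and> c ` {..m} \<subseteq> D"
  have "x \<in> c ` {..m}" if x: "x \<in> D" for x
  proof -
    have xA: "x \<in> A" using D x by (auto simp: is_chain_def)
    obtain k where k: "k \<le> m" "\<And>i. i \<le> m \<Longrightarrow> le (c i) x \<longleftrightarrow> i \<le> k" using enum_chain_locate[OF c xA] by blast
    show ?thesis
    proof (cases "k = m")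
      case True
      then have "x = c m" using k antisym enum_chainD(5)[OF c] xA enum_chainD(1)[OF c] by simp
      then show ?thesis by simp
    next
      case False
      then have "k < m" using k by simp
      then have "c (Suc k) \<in> D" "\<not> le (c (Suc k)) x" using k D by auto
      then have "le x (c (Suc k))" using D x unfolding is_chain_def by blast
      moreover have "le (c k) x" using k by simp
      ultimately have "x = c k \<or> x = c (Suc k)"
        using enum_chainD(3)[OF c \<open>k < m\<close>] xA unfolding covers_def by blast
      then show ?thesis using \<open>k < m\<close> by auto
    qed
  qed
  then show "D = c ` {..m}" using D by blast
qed

context two_chains begin

text \<open>Chosen so that the two forms in \<open>dominated\<close> become 2 X a and 2 Y a; the
  height is X + Y, and elements with large X lie to the left.\<close>

definition drawing :: "'a \<Rightarrow> real \<times> real" where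
  "drawing a = (real (Y a) - real (X a), real (X a) + real (Y a))"

lemma planar_drawing: "planar_diagram A le drawing"
  by (rule planar_diagram_dominance[OF fin_lattice])
    (auto simp: le_iff_coords dominated_def drawing_def)

text \<open>At height H, the path of c at parameter u on the edge from \<open>c i\<close> has first
  coordinate H - 2 (i + u), while x has H - 2 X x. So it suffices to find an edge of c reaching the
  height of x with \<open>X x \<le> i + u\<close>.\<close>

lemma left_boundary_drawing:
  assumes "m \<ge> 1" shows "left_boundary A le drawing (c ` {..m})"
  unfolding left_boundary_def
proof (intro conjI ballI)
  show "maximal_chain A le (c ` {..m})" by (rule enum_chain_maximal[OF enum_c])
  fix x assume x: "x \<in> A"
  define H where "H = X x + Y x"
  define h where "h i = i + Y (c i)" for i
  have snd_c: "drawing (c i) = (real (h i) - 2 * real i, real (h i))" if "i \<le> m" for i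
    using lev_enum[OF enum_c that] by (simp add: drawing_def h_def)
  have Ymono: "Y a \<le> Y b" if "le a b" "a \<in> A" "b \<in> A" for a b using le_iff_coords that by blast
  \<comment> \<open>The last alternative is the top element: no edge starts at index m, so the last
    edge is used at its upper end, where u = 1. Otherwise i is the largest index from X x on whose
    vertex is not higher than x.\<close>
  have "\<exists>i<m. h i \<le> H \<and> H \<le> h (Suc i) \<and> (X x \<le> i \<or> X x = m \<and> H = h (Suc i) \<and> Suc i = m)"
  proof (cases "X x = m")
    case True
    then have "x = c m" using le_iff_X[OF x, of m] antisym enum_chainD(5)[OF enum_c x] x c_in by simp
    then have "H = h m" using True by (simp add: H_def h_def)
    moreover have "h (m - 1) \<le> h m" using Ymono[of "c (m - 1)" "c m"] c_le_iff c_in by (simp add: h_def add_mono)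
    ultimately show ?thesis using True assms by (intro exI[of _ "m - 1"]) auto
  next
    case False
    then have "X x < m" using X_le[OF x] by simp
    define S where "S = {i. X x \<le> i \<and> i < m \<and> h i \<le> H}"
    have "finite S" by (simp add: S_def)
    have "le (c (X x)) x" using le_iff_X[OF x X_le[OF x]] by simp
    then have "X x \<in> S" using Ymono[of "c (X x)" x] c_in X_le[OF x] x \<open>X x < m\<close> by (simp add: h_def H_def S_def)
    then have M: "Max S \<in> S" using \<open>finite S\<close> by (intro Max_in) auto
    have "H \<le> h (Suc (Max S))"
    proof (cases "Suc (Max S) = m")
      case True
      then show ?thesis using Ymono[OF enum_chainD(5)[OF enum_c x] x] c_in X_le[OF x] by (simp add: h_def H_def)
    next
      case False
      have "Suc (Max S) \<notin> S" using Max_ge[OF \<open>finite S\<close>, of "Suc (Max S)"] by linarith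
      then show ?thesis using M False by (auto simp: S_def)
    qed
    then show ?thesis using M by (intro exI[of _ "Max S"]) (auto simp: S_def)
  qed
  then obtain i where i: "i < m" "h i \<le> H" "H \<le> h (Suc i)" "X x \<le> i \<or> X x = m \<and> H = h (Suc i) \<and> Suc i = m" by blast
  have cA: "c i \<in> A" "c (Suc i) \<in> A" "le (c i) (c (Suc i))" using c_in c_le_iff i by auto
  have "h i < h (Suc i)" using Ymono[OF cA(3,1,2)] by (simp add: h_def)
  define u where "u = (real H - real (h i)) / (real (h (Suc i)) - real (h i))"
  have pos: "real (h (Suc i)) - real (h i) > 0" using \<open>h i < h (Suc i)\<close> by simp
  have u: "0 \<le> u" "u \<le> 1" "u * (real (h (Suc i)) - real (h i)) = real H - real (h i)"
    using i pos by (auto simp: u_def divide_simps)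
  define q where "q = (1 - u) *\<^sub>R drawing (c i) + u *\<^sub>R drawing (c (Suc i))"
  have "q \<in> closed_segment (drawing (c i)) (drawing (c (Suc i)))" using u by (auto simp: in_segment q_def)
  moreover have "covers A le (c i) (c (Suc i))" by (rule enum_chainD(3)[OF enum_c i(1)])
  ultimately have qp: "q \<in> chain_path A le drawing (c ` {..m})"
    using i(1) by (intro chain_pathI[of "c i" _ "c (Suc i)"]) auto
  have snd: "snd q = real H"
    unfolding q_def using snd_c[of i] snd_c[of "Suc i"] i(1) u(3) by (simp add: algebra_simps)
  have fst: "fst q = real H - 2 * (real i + u)"
  proof -
    have "fst q = snd q - 2 * ((1 - u) * real i + u * real (Suc i))"
      unfolding q_def using snd_c[of i] snd_c[of "Suc i"] i(1) by (simp add: algebra_simps)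
    then show ?thesis using snd by (simp add: algebra_simps)
  qed
  have "real (X x) \<le> real i + u"
  proof (cases "X x \<le> i")
    case True then show ?thesis using u by simp
  next
    case False
    then have "u = 1" "X x = Suc i" using i pos by (auto simp: u_def)
    then show ?thesis by simp
  qed
  then have "fst q \<le> fst (drawing x)" using fst by (simp add: drawing_def H_def)
  moreover have "snd q = snd (drawing x)" using snd by (simp add: drawing_def H_def)
  ultimately show "\<exists>q\<in>chain_path A le drawing (c ` {..m}). snd q = snd (drawing x) \<and> fst q \<le> fst (drawing x)"
    using qp by blast
qed

lemma right_boundary_drawing:
  assumes "m' \<ge> 1" shows "right_boundary A le drawing (d ` {..m'})"
proof -
  interpret s: two_chains A le d c m' m by (rule two_chains_swap)
  have "s.drawing = mirror \<circ> drawing" by (auto simp: fun_eq_iff drawing_def s.drawing_def mirror_def)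
  then show ?thesis using s.left_boundary_drawing[OF assms] left_boundary_mirror by metis
qed

end

lemma ex_planar_diagram:
  assumes fl: "fin_lattice A le" and len: "lattice_length A le n" and n: "n \<ge> 1"
    and C: "maximal_chain A le C" and D: "maximal_chain A le D"
    and J: "\<And>j. join_irr A le j \<Longrightarrow> j \<in> C \<union> D"
  shows "\<exists>p. planar_diagram A le p \<and> left_boundary A le p C \<and> right_boundary A le p D"
proof -
  interpret finlat A le by unfold_locales (rule fl)
  obtain c m where c: "enum_chain A le c m" "C = c ` {..m}" using maximal_chain_enum C by blast
  obtain d m' where d: "enum_chain A le d m'" "D = d ` {..m'}" using maximal_chain_enum D by blast
  interpret two_chains A le c d m m'
    by unfold_locales (use c d J in auto)
  have bot: "m \<ge> 1" if "enum_chain A le c m" for c m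
  proof (rule ccontr)
    assume "\<not> m \<ge> 1"
    then have "m = 0" by simp
    then have "x = c 0" if "x \<in> A" for x
      using \<open>enum_chain A le c m\<close> that antisym[of x "c 0"] by (auto simp: enum_chain_def)
    then have sub: "K \<subseteq> {c 0}" if "is_chain A le K" for K using that by (auto simp: is_chain_def)
    obtain K where "is_chain A le K" "card K = n + 1" using len by (auto simp: lattice_length_def)
    then show False using card_mono[OF _ sub, of K] n by simp
  qed
  show ?thesis
    using planar_drawing left_boundary_drawing[OF bot[OF c(1)]] right_boundary_drawing[OF bot[OF d(1)]] c d by blast
qed

section \<open>Boundary chains of planar diagrams\<close>

lemma nat_step_between:
  fixes f :: "nat \<Rightarrow> real"
  assumes "f 0 \<le> t" "t \<le> f m" "0 < m"
  obtains i where "i < m" "f i \<le> t" "t \<le> f (Suc i)"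
proof -
  have "\<exists>i<m. f i \<le> t \<and> t \<le> f (Suc i)"
    using assms(2,3)
  proof (induction m)
    case 0 then show ?case by simp
  next
    case (Suc m)
    show ?case
    proof (cases "t \<le> f m \<and> 0 < m")
      case True then show ?thesis using Suc.IH less_SucI by blast
    next
      case False
      then have "f m \<le> t" using assms(1) by (cases "m = 0") auto
      then show ?thesis using Suc.prems by blast
    qed
  qed
  then show thesis using that by blast
qed

text \<open>A lattice contained in a single point has no coverings, so all its chain paths would be
  empty; \<open>nontrivial\<close> makes every maximal chain contain an edge.\<close>

locale diagram = finlat A le for A :: "'a set" and le +
  fixes p :: "'a \<Rightarrow> real \<times> real"
  assumes planar: "planar_diagram A le p" and nontrivial: "\<not> (\<exists>z. A \<subseteq> {z})"
begin

lemma mirror: "diagram A le (mirror \<circ> p)"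
  using planar_diagram_mirror[OF planar] nontrivial by unfold_locales

abbreviation h :: "'a \<Rightarrow> real" where "h x \<equiv> snd (p x)"

lemma covers_h: "covers A le a b \<Longrightarrow> h a < h b"
  using planar by (simp add: planar_diagram_def)

lemma vertex_on_edge:
  "covers A le a b \<Longrightarrow> x \<in> A \<Longrightarrow> p x \<in> closed_segment (p a) (p b) \<Longrightarrow> x = a \<or> x = b"
  using planar unfolding planar_diagram_def by blast

lemma edges_meet:
  assumes "covers A le a b" "covers A le c d" "(a, b) \<noteq> (c, d)"
    "q \<in> closed_segment (p a) (p b)" "q \<in> closed_segment (p c) (p d)"
  shows "q = p a \<or> q = p b"
proof -
  have "closed_segment (p a) (p b) \<inter> closed_segment (p c) (p d) \<subseteq> p ` ({a, b} \<inter> {c, d})"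
    using planar assms(1-3) by (simp add: planar_diagram_def)
  then show ?thesis using assms(4,5) by blast
qed

lemma less_h: "le a b \<Longrightarrow> a \<noteq> b \<Longrightarrow> a \<in> A \<Longrightarrow> b \<in> A \<Longrightarrow> h a < h b"
proof (induction "card {z \<in> A. le z b}" arbitrary: b rule: less_induct)
  case less
  obtain x where x: "covers A le x b" "le a x" using ex_cover_below less.prems by blast
  have xA: "x \<in> A" "le x b" "x \<noteq> b" using x by (auto simp: covers_def)
  have "h x < h b" using covers_h x by blast
  moreover have "a = x \<or> h a < h x"
    using less.hyps[OF card_down_less[of x b]] x xA less.prems by blast
  ultimately show ?case by auto
qed

lemma le_h: "le a b \<Longrightarrow> a \<in> A \<Longrightarrow> b \<in> A \<Longrightarrow> h a \<le> h b"
  using less_h[of a b] by (cases "a = b") auto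

definition heights :: "real set" where
  "heights = {t. \<exists>x\<in>A. \<exists>y\<in>A. h x \<le> t \<and> t \<le> h y}"

lemma h_in_heights: "x \<in> A \<Longrightarrow> h x \<in> heights" by (auto simp: heights_def)

lemma heights_between: "a \<in> A \<Longrightarrow> b \<in> A \<Longrightarrow> h a \<le> t \<Longrightarrow> t \<le> h b \<Longrightarrow> t \<in> heights"
  by (auto simp: heights_def)

text \<open>The horizontal coordinate of the edge at height t by linear interpolation; for a
  covering pair the denominator is positive.\<close>

definition edge_x :: "'a \<Rightarrow> 'a \<Rightarrow> real \<Rightarrow> real" where
  "edge_x a b t = fst (p a) + (t - h a) / (h b - h a) * (fst (p b) - fst (p a))"

lemma edge_x_ends: "covers A le a b \<Longrightarrow> edge_x a b (h a) = fst (p a)" "covers A le a b \<Longrightarrow> edge_x a b (h b) = fst (p b)"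
  using covers_h[of a b] by (auto simp: edge_x_def)

lemma segment_iff:
  assumes "covers A le a b"
  shows "q \<in> closed_segment (p a) (p b) \<longleftrightarrow> h a \<le> snd q \<and> snd q \<le> h b \<and> fst q = edge_x a b (snd q)"
proof
  note hab = covers_h[OF assms]
  assume "q \<in> closed_segment (p a) (p b)"
  then obtain u where u: "0 \<le> u" "u \<le> 1" "q = (1 - u) *\<^sub>R p a + u *\<^sub>R p b" by (auto simp: in_segment)
  have sq: "snd q = h a + u * (h b - h a)" "fst q = fst (p a) + u * (fst (p b) - fst (p a))"
    unfolding u(3) by (simp_all add: algebra_simps)
  then have "(snd q - h a) / (h b - h a) = u" using hab by simp
  then have "fst q = edge_x a b (snd q)" unfolding edge_x_def sq(2) by simp
  moreover have "0 \<le> u * (h b - h a)" "u * (h b - h a) \<le> 1 * (h b - h a)"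
    using u hab by (auto intro: mult_right_mono)
  ultimately show "h a \<le> snd q \<and> snd q \<le> h b \<and> fst q = edge_x a b (snd q)" using sq(1) by simp
next
  note hab = covers_h[OF assms]
  assume q: "h a \<le> snd q \<and> snd q \<le> h b \<and> fst q = edge_x a b (snd q)"
  define u where "u = (snd q - h a) / (h b - h a)"
  have "0 \<le> u" "u \<le> 1" using q hab by (auto simp: u_def)
  moreover have "u * (h b - h a) = snd q - h a" using hab by (simp add: u_def)
  then have "q = (1 - u) *\<^sub>R p a + u *\<^sub>R p b"
    using q by (simp add: prod_eq_iff edge_x_def u_def[symmetric] algebra_simps)
  ultimately show "q \<in> closed_segment (p a) (p b)" unfolding in_segment by blast
qed

section \<open>Paths of maximal chains as continuous functions of the height\<close>

definition xpos :: "'a set \<Rightarrow> real \<Rightarrow> real" where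
  "xpos E t = (THE x. (x, t) \<in> chain_path A le p E)"

text \<open>Heights increase along the order, so the edges of a chain occupy successive height
  intervals. Two different edges can share a height only at a common vertex.\<close>

lemma chain_path_unique:
  assumes E: "maximal_chain A le E" and q: "(x, t) \<in> chain_path A le p E" "(y, t) \<in> chain_path A le p E"
  shows "x = y"
proof -
  note lin = maximal_chainD(2)[OF E] and EA = maximal_chainD(1)[OF E]
  have ordered: "x = y" if "a \<in> E" "b \<in> E" "covers A le a b" "(x, t) \<in> closed_segment (p a) (p b)"
    "a' \<in> E" "b' \<in> E" "covers A le a' b'" "(y, t) \<in> closed_segment (p a') (p b')" "le a a'"
    for a b a' b' x y
  proof -
    have ab: "h a \<le> t" "t \<le> h b" "x = edge_x a b t" "h a' \<le> t" "t \<le> h b'" "y = edge_x a' b' t"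
      using that segment_iff by auto
    show ?thesis
    proof (cases "a = a'")
      case True
      have "b = b'" using lin[of b b'] that True unfolding covers_def by blast
      then show ?thesis using True ab by simp
    next
      case False
      have "le b a'" using lin[of b a'] that False refl EA unfolding covers_def by blast
      then have "h b \<le> h a'" using le_h that EA by blast
      then have t: "t = h b" "t = h a'" using ab by auto
      then have "b = a'" using less_h[OF \<open>le b a'\<close>] that EA by auto
      then show ?thesis using ab edge_x_ends that t by simp
    qed
  qed
  obtain a b where a: "a \<in> E" "b \<in> E" "covers A le a b" "(x, t) \<in> closed_segment (p a) (p b)"
    using q(1) by (rule chain_pathE)
  obtain a' b' where a': "a' \<in> E" "b' \<in> E" "covers A le a' b'" "(y, t) \<in> closed_segment (p a') (p b')"
    using q(2) by (rule chain_pathE)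
  show ?thesis using lin[OF a(1) a'(1)] ordered[OF a a'] ordered[OF a' a] by auto
qed

lemma enum_chain_pos: "enum_chain A le c m \<Longrightarrow> 0 < m"
proof (rule ccontr)
  assume c: "enum_chain A le c m" "\<not> 0 < m"
  then have "m = 0" by simp
  then have "x = c 0" if "x \<in> A" for x
    by (intro antisym) (use enum_chainD(1,4,5)[OF c(1)] that in auto)
  then have "A \<subseteq> {c 0}" by blast
  then show False using nontrivial by blast
qed

lemma vertex_in_path:
  assumes E: "maximal_chain A le E" and x: "x \<in> E"
  shows "p x \<in> chain_path A le p E"
proof -
  obtain c m where c: "enum_chain A le c m" "E = c ` {..m}" using maximal_chain_enum E by blast
  obtain i where i: "x = c i" "i \<le> m" using x c(2) by auto
  have "0 < m" using enum_chain_pos c by blast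
  show ?thesis
  proof (cases "i < m")
    case True
    then show ?thesis using chain_pathI[of "c i" E "c (Suc i)" A le] enum_chainD(3)[OF c(1)] c(2) i by auto
  next
    case False
    then have "i = m" using i by simp
    then show ?thesis
      using chain_pathI[of "c (m - 1)" E "c m" A le] enum_chainD(3)[OF c(1), of "m - 1"] c(2) i \<open>0 < m\<close> by auto
  qed
qed

lemma ex_path_point:
  assumes E: "maximal_chain A le E" and t: "t \<in> heights"
  shows "\<exists>x. (x, t) \<in> chain_path A le p E"
proof -
  obtain c m where c: "enum_chain A le c m" "E = c ` {..m}" using maximal_chain_enum E by blast
  obtain x y where xy: "x \<in> A" "y \<in> A" "h x \<le> t" "t \<le> h y" using t by (auto simp: heights_def)
  have "h (c 0) \<le> h x" "h y \<le> h (c m)" using le_h enum_chainD[OF c(1)] xy by auto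
  then obtain i where i: "i < m" "h (c i) \<le> t" "t \<le> h (c (Suc i))"
    using nat_step_between[of "\<lambda>i. h (c i)" t m] enum_chain_pos[OF c(1)] xy by auto
  have "(edge_x (c i) (c (Suc i)) t, t) \<in> chain_path A le p E"
    using i c segment_iff[OF enum_chainD(3)[OF c(1) i(1)]] enum_chainD(3)[OF c(1) i(1)]
    by (intro chain_pathI[of "c i" _ "c (Suc i)"]) auto
  then show ?thesis by blast
qed

lemma xpos_iff:
  assumes E: "maximal_chain A le E" and t: "t \<in> heights"
  shows "(x, t) \<in> chain_path A le p E \<longleftrightarrow> x = xpos E t"
proof -
  obtain y where y: "(y, t) \<in> chain_path A le p E" using ex_path_point assms by blast
  then have "xpos E t = y" unfolding xpos_def using chain_path_unique[OF E] by blast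
  then show ?thesis using y chain_path_unique[OF E] by blast
qed

lemma path_snd:
  assumes "E \<subseteq> A" "q \<in> chain_path A le p E" shows "snd q \<in> heights"
proof -
  obtain a b where "a \<in> E" "b \<in> E" "covers A le a b" "q \<in> closed_segment (p a) (p b)"
    using assms(2) by (rule chain_pathE)
  then show ?thesis using segment_iff assms(1) heights_between by blast
qed

text \<open>The path is a finite union of segments, hence compact, and projection to the height is
  injective on it; a continuous injection from a compact set has a continuous inverse.\<close>

lemma continuous_xpos:
  assumes E: "maximal_chain A le E" shows "continuous_on heights (xpos E)"
proof -
  let ?R = "chain_path A le p E"
  note EA = maximal_chainD(1)[OF E]
  have "?R = (\<Union>(a, b)\<in>{(a, b). a \<in> E \<and> b \<in> E \<and> covers A le a b}. closed_segment (p a) (p b))"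
    unfolding chain_path_def by blast
  moreover have "finite {(a, b). a \<in> E \<and> b \<in> E \<and> covers A le a b}"
    by (rule finite_subset[of _ "E \<times> E"]) (use maximal_chainD(3)[OF E] in auto)
  ultimately have "compact ?R" by (auto intro!: compact_UN)
  moreover have "(xpos E (snd q), snd q) = q" if "q \<in> ?R" for q
    using that xpos_iff[OF E path_snd[OF EA that], of "fst q"] by (simp add: prod_eq_iff)
  ultimately have "continuous_on (snd ` ?R) (\<lambda>t. (xpos E t, t))"
    by (intro continuous_on_inv) (auto intro: continuous_intros)
  moreover have "snd ` ?R = heights"
    using path_snd[OF EA] ex_path_point[OF E] by (auto simp: image_iff) (metis snd_conv surj_pair)+
  ultimately have "continuous_on heights (\<lambda>t. fst (xpos E t, t))" by (intro continuous_on_fst) simp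
  then show ?thesis by simp
qed

lemma edge_in_path:
  assumes E: "maximal_chain A le E" and ab: "a \<in> E" "b \<in> E" "covers A le a b" and t: "h a \<le> t" "t \<le> h b"
  shows "edge_x a b t = xpos E t"
proof -
  have "(edge_x a b t, t) \<in> chain_path A le p E"
    using ab t segment_iff[OF ab(3)] by (intro chain_pathI[OF ab]) auto
  then show ?thesis using xpos_iff[OF E] heights_between t ab maximal_chainD(1)[OF E] by (meson subsetD)
qed

text \<open>A vertex on the path lies on some edge of E, and in a planar diagram an edge passes
  through no vertex other than its ends.\<close>

lemma vertex_iff:
  assumes E: "maximal_chain A le E" and x: "x \<in> A"
  shows "x \<in> E \<longleftrightarrow> fst (p x) = xpos E (h x)"
proof -
  have "p x \<in> chain_path A le p E \<longleftrightarrow> fst (p x) = xpos E (h x)"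
    using xpos_iff[OF E h_in_heights[OF x], of "fst (p x)"] by simp
  moreover have "x \<in> E" if "p x \<in> chain_path A le p E"
    using that by (rule chain_pathE) (use vertex_on_edge x in blast)
  ultimately show ?thesis using vertex_in_path[OF E] by blast
qed

section \<open>The two sides of a maximal chain\<close>

definition lft :: "'a set \<Rightarrow> 'a \<Rightarrow> bool" where "lft E x \<longleftrightarrow> fst (p x) < xpos E (h x)"
definition rgt :: "'a set \<Rightarrow> 'a \<Rightarrow> bool" where "rgt E x \<longleftrightarrow> xpos E (h x) < fst (p x)"

lemma side_cases:
  assumes "maximal_chain A le E" "x \<in> A"
  shows "x \<in> E \<longleftrightarrow> \<not> lft E x \<and> \<not> rgt E x"
  using vertex_iff[OF assms] by (auto simp: lft_def rgt_def)

text \<open>By the intermediate value theorem the edge would meet the path of E at a height strictly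
  between s and t, hence at an inner point of the edge. Planarity leaves only the case that the edge
  itself belongs to E, and then it never departs from the path.\<close>

lemma edge_on_one_side:
  assumes E: "maximal_chain A le E" and ab: "covers A le a b"
    and s: "h a \<le> s" "s \<le> h b" "edge_x a b s < xpos E s"
    and t: "h a \<le> t" "t \<le> h b" "xpos E t < edge_x a b t"
  shows False
proof -
  let ?f = "\<lambda>r. edge_x a b r - xpos E r"
  have A: "a \<in> A" "b \<in> A" using ab by (auto simp: covers_def)
  have "{h a..h b} \<subseteq> heights" using heights_between A by auto
  then have "continuous_on {h a..h b} (xpos E)" using continuous_on_subset[OF continuous_xpos[OF E]] by blast
  then have "continuous_on {h a..h b} ?f"
    unfolding edge_x_def using covers_h[OF ab] by (intro continuous_intros) auto
  then have cont: "continuous_on {u..v} ?f" if "h a \<le> u" "v \<le> h b" for u v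
    by (rule continuous_on_subset) (use that in auto)
  obtain r where r: "h a \<le> r" "r \<le> h b" "r \<noteq> h a" "r \<noteq> h b" "?f r = 0"
  proof (cases "s \<le> t")
    case True
    obtain r where "s \<le> r" "r \<le> t" "?f r = 0"
      using IVT'[of ?f s 0 t] True cont[of s t] s t by auto
    then show thesis using that[of r] s t by (cases "r = s"; cases "r = t") auto
  next
    case False
    obtain r where "t \<le> r" "r \<le> s" "?f r = 0"
      using IVT2'[of ?f s 0 t] False cont[of t s] s t by auto
    then show thesis using that[of r] s t by (cases "r = s"; cases "r = t") auto
  qed
  have q: "(edge_x a b r, r) \<in> closed_segment (p a) (p b)" using segment_iff[OF ab] r by simp
  have "(edge_x a b r, r) \<in> chain_path A le p E"
    using xpos_iff[OF E heights_between[OF A r(1,2)]] r by simp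
  then obtain a' b' where E': "a' \<in> E" "b' \<in> E" "covers A le a' b'" "(edge_x a b r, r) \<in> closed_segment (p a') (p b')"
    by (rule chain_pathE)
  show False
  proof (cases "(a, b) = (a', b')")
    case True
    then show False using edge_in_path[OF E _ _ ab s(1,2)] E' s by simp
  next
    case False
    then have "(edge_x a b r, r) = p a \<or> (edge_x a b r, r) = p b" using edges_meet ab E' q by blast
    then show False using r by (metis snd_conv)
  qed
qed

lemma cover_sides:
  assumes E: "maximal_chain A le E" and ab: "covers A le a b"
  shows "\<not> (lft E a \<and> rgt E b)" "\<not> (rgt E a \<and> lft E b)"
  using edge_on_one_side[OF E ab, of "h a" "h b"] edge_on_one_side[OF E ab, of "h b" "h a"]
    covers_h[OF ab] edge_x_ends[OF ab] by (auto simp: lft_def rgt_def)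

text \<open>Descend from w to y through coverings. The two ends are not on the same side and a
  single covering cannot jump from one side to the other, so some element on the way lies on
  E.\<close>

lemma crossing:
  assumes E: "maximal_chain A le E"
  shows "le y w \<Longrightarrow> y \<in> A \<Longrightarrow> w \<in> A \<Longrightarrow> lft E y \<and> \<not> lft E w \<or> rgt E y \<and> \<not> rgt E w
    \<Longrightarrow> \<exists>z\<in>E. le y z \<and> le z w"
proof (induction "card {z \<in> A. le z w}" arbitrary: w rule: less_induct)
  case less
  show ?case
  proof (cases "w \<in> E")
    case True then show ?thesis using less.prems refl by blast
  next
    case False
    have "y \<noteq> w" using less.prems by blast
    then obtain x where x: "covers A le x w" "le y x" using ex_cover_below less.prems by blast
    have xA: "x \<in> A" "le x w" "x \<noteq> w" using x by (auto simp: covers_def)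
    have "lft E w \<or> rgt E w" using False side_cases[OF E] less.prems by blast
    then have "lft E y \<and> \<not> lft E x \<or> rgt E y \<and> \<not> rgt E x"
      using cover_sides[OF E x(1)] less.prems by (auto simp: lft_def rgt_def)
    then obtain z where "z \<in> E" "le y z" "le z x"
      using less.hyps[OF card_down_less[of x w]] x xA less.prems by blast
    then show ?thesis using trans[of z x w] xA less.prems maximal_chainD(1)[OF E] by blast
  qed
qed

lemma path_edge:
  assumes F: "maximal_chain A le F" and t: "t \<in> heights"
  obtains a b where "a \<in> F" "b \<in> F" "covers A le a b" "h a \<le> t" "t \<le> h b" "edge_x a b t = xpos F t"
proof -
  have "(xpos F t, t) \<in> chain_path A le p F" using xpos_iff[OF F t] by simp
  then obtain a b where ab: "a \<in> F" "b \<in> F" "covers A le a b" "(xpos F t, t) \<in> closed_segment (p a) (p b)"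
    by (rule chain_pathE)
  then show thesis using that[of a b] segment_iff[OF ab(3)] by simp
qed

text \<open>Suppose an edge of F has a point to the right of E. Its ends cannot be to the left, as
  an edge keeps to one side, nor to the right by assumption. So both ends lie on E, and the edge is
  part of the path of E.\<close>

lemma path_le:
  assumes E: "maximal_chain A le E" and F: "maximal_chain A le F" and v: "\<And>v. v \<in> F \<Longrightarrow> \<not> rgt E v"
    and t: "t \<in> heights"
  shows "xpos F t \<le> xpos E t"
proof (rule ccontr)
  assume "\<not> xpos F t \<le> xpos E t"
  then have less: "xpos E t < xpos F t" by simp
  obtain a b where ab: "a \<in> F" "b \<in> F" "covers A le a b" "h a \<le> t" "t \<le> h b" "edge_x a b t = xpos F t"
    using path_edge[OF F t] by blast
  have A: "a \<in> A" "b \<in> A" using ab by (auto simp: covers_def)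
  have "\<not> lft E a" "\<not> lft E b"
    using edge_on_one_side[OF E ab(3), of "h a" t] edge_on_one_side[OF E ab(3), of "h b" t] edge_x_ends[OF ab(3)] covers_h[OF ab(3)] ab less
    by (auto simp: lft_def)
  then have "a \<in> E" "b \<in> E" using side_cases[OF E] v ab A by blast+
  then show False using edge_in_path[OF E _ _ ab(3)] ab less by simp
qed

lemma path_ge:
  assumes E: "maximal_chain A le E" and F: "maximal_chain A le F" and v: "\<And>v. v \<in> F \<Longrightarrow> \<not> lft E v"
    and t: "t \<in> heights"
  shows "xpos E t \<le> xpos F t"
proof (rule ccontr)
  assume "\<not> xpos E t \<le> xpos F t"
  then have less: "xpos F t < xpos E t" by simp
  obtain a b where ab: "a \<in> F" "b \<in> F" "covers A le a b" "h a \<le> t" "t \<le> h b" "edge_x a b t = xpos F t"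
    using path_edge[OF F t] by blast
  have A: "a \<in> A" "b \<in> A" using ab by (auto simp: covers_def)
  have "\<not> rgt E a" "\<not> rgt E b"
    using edge_on_one_side[OF E ab(3), of t "h a"] edge_on_one_side[OF E ab(3), of t "h b"] edge_x_ends[OF ab(3)] covers_h[OF ab(3)] ab less
    by (auto simp: rgt_def)
  then have "a \<in> E" "b \<in> E" using side_cases[OF E] v ab A by blast+
  then show False using edge_in_path[OF E _ _ ab(3)] ab less by simp
qed

section \<open>Existence, uniqueness and join-irreducible elements of the boundary chains\<close>

lemma left_boundary_iff: "left_boundary A le p C \<longleftrightarrow> maximal_chain A le C \<and> (\<forall>x\<in>A. \<not> lft C x)"
proof -
  have "(\<exists>q\<in>chain_path A le p C. snd q = h x \<and> fst q \<le> fst (p x)) \<longleftrightarrow> \<not> lft C x"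
    if C: "maximal_chain A le C" and x: "x \<in> A" for x
  proof -
    have "(\<exists>q\<in>chain_path A le p C. snd q = h x \<and> fst q \<le> fst (p x)) \<longleftrightarrow>
        (\<exists>y. (y, h x) \<in> chain_path A le p C \<and> y \<le> fst (p x))" by (metis prod.collapse fst_conv snd_conv)
    then show ?thesis using xpos_iff[OF C h_in_heights[OF x]] by (auto simp: lft_def)
  qed
  then show ?thesis unfolding left_boundary_def by blast
qed

lemma right_boundary_iff: "right_boundary A le p C \<longleftrightarrow> maximal_chain A le C \<and> (\<forall>x\<in>A. \<not> rgt C x)"
proof -
  have "(\<exists>q\<in>chain_path A le p C. snd q = h x \<and> fst (p x) \<le> fst q) \<longleftrightarrow> \<not> rgt C x"
    if C: "maximal_chain A le C" and x: "x \<in> A" for x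
  proof -
    have "(\<exists>q\<in>chain_path A le p C. snd q = h x \<and> fst (p x) \<le> fst q) \<longleftrightarrow>
        (\<exists>y. (y, h x) \<in> chain_path A le p C \<and> fst (p x) \<le> y)" by (metis prod.collapse fst_conv snd_conv)
    then show ?thesis using xpos_iff[OF C h_in_heights[OF x]] by (auto simp: rgt_def)
  qed
  then show ?thesis unfolding right_boundary_def by blast
qed

text \<open>\<open>F\<close> agrees with \<open>E\<close> below the largest element of \<open>E\<close> under \<open>y\<close> and above the smallest one over \<open>y\<close>;
  in between it cannot pass to the right of \<open>E\<close> without meeting \<open>E\<close>.\<close>
lemma reroute_left:
  assumes E: "maximal_chain A le E" and y: "y \<in> A" "lft E y"
  obtains F where "maximal_chain A le F" "y \<in> F" "\<And>v. v \<in> F \<Longrightarrow> \<not> rgt E v"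
proof -
  note EA = maximal_chainD(1)[OF E] and lin = maximal_chainD(2)[OF E]
  obtain z where z: "z \<in> A" "\<And>x. x \<in> A \<Longrightarrow> le z x" using ex_bottom by blast
  obtain t where t: "t \<in> A" "\<And>x. x \<in> A \<Longrightarrow> le x t" using ex_top by blast
  have zt: "z \<in> E" "t \<in> E" using maximal_chain_memI[OF E] z t EA by blast+
  have "{e \<in> E. le e y} \<subseteq> A" "{e \<in> E. le e y} \<noteq> {}" using zt z y EA by auto
  then obtain a where a': "a \<in> {e \<in> E. le e y}" "\<And>e. e \<in> {e \<in> E. le e y} \<Longrightarrow> le a e \<Longrightarrow> e = a"
    by (rule ex_maximal) (rule that)
  then have a: "a \<in> E" "le a y" "\<And>e. e \<in> E \<Longrightarrow> le e y \<Longrightarrow> le a e \<Longrightarrow> e = a" by blast+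
  have "{e \<in> E. le y e} \<subseteq> A" "{e \<in> E. le y e} \<noteq> {}" using zt t y EA by auto
  then obtain b where b': "b \<in> {e \<in> E. le y e}" "\<And>e. e \<in> {e \<in> E. le y e} \<Longrightarrow> le e b \<Longrightarrow> e = b"
    by (rule ex_minimal) (rule that)
  then have b: "b \<in> E" "le y b" "\<And>e. e \<in> E \<Longrightarrow> le y e \<Longrightarrow> le e b \<Longrightarrow> e = b" by blast+
  have abA: "a \<in> A" "b \<in> A" using a b EA by auto
  have a_max: "le e a" if "e \<in> E" "le e y" for e using a that lin[of a e] refl abA by blast
  have b_min: "le b e" if "e \<in> E" "le y e" for e using b that lin[of b e] refl abA by blast
  define K where "K = {e \<in> E. le e a} \<union> {y} \<union> {e \<in> E. le b e}"
  have below: "le e y" if "e \<in> E" "le e a" for e using trans[of e a y] that a abA y EA by blast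
  have above: "le y e" if "e \<in> E" "le b e" for e using trans[of y b e] that b abA y EA by blast
  have "is_chain A le K" unfolding is_chain_def K_def
    using lin below above refl y EA by blast
  then obtain F where F: "maximal_chain A le F" "K \<subseteq> F" using extend_to_maximal_chain by blast
  have "\<not> rgt E v" if v: "v \<in> F" for v
  proof
    assume r: "rgt E v"
    have vA: "v \<in> A" using v maximal_chainD(1)[OF F(1)] by blast
    have "v \<notin> E" using r side_cases[OF E vA] by blast
    have cmp: "le v k \<or> le k v" if "k \<in> K" for k using maximal_chainD(2)[OF F(1) v, of k] that F(2) by blast
    have abK: "a \<in> K" "b \<in> K" "y \<in> K" unfolding K_def using a b refl abA by auto
    have not_a: "\<not> le v a"
    proof
      assume "le v a"
      have "v \<in> E"
      proof (rule maximal_chain_memI[OF E vA])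
        fix e assume e: "e \<in> E"
        show "le v e \<or> le e v"
        proof (cases "le e a")
          case True then show ?thesis using cmp[of e] e by (auto simp: K_def)
        next
          case False
          then have "le a e" using lin[of a e] a e by blast
          then show ?thesis using trans[of v a e] \<open>le v a\<close> vA abA e EA by blast
        qed
      qed
      then show False using \<open>v \<notin> E\<close> by blast
    qed
    have not_b: "\<not> le b v"
    proof
      assume "le b v"
      have "v \<in> E"
      proof (rule maximal_chain_memI[OF E vA])
        fix e assume e: "e \<in> E"
        show "le v e \<or> le e v"
        proof (cases "le b e")
          case True then show ?thesis using cmp[of e] e by (auto simp: K_def)
        next
          case False
          then have "le e b" using lin[of b e] b e by blast
          then show ?thesis using trans[of e b v] \<open>le b v\<close> vA abA e EA by blast
        qed
      qed
      then show False using \<open>v \<notin> E\<close> by blast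
    qed
    have ny: "\<not> rgt E y" using y by (simp add: lft_def rgt_def)
    have nl: "\<not> lft E v" using r by (simp add: lft_def rgt_def)
    from cmp[OF abK(3)] show False
    proof
      assume "le v y"
      then obtain e where e: "e \<in> E" "le v e" "le e y" using crossing[OF E _ vA y(1)] r ny by blast
      then have "le v a" using a_max trans[of v e a] vA abA EA by blast
      then show False using not_a by blast
    next
      assume "le y v"
      then obtain e where e: "e \<in> E" "le y e" "le e v" using crossing[OF E _ y(1) vA] y nl by blast
      then have "le b v" using b_min trans[of b e v] vA abA EA by blast
      then show False using not_b by blast
    qed
  qed
  then show thesis using that[of F] F K_def by blast
qed

text \<open>Rerouting a chain through an element y on its left moves the path weakly to the left. No
  element becomes a left one by this, and y ceases to be one, so a chain with the fewest left
  elements has none.\<close>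

lemma ex_left_boundary: "\<exists>C. left_boundary A le p C"
proof -
  obtain C0 where C0: "maximal_chain A le C0"
    using extend_to_maximal_chain[of "{}"] by (auto simp: is_chain_def)
  obtain C where C: "maximal_chain A le C"
    and least: "\<And>F. maximal_chain A le F \<Longrightarrow> card {x \<in> A. lft C x} \<le> card {x \<in> A. lft F x}"
    using ex_has_least_nat[of "maximal_chain A le" C0 "\<lambda>E. card {x \<in> A. lft E x}"] C0 by blast
  have "\<not> lft C y" if y: "y \<in> A" for y
  proof
    assume l: "lft C y"
    then obtain F where F: "maximal_chain A le F" "y \<in> F" "\<And>v. v \<in> F \<Longrightarrow> \<not> rgt C v"
      using reroute_left[OF C y] by blast
    have "{x \<in> A. lft F x} \<subseteq> {x \<in> A. lft C x}"
      using path_le[OF C F(1,3)] h_in_heights by (force simp: lft_def)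
    moreover have "\<not> lft F y" using side_cases[OF F(1) y] F(2) by blast
    ultimately have "{x \<in> A. lft F x} \<subset> {x \<in> A. lft C x}" using l y by blast
    then have "card {x \<in> A. lft F x} < card {x \<in> A. lft C x}"
      using finite_carrier by (intro psubset_card_mono) auto
    then show False using least[OF F(1)] by simp
  qed
  then show ?thesis using C left_boundary_iff by blast
qed

text \<open>Each of two left boundaries has no vertex to the left of the other, so their paths agree
  at every height; a maximal chain is recovered from its path.\<close>

lemma left_boundary_unique:
  assumes "left_boundary A le p C" "left_boundary A le p D" shows "C = D"
proof -
  have sub: "C \<subseteq> D" if "left_boundary A le p C" "left_boundary A le p D" for C D
  proof
    fix x assume x: "x \<in> C"
    have C: "maximal_chain A le C" "\<And>x. x \<in> A \<Longrightarrow> \<not> lft C x" and D: "maximal_chain A le D" "\<And>x. x \<in> A \<Longrightarrow> \<not> lft D x"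
      using that left_boundary_iff by auto
    have CD: "C \<subseteq> A" "D \<subseteq> A" using C D maximal_chainD(1) by auto
    have "xpos C t = xpos D t" if "t \<in> heights" for t
      using path_ge[OF C(1) D(1) _ that] path_ge[OF D(1) C(1) _ that] C(2) D(2) CD by (meson order_antisym subsetD)
    then show "x \<in> D" using vertex_iff C(1) D(1) x CD h_in_heights by (metis subsetD)
  qed
  show ?thesis using sub assms by blast
qed

lemma ex_right_boundary: "\<exists>C. right_boundary A le p C"
  using diagram.ex_left_boundary[OF mirror] left_boundary_mirror by blast

lemma right_boundary_unique: "right_boundary A le p C \<Longrightarrow> right_boundary A le p D \<Longrightarrow> C = D"
  using diagram.left_boundary_unique[OF mirror] left_boundary_mirror by blast

text \<open>Let E be a maximal chain through x. As x is off both boundaries, each of them has an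
  element incomparable to x, and below it a join-irreducible element incomparable to x. These two
  lie strictly on opposite sides of E, so they are incomparable to each other and form an antichain
  with x.\<close>

lemma slim_join_irr_boundary:
  assumes slim: "slim A le" and C: "left_boundary A le p C" and D: "right_boundary A le p D" and x: "join_irr A le x"
  shows "x \<in> C \<union> D"
proof (rule ccontr)
  assume nx: "x \<notin> C \<union> D"
  have xA: "x \<in> A" using x by (simp add: join_irr_def)
  have Cm: "maximal_chain A le C" and Cl: "\<And>x. x \<in> A \<Longrightarrow> \<not> lft C x"
    and Dm: "maximal_chain A le D" and Dr: "\<And>x. x \<in> A \<Longrightarrow> \<not> rgt D x"
    using C D left_boundary_iff right_boundary_iff by auto
  obtain E where E: "maximal_chain A le E" "x \<in> E"
    using extend_to_maximal_chain[of "{x}"] xA refl by (auto simp: is_chain_def)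
  have EA: "E \<subseteq> A" using maximal_chainD(1)[OF E(1)] .
  have Ex: "le e x \<or> le x e" if "e \<in> E" for e using maximal_chainD(2)[OF E(1)] that E(2) by blast
  have next_elem: "\<exists>y\<in>K. \<not> le y x \<and> \<not> le x y" if K: "maximal_chain A le K" "x \<notin> K" for K
    using maximal_chain_memI[OF K(1) xA] K(2) by blast
  have irr: "\<exists>j. join_irr A le j \<and> le j y \<and> \<not> le j x \<and> \<not> le x j" if y: "y \<in> A" "\<not> le y x" "\<not> le x y" for y
  proof -
    obtain j where j: "join_irr A le j" "le j y" "\<not> le j x" using join_irr_separates[OF y(1) xA y(2)] by blast
    then have "\<not> le x j" using trans[of x j y] y xA by (auto simp: join_irr_def)
    then show ?thesis using j by blast
  qed
  obtain y where y: "y \<in> C" "\<not> le y x" "\<not> le x y" using next_elem[OF Cm] nx by blast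
  obtain w where w: "w \<in> D" "\<not> le w x" "\<not> le x w" using next_elem[OF Dm] nx by blast
  have yA: "y \<in> A" and wA: "w \<in> A" using y w maximal_chainD(1) Cm Dm by auto
  obtain j where j: "join_irr A le j" "le j y" "\<not> le j x" "\<not> le x j" using irr[OF yA y(2,3)] by blast
  obtain k where k: "join_irr A le k" "le k w" "\<not> le k x" "\<not> le x k" using irr[OF wA w(2,3)] by blast
  have jA: "j \<in> A" and kA: "k \<in> A" using j k by (auto simp: join_irr_def)
  have jkE: "j \<notin> E" "k \<notin> E" using Ex j k by auto
  \<comment> \<open>An element z of E is comparable with x. From a \<le> z \<le> b it would follow
    that a \<le> x or x \<le> b, so a and b cannot be linked across E.\<close>
  have no_through: "\<not> (\<exists>z\<in>E. le a z \<and> le z b)" if "\<not> le a x" "\<not> le x b" "a \<in> A" "b \<in> A" for a b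
  proof
    assume "\<exists>z\<in>E. le a z \<and> le z b"
    then obtain z where z: "z \<in> E" "le a z" "le z b" by blast
    then show False using Ex[of z] trans[of a z x] trans[of x z b] that xA EA by blast
  qed
  have "xpos C (h y) \<le> xpos E (h y)"
    by (rule path_ge[OF Cm E(1) _ h_in_heights[OF yA]]) (use Cl EA in blast)
  then have "\<not> rgt E y" using vertex_iff[OF Cm yA] y(1) by (simp add: rgt_def)
  then have "\<not> rgt E j" using crossing[OF E(1) j(2) jA yA] no_through[OF j(3) y(3) jA yA] by blast
  then have lj: "lft E j" using side_cases[OF E(1) jA] jkE by blast
  have "xpos E (h w) \<le> xpos D (h w)"
    by (rule path_le[OF Dm E(1) _ h_in_heights[OF wA]]) (use Dr EA in blast)
  then have "\<not> lft E w" using vertex_iff[OF Dm wA] w(1) by (simp add: lft_def)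
  then have "\<not> lft E k" using crossing[OF E(1) k(2) kA wA] no_through[OF k(3) w(3) kA wA] by blast
  then have rk: "rgt E k" using side_cases[OF E(1) kA] jkE by blast
  have "\<not> le j k" using crossing[OF E(1) _ jA kA] no_through[OF j(3) k(4) jA kA] lj rk by (auto simp: lft_def rgt_def)
  moreover have "\<not> le k j" using crossing[OF E(1) _ kA jA] no_through[OF k(3) j(4) kA jA] lj rk by (auto simp: lft_def rgt_def)
  ultimately show False using slim x j k unfolding slim_def by blast
qed

end

lemma diagramI:
  assumes "planar_diagram A le p" "lattice_length A le n" "n \<ge> 1"
  shows "diagram A le p"
proof
  show "fin_lattice A le" using assms(1) by (simp add: planar_diagram_def)
  show "\<not> (\<exists>z. A \<subseteq> {z})"
  proof
    assume "\<exists>z. A \<subseteq> {z}"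
    then obtain z where z: "A \<subseteq> {z}" by blast
    obtain K where "is_chain A le K" "card K = n + 1" using assms(2) by (auto simp: lattice_length_def)
    then show False using card_mono[of "{z}" K] z assms(3) by (auto simp: is_chain_def)
  qed
qed (rule assms(1))

section \<open>Isomorphisms of grid families and the relation \<open>\<rho>\<^sub>i\<^sub>e\<close>\<close>

lemma lat_iso_sym:
  assumes "lat_iso A le B le' f" shows "lat_iso B le' A le (inv_into A f)"
proof -
  have f: "bij_betw f A B" "\<And>x y. x \<in> A \<Longrightarrow> y \<in> A \<Longrightarrow> le x y \<longleftrightarrow> le' (f x) (f y)"
    using assms by (auto simp: lat_iso_def)
  have inv: "inv_into A f y \<in> A" "f (inv_into A f y) = y" if "y \<in> B" for y
    using that f(1) by (auto simp: bij_betw_def inv_into_into f_inv_into_f)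
  show ?thesis unfolding lat_iso_def using bij_betw_inv_into[OF f(1)] f(2) inv by auto
qed

lemma lat_iso_trans:
  assumes "lat_iso A le B le' f" "lat_iso B le' D le'' g" shows "lat_iso A le D le'' (g \<circ> f)"
  using assms bij_betw_trans[of f A B g D] unfolding lat_iso_def by (auto simp: bij_betw_def)

section \<open>Isomorphisms between grid families\<close>

context grid_family begin

lemma empty_in: "{} \<in> F"
proof -
  have "c n = {}" using card_c[of n] finite_c[of n] by simp
  then show ?thesis using c_in[of n] by simp
qed

text \<open>Write Y as \<open>c i \<inter> d j\<close>. If i exceeds k, Y lies in
  \<open>c (Suc k)\<close> and cardinality gives equality; otherwise the factor \<open>c i\<close>
  can be replaced by \<open>c k\<close>.\<close>

lemma below_c:
  assumes Y: "Y \<in> F" "Y \<subseteq> c k" "k < n" "card Y = n - Suc k"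
  shows "Y = c (Suc k) \<or> (\<exists>l\<le>n. Y = c k \<inter> d l)"
proof -
  obtain i j where ij: "Y = c i \<inter> d j" "i \<le> n" "j \<le> n" using Y unfolding F_eq by blast
  show ?thesis
  proof (cases "Suc k \<le> i")
    case True
    then have "Y \<subseteq> c (Suc k)" using ij c_anti[of "Suc k" i] by auto
    then have "Y = c (Suc k)" using Y card_c[of "Suc k"] by (intro card_subset_eq finite_c) auto
    then show ?thesis by blast
  next
    case False
    then have "c k \<subseteq> c i" using c_anti[of i k] Y by simp
    then have "Y = c k \<inter> d j" using ij Y by blast
    then show ?thesis using ij by blast
  qed
qed

lemma narrow_comparable:
  assumes "c k = d k" "k \<le> n" "X \<in> F" shows "X \<subseteq> c k \<or> c k \<subseteq> X"
proof -
  obtain i j where ij: "X = c i \<inter> d j" "i \<le> n" "j \<le> n" using assms unfolding F_eq by blast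
  show ?thesis
    using ij assms c_anti[of k i] c_anti[of i k] d_anti[of k j] d_anti[of j k]
    by (cases "i \<le> k"; cases "j \<le> k") auto
qed

end

locale family_iso = f1: grid_family n F c d + f2: grid_family n F' c' d'
  for n :: nat and F :: "'s set set" and c d and F' :: "'t set set" and c' d' +
  fixes h :: "'s set \<Rightarrow> 't set"
  assumes iso: "lat_iso F (\<supseteq>) F' (\<supseteq>) h"
begin

lemma h_in: "X \<in> F \<Longrightarrow> h X \<in> F'"
  and h_le: "X \<in> F \<Longrightarrow> Y \<in> F \<Longrightarrow> h X \<subseteq> h Y \<longleftrightarrow> X \<subseteq> Y"
  and h_eq: "X \<in> F \<Longrightarrow> Y \<in> F \<Longrightarrow> h X = h Y \<longleftrightarrow> X = Y"
  using iso by (auto simp: lat_iso_def bij_betw_def inj_on_def)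

lemma h_surj: assumes "Y \<in> F'" obtains X where "X \<in> F" "h X = Y"
  using iso assms that by (auto simp: lat_iso_def bij_betw_def)

lemma inverse: "family_iso n F' c' d' F c d (inv_into F h)"
  using lat_iso_sym[OF iso] by unfold_locales

lemma inv_h: "X \<in> F \<Longrightarrow> inv_into F h (h X) = X"
  using iso by (auto simp: lat_iso_def bij_betw_def inv_into_f_f)

lemma swap_both: "family_iso n F d c F' d' c' h"
  using iso f1.swap f2.swap by (simp add: family_iso_def family_iso_axioms_def)

lemma swap_target: "family_iso n F c d F' d' c' h"
  using iso f1.grid_family_axioms f2.swap by (simp add: family_iso_def family_iso_axioms_def)

text \<open>From X one can descend by one point at a time, and h turns each step into a strict
  inclusion. The inverse of h gives the opposite inequality in \<open>card_h\<close>.\<close>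

lemma card_le_h: "X \<in> F \<Longrightarrow> card X \<le> card (h X)"
proof (induction "card X" arbitrary: X rule: less_induct)
  case less
  show ?case
  proof (cases "X = {}")
    case False
    then have "{} \<subset> X" by blast
    with f1.drop_one[OF less.prems f1.empty_in] obtain Z where Z: "Z \<in> F" "Z \<subset> X" "card X = Suc (card Z)"
      by metis
    have "h Z \<subset> h X" using Z less.prems h_le h_eq by blast
    then have "card (h Z) < card (h X)" using f2.finite_mem h_in less.prems by (intro psubset_card_mono) auto
    then show ?thesis using less.hyps[of Z] Z by simp
  qed simp
qed

lemma card_h: "X \<in> F \<Longrightarrow> card (h X) = card X"
proof -
  interpret i: family_iso n F' c' d' F c d "inv_into F h" by (rule inverse)
  assume X: "X \<in> F"
  then show ?thesis using card_le_h[OF X] i.card_le_h[OF h_in[OF X]] inv_h by simp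
qed

lemma h_inter:
  assumes "X \<in> F" "Y \<in> F" shows "h (X \<inter> Y) = h X \<inter> h Y"
proof
  have XY: "X \<inter> Y \<in> F" using f1.inter_closed assms by blast
  show "h (X \<inter> Y) \<subseteq> h X \<inter> h Y" using h_le XY assms by blast
  obtain Z where Z: "Z \<in> F" "h Z = h X \<inter> h Y" using h_surj f2.inter_closed h_in assms by metis
  then have "Z \<subseteq> X \<inter> Y" using h_le[of Z X] h_le[of Z Y] assms by blast
  then show "h X \<inter> h Y \<subseteq> h (X \<inter> Y)" using h_le[OF Z(1) XY] Z(2) by blast
qed

text \<open>A set where the chains meet is comparable with every member, so its image is the only
  member of its cardinality. Both \<open>c' k\<close> and \<open>d' k\<close> have that
  cardinality.\<close>

lemma h_narrow:
  assumes "c k = d k" "k \<le> n"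
  shows "h (c k) = c' k" "h (d k) = d' k" "c' k = d' k"
proof -
  note ck = f1.c_in[OF assms(2)]
  have card: "card (h (c k)) = n - k" using card_h[OF ck] f1.card_c[OF assms(2)] by simp
  have eq: "h (c k) = Y" if Y: "Y \<in> F'" "card Y = n - k" for Y
  proof -
    obtain X where X: "X \<in> F" "h X = Y" using h_surj Y by blast
    have "X \<subseteq> c k \<or> c k \<subseteq> X" using f1.narrow_comparable[OF assms X(1)] .
    then have "Y \<subseteq> h (c k) \<or> h (c k) \<subseteq> Y" using X h_le ck by blast
    then show ?thesis using card_subset_eq f2.finite_mem h_in[OF ck] Y card by metis
  qed
  show "h (c k) = c' k" "h (d k) = d' k" "c' k = d' k"
    using eq[of "c' k"] eq[of "d' k"] f2.c_in f2.d_in f2.card_c f2.card_d assms by auto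
qed

text \<open>By \<open>below_c\<close> the image of \<open>c (Suc k)\<close> is
  \<open>c' (Suc k)\<close> or some \<open>c' k \<inter> d' l\<close>. For l < a such an
  intersection removes nothing. For l > k it lies in \<open>c' k \<inter> d' k\<close>, which is
  already too small unless equal, so l may be taken as k. For l from a to k it pulls back along h to
  an equation in the first family, the alternative in the conclusion.\<close>

lemma step_half:
  assumes k: "a \<le> k" "k < n" and a: "c' a = d' a" and wide: "c' k \<noteq> d' k"
    and eq: "\<And>j. a \<le> j \<Longrightarrow> j \<le> k \<Longrightarrow> h (c j) = c' j \<and> h (d j) = d' j"
  shows "h (c (Suc k)) = c' (Suc k) \<or> (\<exists>l\<in>{a..k}. c (Suc k) = c k \<inter> d l)"
proof (rule disjCI)
  assume no: "\<not> (\<exists>l\<in>{a..k}. c (Suc k) = c k \<inter> d l)"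
  let ?Y = "h (c (Suc k))"
  have ck: "c k \<in> F" "c (Suc k) \<in> F" "h (c k) = c' k" using f1.c_in k eq by auto
  have Y: "?Y \<in> F'" "?Y \<subseteq> c' k" "card ?Y = n - Suc k"
    using h_in h_le[OF ck(2,1)] ck f1.c_anti[of k "Suc k"] k card_h f1.card_c by auto
  have no': "?Y \<noteq> c' k \<inter> d' l" if l: "l \<in> {a..k}" for l
  proof
    assume "?Y = c' k \<inter> d' l"
    then have "?Y = h (c k \<inter> d l)" using eq[of l] ck h_inter f1.d_in[of l] l k by auto
    then have "c (Suc k) = c k \<inter> d l" using h_eq ck f1.inter_closed f1.d_in[of l] l k by auto
    then show False using no l by blast
  qed
  have "?Y \<noteq> c' k \<inter> d' l" if l: "l \<le> n" for l
  proof
    assume eqY: "?Y = c' k \<inter> d' l"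
    consider "l < a" | "l \<in> {a..k}" | "k < l" by fastforce
    then show False
    proof cases
      case 1
      then have "c' k \<subseteq> d' l" using f2.d_anti[of l a] f2.c_anti[of a k] a k by auto
      then have "?Y = c' k" using eqY by blast
      then show False using Y(3) f2.card_c[of k] k by simp
    next
      case 2 then show False using no' eqY by blast
    next
      case 3
      then have sub: "?Y \<subseteq> c' k \<inter> d' k" using eqY f2.d_anti[of k l] l by auto
      have "\<not> c' k \<subseteq> d' k"
        using wide card_subset_eq[OF f2.finite_d[of k], of "c' k"] f2.card_c[of k] f2.card_d[of k] k by auto
      then have "card (c' k \<inter> d' k) < card (c' k)"
        using f2.finite_c[of k] k by (intro psubset_card_mono) auto
      then have "card (c' k \<inter> d' k) \<le> card ?Y" using Y(3) f2.card_c[of k] k by simp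
      then have "?Y = c' k \<inter> d' k" using sub f2.finite_c[of k] k by (intro card_seteq) auto
      then show False using no'[of k] k by auto
    qed
  qed
  then show "?Y = c' (Suc k)" using f2.below_c[OF Y(1,2) k(2) Y(3)] by blast
qed

text \<open>If the image were wrong, \<open>step_half\<close> for h and for its inverse would make
  both \<open>h (c (Suc k))\<close> and \<open>c' (Suc k)\<close> intersections of
  \<open>c' k\<close> with members of the chain d'. Such intersections are nested, and equal
  cardinality makes them equal.\<close>

lemma step_c:
  assumes k: "a \<le> k" "k < n" and a: "c a = d a" and wide: "c k \<noteq> d k"
    and eq: "\<And>j. a \<le> j \<Longrightarrow> j \<le> k \<Longrightarrow> h (c j) = c' j \<and> h (d j) = d' j"
  shows "h (c (Suc k)) = c' (Suc k)"
proof (rule ccontr)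
  assume ne: "h (c (Suc k)) \<noteq> c' (Suc k)"
  interpret i: family_iso n F' c' d' F c d "inv_into F h" by (rule inverse)
  have cd: "c j \<in> F" "d j \<in> F" "c' j \<in> F'" "d' j \<in> F'" if "j \<le> n" for j
    using that f1.c_in f1.d_in f2.c_in f2.d_in by auto
  have a': "c' a = d' a" using h_narrow(3)[OF a] k by simp
  have wide': "c' k \<noteq> d' k" using wide h_eq[of "c k" "d k"] eq[of k] cd k by auto
  obtain l where l: "l \<in> {a..k}" "c (Suc k) = c k \<inter> d l"
    using step_half[OF k a' wide' eq] ne by blast
  have inv_eq: "inv_into F h (c' j) = c j \<and> inv_into F h (d' j) = d j" if "a \<le> j" "j \<le> k" for j
    using eq[OF that] inv_h[of "c j"] inv_h[of "d j"] cd that k by auto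
  have "inv_into F h (c' (Suc k)) \<noteq> c (Suc k)"
    using ne iso cd[of "Suc k"] k f_inv_into_f[of "c' (Suc k)" h F] by (auto simp: lat_iso_def bij_betw_def)
  then obtain l' where l': "l' \<in> {a..k}" "c' (Suc k) = c' k \<inter> d' l'"
    using i.step_half[OF k a wide inv_eq] by blast
  have him: "h (c k \<inter> d j) = c' k \<inter> d' j" if "j \<in> {a..k}" for j
    using that h_inter cd[of k] cd[of j] eq[of k] eq[of j] k by auto
  have Suc_k: "Suc k \<le> n" using k by simp
  have cards: "card (h (c (Suc k))) = card (c' (Suc k))"
    using card_h cd Suc_k f1.card_c f2.card_c by simp
  have fin: "finite (h (c (Suc k)))" "finite (c' (Suc k))" using f2.finite_mem h_in cd Suc_k by auto
  show False
  proof (cases "l \<le> l'")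
    case True
    then have "d' l' \<subseteq> d' l" using f2.d_anti[of l l'] l' k by auto
    then have "c' (Suc k) \<subseteq> h (c (Suc k))" using l'(2) him[OF l(1)] l(2) by auto
    then show False using card_subset_eq[OF fin(1)] cards ne by metis
  next
    case False
    then have "d l \<subseteq> d l'" using f1.d_anti[of l' l] l k by auto
    then have "c (Suc k) \<subseteq> c k \<inter> d l'" using l(2) by auto
    then have "h (c (Suc k)) \<subseteq> h (c k \<inter> d l')"
      using h_le f1.inter_closed cd[of k] cd[of l'] cd[OF Suc_k] l' k by auto
    then have "h (c (Suc k)) \<subseteq> c' (Suc k)" using l'(2) him[OF l'(1)] by simp
    then show False using card_subset_eq[OF fin(2)] cards ne by metis
  qed
qed

lemma straight_segment:
  assumes av: "a < v" "v \<le> n" and a: "c a = d a" and wide: "\<And>k. a < k \<Longrightarrow> k < v \<Longrightarrow> c k \<noteq> d k"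
    and start: "h (c (Suc a)) = c' (Suc a)" "h (d (Suc a)) = d' (Suc a)"
    and k: "a \<le> k" "k \<le> v"
  shows "h (c k) = c' k \<and> h (d k) = d' k"
  using k
proof (induction k rule: less_induct)
  case (less k)
  interpret s: family_iso n F d c F' d' c' h by (rule swap_both)
  consider "k = a" | "k = Suc a" | k0 where "k = Suc k0" "a < k0"
    using less.prems by (metis Suc_lessI le_neq_implies_less less_Suc_eq_le less_imp_Suc_add not_less_eq add_Suc_right)
  then show ?case
  proof cases
    case 1 then show ?thesis using h_narrow[OF a] av by simp
  next
    case 2 then show ?thesis using start by simp
  next
    case (3 k0)
    have eq: "h (c j) = c' j \<and> h (d j) = d' j" if "a \<le> j" "j \<le> k0" for j
      using less.IH[of j] that 3 less.prems by auto
    have "c k0 \<noteq> d k0" using wide 3 less.prems by auto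
    then show ?thesis
      using step_c[of a k0] s.step_c[of a k0] eq a 3 less.prems av by auto
  qed
qed

text \<open>At a meeting point \<open>c' a = d' a\<close>, so an intersection
  \<open>c' a \<inter> d' l\<close> that loses a point has l > a; it lies in
  \<open>d' (Suc a)\<close> and equals it by cardinality.\<close>

lemma start_c:
  assumes "c a = d a" "a < n"
  shows "h (c (Suc a)) = c' (Suc a) \<or> h (c (Suc a)) = d' (Suc a)"
proof -
  let ?Y = "h (c (Suc a))"
  note na = h_narrow[OF assms(1)]
  have ca: "c a \<in> F" "c (Suc a) \<in> F" using f1.c_in[of a] f1.c_in[of "Suc a"] assms(2) by simp_all
  have Y: "?Y \<in> F'" "?Y \<subseteq> c' a" "card ?Y = n - Suc a"
    using h_in h_le[OF ca(2,1)] ca f1.c_anti[of a "Suc a"] assms card_h f1.card_c na(1) by auto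
  have "?Y = d' (Suc a)" if l: "l \<le> n" "?Y = c' a \<inter> d' l" for l
  proof -
    have "a < l"
    proof (rule ccontr)
      assume "\<not> a < l"
      then have "?Y = c' a" using l na(3) f2.d_anti[of l a] assms by auto
      then show False using Y(3) f2.card_c[of a] assms by simp
    qed
    then have "?Y \<subseteq> d' (Suc a)" using l f2.d_anti[of "Suc a" l] by auto
    then show ?thesis using Y f2.card_d[of "Suc a"] f2.finite_d assms by (intro card_subset_eq) auto
  qed
  then show ?thesis using f2.below_c[OF Y(1,2) assms(2) Y(3)] by blast
qed

text \<open>Just above a the two chains differ, so their images there are either both kept or both
  exchanged, and this choice propagates. The crossed case is the straight one for the target with
  its chains exchanged. If v = \<open>Suc a\<close>, only meeting points are involved.\<close>

lemma segment_straight_or_crossed: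
  assumes av: "a < v" "v \<le> n" and a: "c a = d a" and v: "c v = d v" and wide: "\<And>k. a < k \<Longrightarrow> k < v \<Longrightarrow> c k \<noteq> d k"
  shows "(\<forall>k\<in>{a..v}. h (c k) = c' k \<and> h (d k) = d' k) \<or> (\<forall>k\<in>{a..v}. h (c k) = d' k \<and> h (d k) = c' k)"
proof (cases "v = Suc a")
  case True
  then have "{a..v} = {a, v}" by auto
  then show ?thesis using h_narrow[OF a] h_narrow[OF v] av by auto
next
  case False
  interpret s: family_iso n F d c F' d' c' h by (rule swap_both)
  interpret t: family_iso n F c d F' d' c' h by (rule swap_target)
  have a1: "Suc a < v" "a < n" using False av by auto
  have "c (Suc a) \<noteq> d (Suc a)" using wide a1 by auto
  then have "h (c (Suc a)) \<noteq> h (d (Suc a))" using h_eq f1.c_in f1.d_in a1 by simp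
  then have "h (c (Suc a)) = c' (Suc a) \<and> h (d (Suc a)) = d' (Suc a) \<or>
      h (c (Suc a)) = d' (Suc a) \<and> h (d (Suc a)) = c' (Suc a)"
    using start_c[OF a a1(2)] s.start_c[OF a[symmetric] a1(2)] by auto
  then show ?thesis
  proof (elim disjE conjE)
    assume "h (c (Suc a)) = c' (Suc a)" "h (d (Suc a)) = d' (Suc a)"
    then show ?thesis using straight_segment[OF av a wide] by auto
  next
    assume "h (c (Suc a)) = d' (Suc a)" "h (d (Suc a)) = c' (Suc a)"
    then show ?thesis using t.straight_segment[OF av a wide] by auto
  qed
qed

end

section \<open>Cuts, segments and the relation \<open>rho_ie\<close>\<close>

definition is_cut :: "(nat \<Rightarrow> nat) \<Rightarrow> nat \<Rightarrow> bool" where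
  "is_cut \<pi> k \<longleftrightarrow> closed_set \<pi> {1..k}"

lemma closed_set_image:
  assumes "\<pi> permutes S" "finite I" "closed_set \<pi> I" shows "\<pi> ` I = I"
  using assms(3) card_image[OF permutes_inj_on[OF assms(1)], of I] unfolding closed_set_def
  by (rule card_subset_eq[OF assms(2)])

lemma cut_0: "is_cut \<pi> 0" by (simp add: is_cut_def closed_set_def)

lemma cut_n: "\<pi> permutes {1..n} \<Longrightarrow> is_cut \<pi> n"
  unfolding is_cut_def closed_set_def using permutes_image by blast

lemma cut_image:
  assumes "\<pi> permutes {1..n}" "is_cut \<pi> k" shows "\<pi> ` {1..k} = {1..k}"
  using closed_set_image[OF assms(1)] assms(2) by (simp add: is_cut_def)

lemma interval_image:
  assumes \<pi>: "\<pi> permutes {1..n}" and cuts: "is_cut \<pi> a" "is_cut \<pi> b" "a \<le> b"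
  shows "\<pi> ` {Suc a..b} = {Suc a..b}"
proof -
  have "{Suc a..b} = {1..b} - {1..a}" by auto
  then show ?thesis
    using image_set_diff[OF permutes_inj[OF \<pi>], of "{1..b}" "{1..a}"] cut_image[OF \<pi>] cuts by simp
qed

lemma is_section_iff:
  assumes \<pi>: "\<pi> permutes {1..n}"
  shows "is_section n \<pi> I \<longleftrightarrow> (\<exists>a b. a < b \<and> b \<le> n \<and> I = {Suc a..b} \<and> is_cut \<pi> a \<and> is_cut \<pi> b)"
proof
  assume "is_section n \<pi> I"
  then obtain u v where uv: "1 \<le> u" "u \<le> v" "v \<le> n" "I = {u..v}" "closed_set \<pi> {1..<u}" "closed_set \<pi> I"
    by (auto simp: is_section_def)
  have e: "{1..u - 1} = {1..<u}" "{1..v} = {1..<u} \<union> {u..v}" using uv by auto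
  have "closed_set \<pi> ({1..<u} \<union> {u..v})" using uv(4,5,6) unfolding closed_set_def by blast
  then have "is_cut \<pi> (u - 1)" "is_cut \<pi> v" using uv(5) unfolding is_cut_def e by simp_all
  then show "\<exists>a b. a < b \<and> b \<le> n \<and> I = {Suc a..b} \<and> is_cut \<pi> a \<and> is_cut \<pi> b"
    using uv by (intro exI[of _ "u - 1"] exI[of _ v]) auto
next
  assume "\<exists>a b. a < b \<and> b \<le> n \<and> I = {Suc a..b} \<and> is_cut \<pi> a \<and> is_cut \<pi> b"
  then obtain a b where ab: "a < b" "b \<le> n" "I = {Suc a..b}" "is_cut \<pi> a" "is_cut \<pi> b" by blast
  have "\<pi> ` {Suc a..b} = {Suc a..b}" "\<pi> ` {Suc b..n} = {Suc b..n}"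
    using interval_image[OF \<pi>] ab cut_n[OF \<pi>] by auto
  then have closed: "closed_set \<pi> {Suc a..b}" "closed_set \<pi> {b + 1..n}" by (simp_all add: closed_set_def)
  have "{1..<Suc a} = {1..a}" by auto
  then have "closed_set \<pi> {1..<Suc a}" using ab(4) unfolding is_cut_def by metis
  moreover have "1 \<le> Suc a" "Suc a \<le> b" using ab(1) by simp_all
  ultimately show "is_section n \<pi> I"
    unfolding is_section_def ab(3) using ab(2) closed by blast
qed

text \<open>A section is an interval between two cuts, and a cut strictly inside would split off a
  smaller section; so segments are the intervals between consecutive cuts.\<close>

lemma Seg_iff:
  assumes \<pi>: "\<pi> permutes {1..n}"
  shows "I \<in> Seg n \<pi> \<longleftrightarrow> (\<exists>a b. a < b \<and> b \<le> n \<and> I = {Suc a..b} \<and> is_cut \<pi> a \<and> is_cut \<pi> b \<and>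
    (\<forall>w. a < w \<and> w < b \<longrightarrow> \<not> is_cut \<pi> w))"
proof
  assume I: "I \<in> Seg n \<pi>"
  then have min: "\<And>J. is_section n \<pi> J \<Longrightarrow> J \<subseteq> I \<Longrightarrow> J = I" and sec: "is_section n \<pi> I" by (auto simp: Seg_def)
  obtain a b where ab: "a < b" "b \<le> n" "I = {Suc a..b}" "is_cut \<pi> a" "is_cut \<pi> b"
    using sec unfolding is_section_iff[OF \<pi>] by blast
  have "\<not> is_cut \<pi> w" if w: "a < w" "w < b" for w
  proof
    assume "is_cut \<pi> w"
    then have "is_section n \<pi> {Suc a..w}" unfolding is_section_iff[OF \<pi>]
      using ab w by (intro exI[of _ a] exI[of _ w]) auto
    moreover have "{Suc a..w} \<subseteq> I" using ab(3) w by auto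
    ultimately have "{Suc a..w} = I" by (rule min)
    then have "b \<in> {Suc a..w}" using ab(1,3) by auto
    then show False using w by simp
  qed
  then show "\<exists>a b. a < b \<and> b \<le> n \<and> I = {Suc a..b} \<and> is_cut \<pi> a \<and> is_cut \<pi> b \<and> (\<forall>w. a < w \<and> w < b \<longrightarrow> \<not> is_cut \<pi> w)"
    using ab by blast
next
  assume "\<exists>a b. a < b \<and> b \<le> n \<and> I = {Suc a..b} \<and> is_cut \<pi> a \<and> is_cut \<pi> b \<and> (\<forall>w. a < w \<and> w < b \<longrightarrow> \<not> is_cut \<pi> w)"
  then obtain a b where ab: "a < b" "b \<le> n" "I = {Suc a..b}" "is_cut \<pi> a" "is_cut \<pi> b"
    "\<And>w. a < w \<Longrightarrow> w < b \<Longrightarrow> \<not> is_cut \<pi> w" by blast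
  have "J = I" if J: "is_section n \<pi> J" "J \<subseteq> I" for J
  proof -
    obtain a' b' where J': "a' < b'" "b' \<le> n" "J = {Suc a'..b'}" "is_cut \<pi> a'" "is_cut \<pi> b'"
      using J(1) unfolding is_section_iff[OF \<pi>] by blast
    then have "a \<le> a'" "b' \<le> b" using J(2) ab(3) by auto
    moreover have "\<not> a < a'" using ab(6)[of a'] J' \<open>b' \<le> b\<close> by auto
    moreover have "\<not> b' < b" using ab(6)[of b'] J' \<open>a \<le> a'\<close> by auto
    ultimately show ?thesis using J' ab by simp
  qed
  moreover have "is_section n \<pi> I" unfolding is_section_iff[OF \<pi>] using ab(1-5) by blast
  ultimately show "I \<in> Seg n \<pi>" unfolding Seg_def by blast
qed

lemma ex_segment:
  assumes \<pi>: "\<pi> permutes {1..n}" and k: "k \<in> {1..n}"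
  obtains a b where "a < k" "k \<le> b" "b \<le> n" "is_cut \<pi> a" "is_cut \<pi> b" "\<And>w. a < w \<Longrightarrow> w < b \<Longrightarrow> \<not> is_cut \<pi> w"
    "{Suc a..b} \<in> Seg n \<pi>"
proof -
  define S where "S = {w. w < k \<and> is_cut \<pi> w}"
  define T where "T = {w. k \<le> w \<and> w \<le> n \<and> is_cut \<pi> w}"
  have fin: "finite S" "finite T" by (auto simp: S_def T_def)
  have "0 \<in> S" "n \<in> T" using k cut_0 cut_n[OF \<pi>] by (auto simp: S_def T_def)
  then have mem: "Max S \<in> S" "Min T \<in> T" using fin by (auto intro: Max_in Min_in)
  have none: "\<not> is_cut \<pi> w" if w: "Max S < w" "w < Min T" for w
  proof
    assume "is_cut \<pi> w"
    then have "w \<in> S \<or> w \<in> T" using w mem by (auto simp: S_def T_def)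
    then show False using w Max_ge[OF fin(1), of w] Min_le[OF fin(2), of w] by linarith
  qed
  have facts: "Max S < k" "k \<le> Min T" "Min T \<le> n" "is_cut \<pi> (Max S)" "is_cut \<pi> (Min T)"
    using mem unfolding S_def T_def by simp_all
  then have "{Suc (Max S)..Min T} \<in> Seg n \<pi>"
    unfolding Seg_iff[OF \<pi>] using none order_less_le_trans[OF facts(1,2)] by blast
  then show thesis using that[of "Max S" "Min T"] facts none by blast
qed

text \<open>The positive cuts are exactly the right ends of segments, and 0 is always a cut.\<close>

lemma Seg_eq_iff:
  assumes \<pi>: "\<pi> permutes {1..n}" and \<mu>: "\<mu> permutes {1..n}"
  shows "Seg n \<pi> = Seg n \<mu> \<longleftrightarrow> (\<forall>k\<le>n. is_cut \<pi> k \<longleftrightarrow> is_cut \<mu> k)"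
proof
  have imp: "is_cut \<mu> k" if \<pi>: "\<pi> permutes {1..n}" and \<mu>: "\<mu> permutes {1..n}" and eq: "Seg n \<pi> = Seg n \<mu>"
    and k: "k \<le> n" "is_cut \<pi> k" for \<pi> \<mu> k
  proof (cases "k = 0")
    case False
    then have "k \<in> {1..n}" using k by simp
    then obtain a b where ab: "a < k" "k \<le> b" "\<And>w. a < w \<Longrightarrow> w < b \<Longrightarrow> \<not> is_cut \<pi> w" "{Suc a..b} \<in> Seg n \<pi>"
      using ex_segment[OF \<pi>] by metis
    then have "b = k" using k by force
    then have "{Suc a..k} \<in> Seg n \<mu>" using ab(4) eq by simp
    then obtain a' b' where "a' < b'" "{Suc a..k} = {Suc a'..b'}" "is_cut \<mu> b'"
      unfolding Seg_iff[OF \<mu>] by blast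
    then show ?thesis using ab by auto
  qed (simp add: cut_0)
  assume "Seg n \<pi> = Seg n \<mu>"
  then show "\<forall>k\<le>n. is_cut \<pi> k \<longleftrightarrow> is_cut \<mu> k" using imp[OF \<pi> \<mu>] imp[OF \<mu> \<pi>] by blast
next
  assume cuts: "\<forall>k\<le>n. is_cut \<pi> k \<longleftrightarrow> is_cut \<mu> k"
  have "I \<in> Seg n \<pi> \<longleftrightarrow> I \<in> Seg n \<mu>" for I
  proof -
    have "(a < b \<and> b \<le> n \<and> I = {Suc a..b} \<and> is_cut \<pi> a \<and> is_cut \<pi> b \<and> (\<forall>w. a < w \<and> w < b \<longrightarrow> \<not> is_cut \<pi> w)) \<longleftrightarrow>
      (a < b \<and> b \<le> n \<and> I = {Suc a..b} \<and> is_cut \<mu> a \<and> is_cut \<mu> b \<and> (\<forall>w. a < w \<and> w < b \<longrightarrow> \<not> is_cut \<mu> w))" for a b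
    proof (cases "a < b \<and> b \<le> n")
      case True
      then have "is_cut \<pi> w \<longleftrightarrow> is_cut \<mu> w" if "w \<le> b" for w using cuts that by simp
      then show ?thesis using True by (metis less_imp_le order_refl)
    qed blast
    then show ?thesis unfolding Seg_iff[OF \<pi>] Seg_iff[OF \<mu>] by simp
  qed
  then show "Seg n \<pi> = Seg n \<mu>" by blast
qed

lemma Seg_image:
  assumes \<pi>: "\<pi> permutes {1..n}" and I: "I \<in> Seg n \<pi>"
  shows "\<pi> ` I = I" "x \<in> I \<Longrightarrow> \<pi> x \<in> I" "x \<in> I \<Longrightarrow> inv \<pi> x \<in> I"
proof -
  obtain a b where "a < b" "I = {Suc a..b}" "is_cut \<pi> a" "is_cut \<pi> b" using I unfolding Seg_iff[OF \<pi>] by blast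
  then show im: "\<pi> ` I = I" using interval_image[OF \<pi>] by simp
  then show "x \<in> I \<Longrightarrow> \<pi> x \<in> I" by blast
  assume "x \<in> I"
  then obtain y where "y \<in> I" "x = \<pi> y" using im by blast
  then show "inv \<pi> x \<in> I" using permutes_inverses(2)[OF \<pi>] by simp
qed

text \<open>A permutation maps each of its segments onto itself, so inverting the restriction agrees
  with restricting the inverse.\<close>

lemma rho_ie_iff:
  "(\<pi>, \<mu>) \<in> rho_ie n \<longleftrightarrow> \<pi> permutes {1..n} \<and> \<mu> permutes {1..n} \<and> Seg n \<pi> = Seg n \<mu> \<and>
     (\<forall>I\<in>Seg n \<pi>. (\<forall>x\<in>I. \<mu> x = \<pi> x) \<or> (\<forall>x\<in>I. \<mu> x = inv \<pi> x))"
proof -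
  have "inv_into I \<pi> x = inv \<pi> x" if \<pi>: "\<pi> permutes {1..n}" and I: "I \<in> Seg n \<pi>" "x \<in> I" for I x
    by (rule inv_into_f_eq) (use Seg_image[OF \<pi> I(1)] I \<pi> permutes_inverses(1)[OF \<pi>] permutes_inj_on[OF \<pi>] in auto)
  then show ?thesis unfolding rho_ie_def by auto
qed

lemma rho_ie_sym: assumes "(\<pi>, \<mu>) \<in> rho_ie n" shows "(\<mu>, \<pi>) \<in> rho_ie n"
proof -
  have \<pi>: "\<pi> permutes {1..n}" and \<mu>: "\<mu> permutes {1..n}" and S: "Seg n \<pi> = Seg n \<mu>"
    and I: "\<And>I. I \<in> Seg n \<pi> \<Longrightarrow> (\<forall>x\<in>I. \<mu> x = \<pi> x) \<or> (\<forall>x\<in>I. \<mu> x = inv \<pi> x)"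
    using assms unfolding rho_ie_iff by auto
  have "\<pi> x = inv \<mu> x" if "I \<in> Seg n \<pi>" "\<forall>x\<in>I. \<mu> x = inv \<pi> x" "x \<in> I" for I x
  proof -
    have "\<mu> (\<pi> x) = x" using that Seg_image(2)[OF \<pi>] permutes_inverses(2)[OF \<pi>] by simp
    then show ?thesis using permutes_inverses(2)[OF \<mu>] by metis
  qed
  then show ?thesis unfolding rho_ie_iff using \<pi> \<mu> S I by metis
qed

lemma rho_ie_trans: assumes "(\<pi>, \<mu>) \<in> rho_ie n" "(\<mu>, \<nu>) \<in> rho_ie n" shows "(\<pi>, \<nu>) \<in> rho_ie n"
proof -
  have \<pi>: "\<pi> permutes {1..n}" and \<mu>: "\<mu> permutes {1..n}" and \<nu>: "\<nu> permutes {1..n}"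
    and S: "Seg n \<pi> = Seg n \<mu>" "Seg n \<mu> = Seg n \<nu>"
    and I: "\<And>I. I \<in> Seg n \<pi> \<Longrightarrow> (\<forall>x\<in>I. \<mu> x = \<pi> x) \<or> (\<forall>x\<in>I. \<mu> x = inv \<pi> x)"
    and I': "\<And>I. I \<in> Seg n \<mu> \<Longrightarrow> (\<forall>x\<in>I. \<nu> x = \<mu> x) \<or> (\<forall>x\<in>I. \<nu> x = inv \<mu> x)"
    using assms unfolding rho_ie_iff by auto
  have "(\<forall>x\<in>I. \<nu> x = \<pi> x) \<or> (\<forall>x\<in>I. \<nu> x = inv \<pi> x)" if IS: "I \<in> Seg n \<pi>" for I
  proof -
    have inv\<mu>: "inv \<mu> x = y" if "\<mu> y = x" for x y using that permutes_inverses(2)[OF \<mu>] by metis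
    have same: "inv \<mu> x = inv \<pi> x" if "\<forall>x\<in>I. \<mu> x = \<pi> x" "x \<in> I" for x
      using that Seg_image(3)[OF \<pi> IS] permutes_inverses(1)[OF \<pi>] by (intro inv\<mu>) simp
    have inverted: "inv \<mu> x = \<pi> x" if "\<forall>x\<in>I. \<mu> x = inv \<pi> x" "x \<in> I" for x
      using that Seg_image(2)[OF \<pi> IS] permutes_inverses(2)[OF \<pi>] by (intro inv\<mu>) simp
    show ?thesis using I[OF IS] I'[of I] IS S same inverted by auto
  qed
  then show ?thesis unfolding rho_ie_iff using \<pi> \<nu> S by simp
qed

lemma equiv_rho_ie: "equiv {\<pi>. \<pi> permutes {1..n}} (rho_ie n)"
proof (rule equivI)
  show "rho_ie n \<subseteq> {\<pi>. \<pi> permutes {1..n}} \<times> {\<pi>. \<pi> permutes {1..n}}" by (auto simp: rho_ie_iff)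
  show "refl_on {\<pi>. \<pi> permutes {1..n}} (rho_ie n)" by (auto simp: refl_on_def rho_ie_iff)
  show "sym (rho_ie n)" using rho_ie_sym by (auto simp: sym_def)
  show "trans (rho_ie n)" using rho_ie_trans by (auto simp: trans_def)
qed

section \<open>Recovering the permutation from its grid family\<close>

lemma Uset_c: assumes "\<pi> permutes {1..n}" shows "Uset n \<pi> (k, 0) = {Suc k..n}"
proof -
  have "0 < \<pi> m" if "m \<in> {1..n}" for m using permutes_in_image[OF assms, of m] that by auto
  then show ?thesis by (auto simp: Uset_def)
qed

text \<open>The two sets are the indices m with k < m and those with k < \<open>\<pi> m\<close>;
  they coincide iff \<pi> preserves \<open>{1..k}\<close>. This translates cuts into meeting points
  of the chains.\<close>

lemma narrow_iff_cut:
  assumes \<pi>: "\<pi> permutes {1..n}" and k: "k \<le> n"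
  shows "Uset n \<pi> (k, 0) = Uset n \<pi> (0, k) \<longleftrightarrow> is_cut \<pi> k"
proof
  have pos: "1 \<le> \<pi> m" if "m \<in> {1..n}" for m using permutes_in_image[OF \<pi>, of m] that by auto
  assume eq: "Uset n \<pi> (k, 0) = Uset n \<pi> (0, k)"
  have "\<pi> m \<in> {1..k}" if m: "m \<in> {1..k}" for m
  proof -
    have "m \<notin> Uset n \<pi> (0, k)" using m eq[symmetric] by (auto simp: Uset_def)
    then show ?thesis using m k pos[of m] by (auto simp: Uset_def)
  qed
  then show "is_cut \<pi> k" by (auto simp: is_cut_def closed_set_def)
next
  assume cut: "is_cut \<pi> k"
  have "\<pi> m \<le> k \<longleftrightarrow> m \<le> k" if m: "m \<in> {1..n}" for m
  proof
    assume "m \<le> k"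
    then have "\<pi> m \<in> \<pi> ` {1..k}" using m by simp
    then show "\<pi> m \<le> k" unfolding cut_image[OF \<pi> cut] by simp
  next
    assume "\<pi> m \<le> k"
    then have "\<pi> m \<in> {1..k}" using permutes_in_image[OF \<pi>, of m] m by auto
    then obtain m' where "m' \<in> {1..k}" "\<pi> m' = \<pi> m" using cut_image[OF \<pi> cut] by (metis imageE)
    then show "m \<le> k" using permutes_inj[OF \<pi>] by (auto dest: injD)
  qed
  then have "k < \<pi> m \<longleftrightarrow> k < m" if "m \<in> {1..n}" for m using that by (simp add: not_le[symmetric] del: not_le)
  then have "Uset n \<pi> (0, k) = {m \<in> {1..n}. k < m}" by (auto simp: Uset_def)
  moreover have "{m \<in> {1..n}. k < m} = {Suc k..n}" by auto
  ultimately show "Uset n \<pi> (k, 0) = Uset n \<pi> (0, k)" using Uset_c[OF \<pi>, of k] by simp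
qed

text \<open>From \<open>Uset n \<pi> (i - 1, 0)\<close> to \<open>Uset n \<pi> (i, 0)\<close>
  exactly the point i is lost, and intersecting with the other chain hides this loss iff
  \<open>\<pi> i \<le> j\<close>. The formula uses only intersection and inclusion, so isomorphisms
  preserve it; with the chains exchanged it describes the inverse of \<pi>.\<close>

lemma perm_le_iff:
  assumes \<pi>: "\<pi> permutes {1..n}" and i: "i \<in> {1..n}"
  shows "Uset n \<pi> (i - 1, 0) \<inter> Uset n \<pi> (0, j) \<subseteq> Uset n \<pi> (i, 0) \<longleftrightarrow> \<pi> i \<le> j"
    "Uset n \<pi> (0, i - 1) \<inter> Uset n \<pi> (j, 0) \<subseteq> Uset n \<pi> (0, i) \<longleftrightarrow> inv \<pi> i \<le> j"
proof -
  have "Uset n \<pi> (i - 1, 0) = insert i (Uset n \<pi> (i, 0))" unfolding Uset_c[OF \<pi>] using i by auto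
  moreover have "i \<notin> Uset n \<pi> (i, 0)" "i \<in> Uset n \<pi> (0, j) \<longleftrightarrow> j < \<pi> i" using i by (auto simp: Uset_def)
  ultimately show "Uset n \<pi> (i - 1, 0) \<inter> Uset n \<pi> (0, j) \<subseteq> Uset n \<pi> (i, 0) \<longleftrightarrow> \<pi> i \<le> j" by auto
  define k where "k = inv \<pi> i"
  have k: "\<pi> k = i" "k \<in> {1..n}"
    using permutes_inverses(1)[OF \<pi>] permutes_in_image[OF permutes_inv[OF \<pi>], of i] i by (auto simp: k_def)
  have uniq: "m = k" if "\<pi> m = i" for m unfolding k_def using that permutes_inverses(2)[OF \<pi>] by metis
  have "Uset n \<pi> (0, i - 1) \<subseteq> insert k (Uset n \<pi> (0, i))"
  proof
    fix m assume m: "m \<in> Uset n \<pi> (0, i - 1)"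
    show "m \<in> insert k (Uset n \<pi> (0, i))"
    proof (cases "\<pi> m = i")
      case True then show ?thesis using uniq by simp
    next
      case False
      then have "i < \<pi> m" using m by (auto simp: Uset_def)
      then show ?thesis using m by (simp add: Uset_def)
    qed
  qed
  moreover have "k \<in> Uset n \<pi> (0, i - 1)" "Uset n \<pi> (0, i) \<subseteq> Uset n \<pi> (0, i - 1)" using k i by (auto simp: Uset_def)
  ultimately have "Uset n \<pi> (0, i - 1) = insert k (Uset n \<pi> (0, i))" by blast
  moreover have "k \<notin> Uset n \<pi> (0, i)" using k by (simp add: Uset_def)
  moreover have "k \<in> Uset n \<pi> (j, 0) \<longleftrightarrow> j < k" using k(2) unfolding Uset_c[OF \<pi>] by auto
  ultimately show "Uset n \<pi> (0, i - 1) \<inter> Uset n \<pi> (j, 0) \<subseteq> Uset n \<pi> (0, i) \<longleftrightarrow> inv \<pi> i \<le> j"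
    unfolding k_def[symmetric] by auto
qed

lemma family_iso_Ufam:
  assumes "\<pi> permutes {1..n}" "\<mu> permutes {1..n}"
    and "lat_iso (Ufam n \<pi>) (\<supseteq>) (Ufam n \<mu>) (\<supseteq>) h"
  shows "family_iso n (Ufam n \<pi>) (\<lambda>i. Uset n \<pi> (i, 0)) (\<lambda>j. Uset n \<pi> (0, j))
    (Ufam n \<mu>) (\<lambda>i. Uset n \<mu> (i, 0)) (\<lambda>j. Uset n \<mu> (0, j)) h"
  using grid_family_Ufam[OF assms(1)] grid_family_Ufam[OF assms(2)] assms(3)
  by (simp add: family_iso_def family_iso_axioms_def)

context
  fixes n \<pi> \<mu> h
  assumes \<pi>: "\<pi> permutes {1..n}" and \<mu>: "\<mu> permutes {1..n}"
    and h: "lat_iso (Ufam n \<pi>) (\<supseteq>) (Ufam n \<mu>) (\<supseteq>) h"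
begin

interpretation family_iso n "Ufam n \<pi>" "\<lambda>i. Uset n \<pi> (i, 0)" "\<lambda>j. Uset n \<pi> (0, j)"
    "Ufam n \<mu>" "\<lambda>i. Uset n \<mu> (i, 0)" "\<lambda>j. Uset n \<mu> (0, j)" h
  by (rule family_iso_Ufam[OF \<pi> \<mu> h])

lemma le_iff_transfer:
  assumes "i \<in> {1..n}" "j \<le> n"
  shows "\<pi> i \<le> j \<longleftrightarrow> h (Uset n \<pi> (i - 1, 0)) \<inter> h (Uset n \<pi> (0, j)) \<subseteq> h (Uset n \<pi> (i, 0))"
proof -
  have "Uset n \<pi> (i - 1, 0) \<in> Ufam n \<pi>" "Uset n \<pi> (0, j) \<in> Ufam n \<pi>" "Uset n \<pi> (i, 0) \<in> Ufam n \<pi>"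
    using f1.c_in f1.d_in assms by auto
  then show ?thesis
    using perm_le_iff(1)[OF \<pi> assms(1), of j] h_le[OF f1.inter_closed] h_inter by metis
qed

text \<open>Both values lie in the block \<open>{Suc a..b}\<close>, so thresholds j from the block
  suffice to compare them, and the transferred inclusions involve only chain members with indices
  from a to b.\<close>

lemma straight_perm_eq:
  assumes "b \<le> n" and eq: "\<And>k. a \<le> k \<Longrightarrow> k \<le> b \<Longrightarrow> h (Uset n \<pi> (k, 0)) = Uset n \<mu> (k, 0)"
    "\<And>k. a \<le> k \<Longrightarrow> k \<le> b \<Longrightarrow> h (Uset n \<pi> (0, k)) = Uset n \<mu> (0, k)"
    and i: "i \<in> {Suc a..b}" "\<pi> i \<in> {Suc a..b}" "\<mu> i \<in> {Suc a..b}"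
  shows "\<mu> i = \<pi> i"
proof -
  have "\<pi> i \<le> j \<longleftrightarrow> \<mu> i \<le> j" if j: "j \<in> {Suc a..b}" for j
    using le_iff_transfer[of i j] perm_le_iff(1)[OF \<mu>, of i j] eq(1)[of "i - 1"] eq(1)[of i] eq(2)[of j] i j assms(1)
    by auto
  then show ?thesis using i by (meson order_antisym order_refl)
qed

text \<open>After the exchange of the chains the transferred inclusion is the second formula of
  \<open>perm_le_iff\<close>, which reads off the inverse of \<mu>.\<close>

lemma crossed_perm_eq:
  assumes "b \<le> n" and eq: "\<And>k. a \<le> k \<Longrightarrow> k \<le> b \<Longrightarrow> h (Uset n \<pi> (k, 0)) = Uset n \<mu> (0, k)"
    "\<And>k. a \<le> k \<Longrightarrow> k \<le> b \<Longrightarrow> h (Uset n \<pi> (0, k)) = Uset n \<mu> (k, 0)"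
    and i: "i \<in> {Suc a..b}" "\<pi> i \<in> {Suc a..b}" "inv \<mu> i \<in> {Suc a..b}"
  shows "inv \<mu> i = \<pi> i"
proof -
  have "\<pi> i \<le> j \<longleftrightarrow> inv \<mu> i \<le> j" if j: "j \<in> {Suc a..b}" for j
    using le_iff_transfer[of i j] perm_le_iff(2)[OF \<mu>, of i j] eq(1)[of "i - 1"] eq(1)[of i] eq(2)[of j] i j assms(1)
    by auto
  then show ?thesis using i by (meson order_antisym order_refl)
qed

text \<open>Isomorphisms preserve cardinality, so a map that carries chains onto chains as sets also
  preserves the index of each member. The whole range is then one straight block.\<close>

lemma iso_chains_imp_eq:
  assumes C: "h ` (\<lambda>i. Uset n \<pi> (i, 0)) ` {..n} = (\<lambda>i. Uset n \<mu> (i, 0)) ` {..n}"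
    and D: "h ` (\<lambda>i. Uset n \<pi> (0, i)) ` {..n} = (\<lambda>i. Uset n \<mu> (0, i)) ` {..n}"
  shows "\<pi> = \<mu>"
proof
  have ec: "h (Uset n \<pi> (k, 0)) = Uset n \<mu> (k, 0)" if k: "k \<le> n" for k
  proof -
    obtain l where l: "l \<le> n" "h (Uset n \<pi> (k, 0)) = Uset n \<mu> (l, 0)" using C k by (auto simp: set_eq_iff image_iff) blast
    then have "n - k = n - l" using card_h[OF f1.c_in[OF k]] f1.card_c[OF k] f2.card_c[OF l(1)] by simp
    then have "l = k" using l(1) k by linarith
    then show ?thesis using l(2) by simp
  qed
  have ed: "h (Uset n \<pi> (0, k)) = Uset n \<mu> (0, k)" if k: "k \<le> n" for k
  proof -
    obtain l where l: "l \<le> n" "h (Uset n \<pi> (0, k)) = Uset n \<mu> (0, l)" using D k by (auto simp: set_eq_iff image_iff) blast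
    then have "n - k = n - l" using card_h[OF f1.d_in[OF k]] f1.card_d[OF k] f2.card_d[OF l(1)] by simp
    then have "l = k" using l(1) k by linarith
    then show ?thesis using l(2) by simp
  qed
  fix i show "\<pi> i = \<mu> i"
  proof (cases "i \<in> {1..n}")
    case True
    then have "\<pi> i \<in> {Suc 0..n}" "\<mu> i \<in> {Suc 0..n}" using permutes_in_image[OF \<pi>, of i] permutes_in_image[OF \<mu>, of i] by auto
    then show ?thesis using straight_perm_eq[of n 0 i] ec ed True by simp
  next
    case False
    then show ?thesis using permutes_not_in[OF \<pi>] permutes_not_in[OF \<mu>] by metis
  qed
qed

text \<open>Meeting points of the chains correspond under the isomorphism, so the cuts and hence the
  segments agree. A segment kept straight gives equal restrictions, a crossed one gives inverse
  restrictions.\<close>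

lemma iso_imp_rho_ie: "(\<pi>, \<mu>) \<in> rho_ie n"
proof -
  interpret i: family_iso n "Ufam n \<mu>" "\<lambda>i. Uset n \<mu> (i, 0)" "\<lambda>j. Uset n \<mu> (0, j)"
    "Ufam n \<pi>" "\<lambda>i. Uset n \<pi> (i, 0)" "\<lambda>j. Uset n \<pi> (0, j)" "inv_into (Ufam n \<pi>) h"
    by (rule inverse)
  have cuts: "is_cut \<pi> k \<longleftrightarrow> is_cut \<mu> k" if k: "k \<le> n" for k
    using h_narrow(3)[OF _ k] i.h_narrow(3)[OF _ k] narrow_iff_cut[OF \<pi> k] narrow_iff_cut[OF \<mu> k] by blast
  then have S: "Seg n \<pi> = Seg n \<mu>" using Seg_eq_iff[OF \<pi> \<mu>] by blast
  have "(\<forall>x\<in>I. \<mu> x = \<pi> x) \<or> (\<forall>x\<in>I. \<mu> x = inv \<pi> x)" if I: "I \<in> Seg n \<pi>" for I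
  proof -
    obtain a b where ab: "a < b" "b \<le> n" "I = {Suc a..b}" "is_cut \<pi> a" "is_cut \<pi> b" "\<And>w. a < w \<Longrightarrow> w < b \<Longrightarrow> \<not> is_cut \<pi> w"
      using I unfolding Seg_iff[OF \<pi>] by blast
    have I': "I \<in> Seg n \<mu>" using I S by simp
    have "(\<forall>k\<in>{a..b}. h (Uset n \<pi> (k, 0)) = Uset n \<mu> (k, 0) \<and> h (Uset n \<pi> (0, k)) = Uset n \<mu> (0, k)) \<or>
      (\<forall>k\<in>{a..b}. h (Uset n \<pi> (k, 0)) = Uset n \<mu> (0, k) \<and> h (Uset n \<pi> (0, k)) = Uset n \<mu> (k, 0))"
      using ab narrow_iff_cut[OF \<pi>] by (intro segment_straight_or_crossed) auto
    then show ?thesis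
    proof
      assume "\<forall>k\<in>{a..b}. h (Uset n \<pi> (k, 0)) = Uset n \<mu> (k, 0) \<and> h (Uset n \<pi> (0, k)) = Uset n \<mu> (0, k)"
      then have "\<mu> x = \<pi> x" if "x \<in> I" for x
        using straight_perm_eq[of b a x] Seg_image(2)[OF \<pi> I that] Seg_image(2)[OF \<mu> I' that] that ab by auto
      then show ?thesis by blast
    next
      assume "\<forall>k\<in>{a..b}. h (Uset n \<pi> (k, 0)) = Uset n \<mu> (0, k) \<and> h (Uset n \<pi> (0, k)) = Uset n \<mu> (k, 0)"
      then have inv: "inv \<mu> x = \<pi> x" if "x \<in> I" for x
        using crossed_perm_eq[of b a x] Seg_image(2)[OF \<pi> I that] Seg_image(3)[OF \<mu> I' that] that ab by auto
      have "\<mu> x = inv \<pi> x" if x: "x \<in> I" for x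
      proof -
        have "\<pi> (\<mu> x) = x" using inv[OF Seg_image(2)[OF \<mu> I' x]] permutes_inverses(2)[OF \<mu>] by simp
        then show ?thesis using permutes_inverses(2)[OF \<pi>] by metis
      qed
      then show ?thesis by blast
    qed
  qed
  then show ?thesis unfolding rho_ie_iff using \<pi> \<mu> S by blast
qed

end

section \<open>From \<open>rho_ie\<close> back to an isomorphism\<close>

lemma Seg_disjoint:
  assumes \<pi>: "\<pi> permutes {1..n}" and "I \<in> Seg n \<pi>" "J \<in> Seg n \<pi>" "k \<in> I" "k \<in> J" shows "I = J"
proof -
  obtain a b where ab: "I = {Suc a..b}" "is_cut \<pi> a" "is_cut \<pi> b" "\<And>w. a < w \<Longrightarrow> w < b \<Longrightarrow> \<not> is_cut \<pi> w"
    using assms(2) unfolding Seg_iff[OF \<pi>] by blast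
  obtain a' b' where J: "J = {Suc a'..b'}" "is_cut \<pi> a'" "is_cut \<pi> b'" "\<And>w. a' < w \<Longrightarrow> w < b' \<Longrightarrow> \<not> is_cut \<pi> w"
    using assms(3) unfolding Seg_iff[OF \<pi>] by blast
  have k: "a < k" "k \<le> b" "a' < k" "k \<le> b'" using assms(4,5) ab J by auto
  have "a = a'" using ab(2) J(2) ab(4)[of a'] J(4)[of a] k by linarith
  moreover have "b = b'" using ab(3) J(3) ab(4)[of b'] J(4)[of b] k by linarith
  ultimately show ?thesis using ab J by simp
qed

text \<open>The relabelling \<open>\<tau>\<close> applies \<open>\<pi>\<close> on exactly those segments on which \<open>\<mu>\<close> inverts \<open>\<pi>\<close>.\<close>
lemma rho_ie_relabel:
  assumes "(\<pi>, \<mu>) \<in> rho_ie n"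
  obtains \<tau> where "inj_on \<tau> {1..n}" "Ufam n \<mu> \<subseteq> image \<tau> ` Ufam n \<pi>"
proof -
  have \<pi>: "\<pi> permutes {1..n}" and \<mu>: "\<mu> permutes {1..n}"
    and I: "\<And>I. I \<in> Seg n \<pi> \<Longrightarrow> (\<forall>x\<in>I. \<mu> x = \<pi> x) \<or> (\<forall>x\<in>I. \<mu> x = inv \<pi> x)"
    using assms unfolding rho_ie_iff by auto
  interpret f: grid_family n "Ufam n \<pi>" "\<lambda>i. Uset n \<pi> (i, 0)" "\<lambda>j. Uset n \<pi> (0, j)"
    by (rule grid_family_Ufam[OF \<pi>])
  interpret f': grid_family n "Ufam n \<mu>" "\<lambda>i. Uset n \<mu> (i, 0)" "\<lambda>j. Uset n \<mu> (0, j)"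
    by (rule grid_family_Ufam[OF \<mu>])
  define sw where "sw k \<longleftrightarrow> (\<exists>I\<in>Seg n \<pi>. k \<in> I \<and> (\<forall>x\<in>I. \<mu> x = inv \<pi> x))" for k
  define \<tau> where "\<tau> m = (if sw m then \<pi> m else m)" for m
  have sw_const: "sw k \<longleftrightarrow> sw l" if "I \<in> Seg n \<pi>" "k \<in> I" "l \<in> I" for I k l
    unfolding sw_def using Seg_disjoint[OF \<pi>] that by blast
  have seg: "\<exists>a b. a < k \<and> k \<le> b \<and> {Suc a..b} \<in> Seg n \<pi>" if "k \<in> {1..n}" for k
    using ex_segment[OF \<pi> that] by metis
  have \<tau>_seg: "\<tau> m \<in> I" if "I \<in> Seg n \<pi>" "m \<in> I" for I m
    using that Seg_image(2)[OF \<pi>] by (simp add: \<tau>_def)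
  have sub: "I \<subseteq> {1..n}" if "I \<in> Seg n \<pi>" for I using that unfolding Seg_iff[OF \<pi>] by auto
  \<comment> \<open>The pair formed by \<open>\<tau> m\<close> and \<open>\<mu> (\<tau> m)\<close>
    is (m, \<open>\<pi> m\<close>) where the permutations agree and (\<open>\<pi> m\<close>, m) on
    the inverted segments: relabelling exchanges the two coordinates of an index exactly
    there.\<close>
  have \<mu>\<tau>: "\<mu> (\<tau> m) = (if sw m then m else \<pi> m)" if m: "m \<in> {1..n}" for m
  proof -
    obtain a b where "a < m" "m \<le> b" "{Suc a..b} \<in> Seg n \<pi>" using seg[OF m] by blast
    then obtain J where J: "J \<in> Seg n \<pi>" "m \<in> J" by (metis Suc_leI atLeastAtMost_iff)
    show ?thesis
    proof (cases "sw m")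
      case True
      then have "\<forall>x\<in>J. \<mu> x = inv \<pi> x" using J Seg_disjoint[OF \<pi>] unfolding sw_def by blast
      then show ?thesis using True \<tau>_seg[OF J] permutes_inverses(2)[OF \<pi>] by (simp add: \<tau>_def)
    next
      case False
      then have "\<forall>x\<in>J. \<mu> x = \<pi> x" using I[OF J(1)] J unfolding sw_def by blast
      then show ?thesis using False J by (simp add: \<tau>_def)
    qed
  qed
  have \<tau>_in: "\<tau> m \<in> {1..n}" if "m \<in> {1..n}" for m
    using that permutes_in_image[OF \<pi>, of m] by (simp add: \<tau>_def)
  have "inj_on \<tau> {1..n}"
  proof (rule inj_onI)
    fix m m' assume m: "m \<in> {1..n}" "m' \<in> {1..n}" "\<tau> m = \<tau> m'"
    obtain a b where "a < m" "m \<le> b" "{Suc a..b} \<in> Seg n \<pi>" using seg[OF m(1)] by blast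
    then obtain J where J: "J \<in> Seg n \<pi>" "m \<in> J" by (metis Suc_leI atLeastAtMost_iff)
    obtain a b where "a < m'" "m' \<le> b" "{Suc a..b} \<in> Seg n \<pi>" using seg[OF m(2)] by blast
    then obtain J' where J': "J' \<in> Seg n \<pi>" "m' \<in> J'" by (metis Suc_leI atLeastAtMost_iff)
    have "J = J'" using Seg_disjoint[OF \<pi> J(1) J'(1)] \<tau>_seg[OF J] \<tau>_seg[OF J'] m(3) by simp
    then have "sw m = sw m'" using sw_const J J' by blast
    then show "m = m'" using m(3) permutes_inj[OF \<pi>] by (auto simp: \<tau>_def split: if_splits dest: injD)
  qed
  then have \<tau>_surj: "\<tau> ` {1..n} = {1..n}"
    using \<tau>_in by (intro card_subset_eq) (auto simp: card_image)
  \<comment> \<open>If k lies in the segment of m, then \<open>sw k = sw m\<close>, and both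
    equivalences follow from the values of \<open>\<tau> m\<close> and
    \<open>\<mu> (\<tau> m)\<close>. Otherwise k is below or above the whole segment, which contains
    m and \<open>\<pi> m\<close>, so all comparisons have the same outcome. Hence each chain member
    of \<mu> at level k is the image of \<open>c k\<close> or \<open>d k\<close> of \<pi>, according
    to \<open>sw k\<close>.\<close>
  have cmp: "(if sw k then k < \<pi> m else k < m) \<longleftrightarrow> k < \<tau> m" "(if sw k then k < m else k < \<pi> m) \<longleftrightarrow> k < \<mu> (\<tau> m)"
    if k: "k \<in> {1..n}" and m: "m \<in> {1..n}" for k m
  proof -
    obtain a b where ab: "a < m" "m \<le> b" "{Suc a..b} \<in> Seg n \<pi>" using seg[OF m] by blast
    have r: "\<pi> m \<in> {Suc a..b}" "\<tau> m \<in> {Suc a..b}" using Seg_image(2)[OF \<pi> ab(3)] \<tau>_seg[OF ab(3)] ab by auto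
    have "sw k = sw m" if "k \<in> {Suc a..b}" using sw_const[OF ab(3) that, of m] ab by auto
    moreover have "k \<in> {Suc a..b} \<or> k \<le> a \<or> b < k" by auto
    ultimately show "(if sw k then k < \<pi> m else k < m) \<longleftrightarrow> k < \<tau> m"
      "(if sw k then k < m else k < \<pi> m) \<longleftrightarrow> k < \<mu> (\<tau> m)"
      using r ab \<mu>\<tau>[OF m] by (auto simp: \<tau>_def)
  qed
  have img: "\<tau> ` {m \<in> {1..n}. P (\<tau> m)} = {m \<in> {1..n}. P m}" for P
    using \<tau>_surj by (auto simp: set_eq_iff image_iff) (metis atLeastAtMost_iff)+
  have Uc: "Uset n \<pi> (k, 0) = {m \<in> {1..n}. k < m}" for k unfolding Uset_c[OF \<pi>] by auto
  have Ud: "Uset n \<pi> (0, k) = {m \<in> {1..n}. k < \<pi> m}" for k by (auto simp: Uset_def)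
  have "\<exists>X\<in>Ufam n \<pi>. Uset n \<mu> (k, 0) = \<tau> ` X" if k: "k \<le> n" for k
  proof (cases "k = 0")
    case True
    then show ?thesis using Uset_c[OF \<pi>, of 0] Uset_c[OF \<mu>, of 0] \<tau>_surj f.c_in[of 0] by (metis One_nat_def le0)
  next
    case False
    then have k1: "k \<in> {1..n}" using k by simp
    have "Uset n \<mu> (k, 0) = {m \<in> {1..n}. k < m}" unfolding Uset_c[OF \<mu>] by auto
    also have "\<dots> = \<tau> ` {m \<in> {1..n}. k < \<tau> m}" using img[of "\<lambda>m. k < m"] by simp
    also have "{m \<in> {1..n}. k < \<tau> m} = (if sw k then Uset n \<pi> (0, k) else Uset n \<pi> (k, 0))"
      unfolding Uc Ud using cmp(1)[OF k1] by (cases "sw k") auto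
    finally show ?thesis using f.c_in[OF k] f.d_in[OF k] by metis
  qed
  moreover have "\<exists>X\<in>Ufam n \<pi>. Uset n \<mu> (0, k) = \<tau> ` X" if k: "k \<le> n" for k
  proof (cases "k = 0")
    case True
    then show ?thesis using Uset_c[OF \<pi>, of 0] Uset_c[OF \<mu>, of 0] \<tau>_surj f.c_in[of 0] by (metis One_nat_def le0)
  next
    case False
    then have k1: "k \<in> {1..n}" using k by simp
    have "Uset n \<mu> (0, k) = {m \<in> {1..n}. k < \<mu> m}" by (auto simp: Uset_def)
    also have "\<dots> = \<tau> ` {m \<in> {1..n}. k < \<mu> (\<tau> m)}" using img[of "\<lambda>m. k < \<mu> m"] by simp
    also have "{m \<in> {1..n}. k < \<mu> (\<tau> m)} = (if sw k then Uset n \<pi> (k, 0) else Uset n \<pi> (0, k))"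
      unfolding Uc Ud using cmp(2)[OF k1] by (cases "sw k") auto
    finally show ?thesis using f.c_in[OF k] f.d_in[OF k] by metis
  qed
  moreover have "X \<subseteq> {1..n}" if "X \<in> Ufam n \<pi>" for X using that by (auto simp: Ufam_def Uset_def)
  moreover have "\<tau> ` X \<inter> \<tau> ` Y = \<tau> ` (X \<inter> Y)" if "X \<subseteq> {1..n}" "Y \<subseteq> {1..n}" for X Y
    using inj_on_image_Int[OF \<open>inj_on \<tau> {1..n}\<close> that] by simp
  ultimately have "Uset n \<mu> (k, 0) \<inter> Uset n \<mu> (0, l) \<in> image \<tau> ` Ufam n \<pi>" if "k \<le> n" "l \<le> n" for k l
    using that f.inter_closed by (metis imageI)
  then have "Ufam n \<mu> \<subseteq> image \<tau> ` Ufam n \<pi>" unfolding f'.F_eq by blast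
  then show thesis using that \<open>inj_on \<tau> {1..n}\<close> by blast
qed

text \<open>The relabelling yields only an inclusion of families. Symmetry of \<open>rho_ie\<close>
  gives the reverse comparison of cardinalities, and finiteness makes the inclusion an
  equality.\<close>

lemma rho_ie_imp_iso:
  assumes "(\<pi>, \<mu>) \<in> rho_ie n"
  shows "\<exists>h. lat_iso (Ufam n \<pi>) (\<supseteq>) (Ufam n \<mu>) (\<supseteq>) h"
proof -
  have le: "card (Ufam n \<mu>) \<le> card (Ufam n \<pi>)" if rho: "(\<pi>, \<mu>) \<in> rho_ie n" for \<pi> \<mu>
  proof -
    have fin: "finite (Ufam n \<pi>)" by (simp add: Ufam_def grid_def)
    obtain \<tau> where "inj_on \<tau> {1..n}" "Ufam n \<mu> \<subseteq> image \<tau> ` Ufam n \<pi>"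
      by (rule rho_ie_relabel[OF rho])
    then have "card (Ufam n \<mu>) \<le> card (image \<tau> ` Ufam n \<pi>)" using fin by (intro card_mono) auto
    then show ?thesis using card_image_le[OF fin, of "image \<tau>"] by simp
  qed
  obtain \<tau> where \<tau>: "inj_on \<tau> {1..n}" "Ufam n \<mu> \<subseteq> image \<tau> ` Ufam n \<pi>"
    by (rule rho_ie_relabel[OF assms])
  have sub: "X \<subseteq> {1..n}" if "X \<in> Ufam n \<pi>" for X using that by (auto simp: Ufam_def Uset_def)
  have fin: "finite (Ufam n \<pi>)" by (simp add: Ufam_def grid_def)
  have "card (image \<tau> ` Ufam n \<pi>) \<le> card (Ufam n \<mu>)"
    using card_image_le[OF fin, of "image \<tau>"] le[OF rho_ie_sym[OF assms]] by simp
  then have "Ufam n \<mu> = image \<tau> ` Ufam n \<pi>" using \<tau>(2) fin by (intro card_seteq) auto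
  moreover have "\<tau> ` X \<subseteq> \<tau> ` Y \<longleftrightarrow> X \<subseteq> Y" if "X \<in> Ufam n \<pi>" "Y \<in> Ufam n \<pi>" for X Y
    using inj_on_image_subset_iff[OF \<tau>(1)] sub that by blast
  ultimately have "lat_iso (Ufam n \<pi>) (\<supseteq>) (Ufam n \<mu>) (\<supseteq>) (image \<tau>)"
    unfolding lat_iso_def bij_betw_def inj_on_def by (metis subset_antisym order_refl)
  then show ?thesis by blast
qed

section \<open>Diagrams and permutations\<close>

lemma lat_iso_id: "lat_iso A le A le id"
  by (simp add: lat_iso_def)

lemma bsimI:
  assumes "lat_iso A le B le' f" "left_boundary A le p C" "right_boundary A le p D"
    "left_boundary B le' p' (f ` C)" "right_boundary B le' p' (f ` D)"
  shows "bsim A le p B le' p'"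
  unfolding bsim_def using assms by (intro exI conjI) (assumption | rule HOL.refl)+

text \<open>A representation by \<open>Ufam\<close> that takes the boundary chains to the two
  coordinate chains. Through it, comparing diagrams becomes comparing families with their
  chains.\<close>

definition diag_rep :: "'a set \<Rightarrow> ('a \<Rightarrow> 'a \<Rightarrow> bool) \<Rightarrow> ('a \<Rightarrow> real \<times> real) \<Rightarrow> nat \<Rightarrow> (nat \<Rightarrow> nat) \<Rightarrow>
    ('a \<Rightarrow> nat set) \<Rightarrow> 'a set \<Rightarrow> 'a set \<Rightarrow> bool" where
  "diag_rep A le p n \<pi> g C D \<longleftrightarrow> left_boundary A le p C \<and> right_boundary A le p D \<and> \<pi> permutes {1..n} \<and>
     lat_iso A le (Ufam n \<pi>) (\<supseteq>) g \<and>
     g ` C = (\<lambda>i. Uset n \<pi> (i, 0)) ` {..n} \<and> g ` D = (\<lambda>i. Uset n \<pi> (0, i)) ` {..n}"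

text \<open>The boundary chains contain all join-irreducible elements, so the representation by two
  chains applies to them and delivers the permutation of the diagram at the same time.\<close>

lemma ex_diag_rep:
  assumes n: "n \<ge> 1" and A: "ssl A le" "lattice_length A le n" "planar_diagram A le p"
  shows "\<exists>\<pi> g C D. diag_rep A le p n \<pi> g C D \<and> perm_of_diagram A le p n \<pi>"
proof -
  interpret diagram A le p by (rule diagramI[OF A(3,2) n])
  obtain C where C: "left_boundary A le p C" using ex_left_boundary by blast
  obtain D where D: "right_boundary A le p D" using ex_right_boundary by blast
  have max: "maximal_chain A le C" "maximal_chain A le D"
    using C D by (simp_all add: left_boundary_def right_boundary_def)
  have J: "j \<in> C \<union> D" if "join_irr A le j" for j
    using slim_join_irr_boundary[OF _ C D that] A(1) by (simp add: ssl_def)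
  obtain c d \<pi> g where R: "enum_chain A le c n" "C = c ` {..n}" "enum_chain A le d n" "D = d ` {..n}"
    "\<pi> permutes {1..n}" "lat_iso A le (Ufam n \<pi>) (\<supseteq>) g"
    "\<And>i. i \<le> n \<Longrightarrow> g (c i) = Uset n \<pi> (i, 0)" "\<And>i. i \<le> n \<Longrightarrow> g (d i) = Uset n \<pi> (0, i)"
    "\<And>i. i \<in> {1..n} \<Longrightarrow> \<exists>!u. meet_irr A le u \<and> u \<noteq> ltop A le \<and> first_idx le C u = i"
    "\<And>u. meet_irr A le u \<Longrightarrow> u \<noteq> ltop A le \<Longrightarrow> \<pi> (first_idx le C u) = first_idx le D u"
    by (rule ssl_representation[OF A(1,2) max]) (erule J, rule that)
  have "g ` C = (\<lambda>i. Uset n \<pi> (i, 0)) ` {..n}" "g ` D = (\<lambda>i. Uset n \<pi> (0, i)) ` {..n}"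
    unfolding R(2,4) image_image using R(7,8) by (intro image_cong; simp)+
  then have "diag_rep A le p n \<pi> g C D" unfolding diag_rep_def using C D R(5,6) by blast
  moreover have "perm_of_diagram A le p n \<pi>" unfolding perm_of_diagram_def using C D R(5,9,10) by blast
  ultimately show ?thesis by blast
qed

text \<open>The boundary chains are existentially quantified in \<open>perm_of_diagram\<close>;
  their uniqueness is what makes the two permutations comparable.\<close>

lemma perm_of_diagram_unique:
  assumes "diagram A le p" "perm_of_diagram A le p n \<pi>" "perm_of_diagram A le p n \<mu>"
  shows "\<pi> = \<mu>"
proof
  interpret diagram A le p by (rule assms(1))
  obtain C D where CD: "\<pi> permutes {1..n}" "left_boundary A le p C" "right_boundary A le p D"
    "\<And>i. i \<in> {1..n} \<Longrightarrow> \<exists>!u. meet_irr A le u \<and> u \<noteq> ltop A le \<and> first_idx le C u = i"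
    "\<And>u. meet_irr A le u \<Longrightarrow> u \<noteq> ltop A le \<Longrightarrow> \<pi> (first_idx le C u) = first_idx le D u"
    using assms(2) unfolding perm_of_diagram_def by blast
  obtain C' D' where CD': "\<mu> permutes {1..n}" "left_boundary A le p C'" "right_boundary A le p D'"
    "\<And>u. meet_irr A le u \<Longrightarrow> u \<noteq> ltop A le \<Longrightarrow> \<mu> (first_idx le C' u) = first_idx le D' u"
    using assms(3) unfolding perm_of_diagram_def by blast
  have eq: "C' = C" "D' = D" using left_boundary_unique right_boundary_unique CD(2,3) CD'(2,3) by blast+
  fix i show "\<pi> i = \<mu> i"
  proof (cases "i \<in> {1..n}")
    case True
    then obtain u where "meet_irr A le u" "u \<noteq> ltop A le" "first_idx le C u = i" using CD(4) by blast
    then show ?thesis using CD(5) CD'(4) eq by metis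
  next
    case False
    then show ?thesis using permutes_not_in[OF CD(1)] permutes_not_in[OF CD'(1)] by metis
  qed
qed

lemma perm_of_diagram_diag_rep:
  assumes "n \<ge> 1" "ssl A le" "lattice_length A le n" "planar_diagram A le p" "perm_of_diagram A le p n \<pi>"
  obtains g C D where "diag_rep A le p n \<pi> g C D"
proof -
  obtain \<mu> g C D where R: "diag_rep A le p n \<mu> g C D" "perm_of_diagram A le p n \<mu>"
    using ex_diag_rep[OF assms(1-4)] by blast
  have "\<mu> = \<pi>" using perm_of_diagram_unique[OF diagramI[OF assms(4,3,1)] R(2) assms(5)] .
  then show thesis using that R(1) by blast
qed

text \<open>Conjugating f by the two representations gives an isomorphism of families that respects
  the chains, and such an isomorphism determines the permutation.\<close>

lemma diag_rep_iso_eq: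
  assumes R: "diag_rep A le p n \<pi> g C D" and R': "diag_rep B le' p' n \<mu> g' C' D'"
    and f: "lat_iso A le B le' f" "f ` C = C'" "f ` D = D'"
  shows "\<pi> = \<mu>"
proof -
  have g: "lat_iso A le (Ufam n \<pi>) (\<supseteq>) g" and g': "lat_iso B le' (Ufam n \<mu>) (\<supseteq>) g'"
    using R R' by (simp_all add: diag_rep_def)
  define h where "h = (g' \<circ> f) \<circ> inv_into A g"
  have h: "lat_iso (Ufam n \<pi>) (\<supseteq>) (Ufam n \<mu>) (\<supseteq>) h"
    unfolding h_def by (rule lat_iso_trans[OF lat_iso_sym[OF g] lat_iso_trans[OF f(1) g']])
  have "C \<subseteq> A" "D \<subseteq> A" using R
    by (auto simp: diag_rep_def left_boundary_def right_boundary_def maximal_chain_def is_chain_def)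
  then have "inv_into A g ` g ` C = C" "inv_into A g ` g ` D = D"
    using g by (simp_all add: lat_iso_def bij_betw_def inv_into_image_cancel)
  then have "h ` g ` C = g' ` C'" "h ` g ` D = g' ` D'" unfolding h_def using f by (metis image_comp)+
  then show ?thesis using R R' by (intro iso_chains_imp_eq[OF _ _ h]) (simp_all add: diag_rep_def)
qed

lemma isomorphic_imp_rho_ie:
  assumes "\<pi> permutes {1..n}" "\<mu> permutes {1..n}"
    and "lat_iso A le (Ufam n \<pi>) (\<supseteq>) g" "lat_iso B le' (Ufam n \<mu>) (\<supseteq>) g'"
    and "lat_iso A le B le' f"
  shows "(\<pi>, \<mu>) \<in> rho_ie n"
  using iso_imp_rho_ie[OF assms(1,2) lat_iso_trans[OF lat_iso_sym[OF assms(3)] lat_iso_trans[OF assms(5,4)]]] .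

context
  fixes n :: nat and \<pi> :: "nat \<Rightarrow> nat"
  assumes n: "n \<ge> 1" and \<pi>: "\<pi> permutes {1..n}"
begin

interpretation q: grid_rep n "Ufam n \<pi>" "\<lambda>i. Uset n \<pi> (i, 0)" "\<lambda>j. Uset n \<pi> (0, j)"
    "quot_carrier n \<pi>" "quot_le n \<pi>" "Uclass n \<pi>"
  using grid_family_Ufam[OF \<pi>] quot_iso_Ufam[OF \<pi>] by (simp add: grid_rep_def grid_rep_axioms_def)

interpretation q': grid_rep n "Ufam n \<pi>" "\<lambda>j. Uset n \<pi> (0, j)" "\<lambda>i. Uset n \<pi> (i, 0)"
    "quot_carrier n \<pi>" "quot_le n \<pi>" "Uclass n \<pi>"
  by (rule q.rep_swap)

lemma quot_ssl: "ssl (quot_carrier n \<pi>) (quot_le n \<pi>)" by (rule q.rep_ssl)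

lemma quot_length: "lattice_length (quot_carrier n \<pi>) (quot_le n \<pi>) n" by (rule q.rep_lattice_length)

lemma quot_class_in: "x \<in> grid n \<Longrightarrow> beta n \<pi> `` {x} \<in> quot_carrier n \<pi>"
  by (auto simp: quot_carrier_def quotient_def)

lemma left_chain_eq: "left_chain_G n \<pi> = (\<lambda>i. beta n \<pi> `` {(i, 0)}) ` {..n}"
  by (auto simp: left_chain_G_def)

lemma right_chain_eq: "right_chain_G n \<pi> = (\<lambda>i. beta n \<pi> `` {(0, i)}) ` {..n}"
  by (auto simp: right_chain_G_def)

lemma Uclass_c: "i \<le> n \<Longrightarrow> Uclass n \<pi> (beta n \<pi> `` {(i, 0)}) = Uset n \<pi> (i, 0)"
  and Uclass_d: "i \<le> n \<Longrightarrow> Uclass n \<pi> (beta n \<pi> `` {(0, i)}) = Uset n \<pi> (0, i)"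
  by (rule Uclass_beta[OF \<pi>]; simp add: grid_def)+

lemma Uclass_left_chain: "Uclass n \<pi> ` left_chain_G n \<pi> = (\<lambda>i. Uset n \<pi> (i, 0)) ` {..n}"
  unfolding left_chain_eq image_image by (rule image_cong[OF HOL.refl]) (rule Uclass_c, simp)

lemma Uclass_right_chain: "Uclass n \<pi> ` right_chain_G n \<pi> = (\<lambda>i. Uset n \<pi> (0, i)) ` {..n}"
  unfolding right_chain_eq image_image by (rule image_cong[OF HOL.refl]) (rule Uclass_d, simp)

lemma left_chain_maximal: "maximal_chain (quot_carrier n \<pi>) (quot_le n \<pi>) (left_chain_G n \<pi>)"
  unfolding left_chain_eq
  by (rule q.enum_chain_maximal[OF q.rep_enum_chain]) (auto intro: quot_class_in simp: Uclass_c grid_def)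

lemma right_chain_maximal: "maximal_chain (quot_carrier n \<pi>) (quot_le n \<pi>) (right_chain_G n \<pi>)"
  unfolding right_chain_eq
  by (rule q.enum_chain_maximal[OF q'.rep_enum_chain]) (auto intro: quot_class_in simp: Uclass_d grid_def)

lemma quot_join_irr:
  assumes "join_irr (quot_carrier n \<pi>) (quot_le n \<pi>) X"
  shows "X \<in> left_chain_G n \<pi> \<union> right_chain_G n \<pi>"
proof -
  have X: "X \<in> quot_carrier n \<pi>" using assms by (simp add: join_irr_def)
  obtain i where i: "i \<le> n" "Uclass n \<pi> X = Uset n \<pi> (i, 0) \<or> Uclass n \<pi> X = Uset n \<pi> (0, i)"
    using q.rep_join_irr[OF assms] by blast
  have "(i, 0) \<in> grid n" "(0, i) \<in> grid n" using i by (simp_all add: grid_def)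
  then have "X = beta n \<pi> `` {(i, 0)} \<or> X = beta n \<pi> `` {(0, i)}"
    using i(2) q.g_eq[OF X quot_class_in] Uclass_c[OF i(1)] Uclass_d[OF i(1)] by metis
  then show ?thesis using i unfolding left_chain_eq right_chain_eq by blast
qed

lemma ex_phi0_diagram: "\<exists>p. phi0_diagram n \<pi> p"
  unfolding phi0_diagram_def
  using ex_planar_diagram[OF q.rep_fin_lattice quot_length n left_chain_maximal right_chain_maximal quot_join_irr] .

lemma phi0_diag_rep:
  assumes "phi0_diagram n \<pi> p"
  shows "diag_rep (quot_carrier n \<pi>) (quot_le n \<pi>) p n \<pi> (Uclass n \<pi>) (left_chain_G n \<pi>) (right_chain_G n \<pi>)"
  using assms \<pi> q.iso Uclass_left_chain Uclass_right_chain by (simp add: diag_rep_def phi0_diagram_def)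

lemma phi0_bsim:
  assumes "phi0_diagram n \<pi> p" "phi0_diagram n \<pi> p'"
  shows "bsim (quot_carrier n \<pi>) (quot_le n \<pi>) p (quot_carrier n \<pi>) (quot_le n \<pi>) p'"
  by (rule bsimI[OF lat_iso_id, of _ _ _ "left_chain_G n \<pi>" "right_chain_G n \<pi>"]) (use assms in \<open>simp_all add: phi0_diagram_def\<close>)

text \<open>The permutation supplied by \<open>ex_diag_rep\<close> comes with a representation of
  the same diagram; comparing it with the representation by \<open>Uclass\<close> along the identity
  map shows that it is \<pi>.\<close>

lemma phi0_perm:
  assumes p: "phi0_diagram n \<pi> p"
  shows "perm_of_diagram (quot_carrier n \<pi>) (quot_le n \<pi>) p n \<pi>"
proof -
  have planar: "planar_diagram (quot_carrier n \<pi>) (quot_le n \<pi>) p" using p by (simp add: phi0_diagram_def)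
  interpret diagram "quot_carrier n \<pi>" "quot_le n \<pi>" p by (rule diagramI[OF planar quot_length n])
  note R = phi0_diag_rep[OF p]
  obtain \<mu> g C D where R': "diag_rep (quot_carrier n \<pi>) (quot_le n \<pi>) p n \<mu> g C D"
    "perm_of_diagram (quot_carrier n \<pi>) (quot_le n \<pi>) p n \<mu>"
    using ex_diag_rep[OF n quot_ssl quot_length planar] by blast
  have "id ` left_chain_G n \<pi> = C" "id ` right_chain_G n \<pi> = D"
    using R R'(1) left_boundary_unique right_boundary_unique unfolding diag_rep_def by simp_all
  then have "\<pi> = \<mu>" by (rule diag_rep_iso_eq[OF R R'(1) lat_iso_id])
  then show ?thesis using R'(2) by simp
qed

text \<open>The lattice and the quotient are represented by the same family with the same two
  chains. One representation followed by the inverse of the other is therefore an isomorphism that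
  respects the boundaries.\<close>

lemma diag_rep_bsim_quot:
  assumes R: "diag_rep A le p n \<pi> g C D"
  shows "\<exists>p'. phi0_diagram n \<pi> p' \<and> bsim A le p (quot_carrier n \<pi>) (quot_le n \<pi>) p'"
    and "isomorphic A le (quot_carrier n \<pi>) (quot_le n \<pi>)"
proof -
  define f where "f = inv_into (quot_carrier n \<pi>) (Uclass n \<pi>) \<circ> g"
  have f: "lat_iso A le (quot_carrier n \<pi>) (quot_le n \<pi>) f"
    unfolding f_def using R by (intro lat_iso_trans[OF _ lat_iso_sym[OF q.iso]]) (simp add: diag_rep_def)
  then show "isomorphic A le (quot_carrier n \<pi>) (quot_le n \<pi>)" by (auto simp: isomorphic_def)
  have "left_chain_G n \<pi> \<subseteq> quot_carrier n \<pi>" "right_chain_G n \<pi> \<subseteq> quot_carrier n \<pi>"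
    unfolding left_chain_eq right_chain_eq using quot_class_in by (auto simp: grid_def)
  then have "inv_into (quot_carrier n \<pi>) (Uclass n \<pi>) ` Uclass n \<pi> ` left_chain_G n \<pi> = left_chain_G n \<pi>"
    "inv_into (quot_carrier n \<pi>) (Uclass n \<pi>) ` Uclass n \<pi> ` right_chain_G n \<pi> = right_chain_G n \<pi>"
    using q.iso by (simp_all add: lat_iso_def bij_betw_def inv_into_image_cancel)
  then have "f ` C = left_chain_G n \<pi>" "f ` D = right_chain_G n \<pi>"
    unfolding f_def Uclass_left_chain Uclass_right_chain using R unfolding diag_rep_def by (metis image_comp)+
  moreover obtain p' where p': "phi0_diagram n \<pi> p'" using ex_phi0_diagram by blast
  ultimately have "bsim A le p (quot_carrier n \<pi>) (quot_le n \<pi>) p'"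
    using R by (intro bsimI[OF f, of _ C D]) (simp_all add: diag_rep_def phi0_diagram_def)
  then show "\<exists>p'. phi0_diagram n \<pi> p' \<and> bsim A le p (quot_carrier n \<pi>) (quot_le n \<pi>) p'" using p' by blast
qed

end

lemma rho_ie_isomorphic:
  assumes "(\<pi>, \<mu>) \<in> rho_ie n"
  shows "isomorphic (quot_carrier n \<pi>) (quot_le n \<pi>) (quot_carrier n \<mu>) (quot_le n \<mu>)"
proof -
  have "\<pi> permutes {1..n}" "\<mu> permutes {1..n}" using assms by (simp_all add: rho_ie_iff)
  moreover obtain h where "lat_iso (Ufam n \<pi>) (\<supseteq>) (Ufam n \<mu>) (\<supseteq>) h"
    using rho_ie_imp_iso[OF assms] by blast
  ultimately show ?thesis
    unfolding isomorphic_def using lat_iso_trans lat_iso_sym quot_iso_Ufam by metis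
qed

lemma ssl_has_planar_diagram:
  assumes "n \<ge> 1" "ssl A le" "lattice_length A le n"
  shows "\<exists>p. planar_diagram A le p"
proof -
  interpret finlat A le using assms(2) by unfold_locales (simp add: ssl_def)
  obtain C D where CD: "maximal_chain A le C" "maximal_chain A le D" "\<And>j. join_irr A le j \<Longrightarrow> j \<in> C \<union> D"
    using slim_two_chains assms(2) by (auto simp: ssl_def)
  then show ?thesis using ex_planar_diagram[OF fin_lattice assms(3,1) CD] by blast
qed

text \<open>The chains named by \<open>bsim\<close> and those of the two representations are
  boundaries of the same diagrams, so uniqueness identifies them and the isomorphism respects the
  represented chains.\<close>

lemma bsim_perm_eq:
  assumes n: "n \<ge> 1" and A: "ssl A le" "lattice_length A le n" "planar_diagram A le p"
    and B: "ssl B le'" "lattice_length B le' n" "planar_diagram B le' p'"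
    and sim: "bsim A le p B le' p'" and perm: "perm_of_diagram A le p n \<pi>" "perm_of_diagram B le' p' n \<mu>"
  shows "\<pi> = \<mu>"
proof -
  interpret a: diagram A le p by (rule diagramI[OF A(3,2) n])
  interpret b: diagram B le' p' by (rule diagramI[OF B(3,2) n])
  obtain g C D where R: "diag_rep A le p n \<pi> g C D" by (rule perm_of_diagram_diag_rep[OF n A perm(1)])
  obtain g' C' D' where R': "diag_rep B le' p' n \<mu> g' C' D'" by (rule perm_of_diagram_diag_rep[OF n B perm(2)])
  obtain f CL CR where f: "lat_iso A le B le' f" "left_boundary A le p CL" "right_boundary A le p CR"
      "left_boundary B le' p' (f ` CL)" "right_boundary B le' p' (f ` CR)"
    using sim unfolding bsim_def by auto
  have bd: "left_boundary A le p C" "right_boundary A le p D" "left_boundary B le' p' C'" "right_boundary B le' p' D'"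
    using R R' by (simp_all add: diag_rep_def)
  have "CL = C" "CR = D" "f ` CL = C'" "f ` CR = D'"
    by (rule a.left_boundary_unique[OF f(2) bd(1)] a.right_boundary_unique[OF f(3) bd(2)]
        b.left_boundary_unique[OF f(4) bd(3)] b.right_boundary_unique[OF f(5) bd(4)])+
  then show ?thesis by (intro diag_rep_iso_eq[OF R R' f(1)]) simp_all
qed

theorem theorem3p3:
  fixes n :: nat
  assumes "n \<ge> 1"
  shows
    \<comment> \<open>rho_ie is an equivalence relation on S_n (so that S_n/rho_ie makes sense)\<close>
    "equiv {\<pi>. \<pi> permutes {1..n}} (rho_ie n)
   \<comment> \<open>(1) G/beta_pi is an SSL of length n with a planar diagram phi_0(pi) having the
        prescribed boundary chains, unique up to boundary similarity\<close>
   \<and> (\<forall>\<pi>. \<pi> permutes {1..n} \<longrightarrow>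
        ssl (quot_carrier n \<pi>) (quot_le n \<pi>) \<and> lattice_length (quot_carrier n \<pi>) (quot_le n \<pi>) n \<and>
        (\<exists>p. phi0_diagram n \<pi> p) \<and>
        (\<forall>p p'. phi0_diagram n \<pi> p \<and> phi0_diagram n \<pi> p' \<longrightarrow>
            bsim (quot_carrier n \<pi>) (quot_le n \<pi>) p (quot_carrier n \<pi>) (quot_le n \<pi>) p'))
   \<comment> \<open>(2) psi_0 is well defined ...\<close>
   \<and> (\<forall>(A :: 'a set) le p. ssl A le \<and> lattice_length A le n \<and> planar_diagram A le p \<longrightarrow>
        (\<exists>!\<pi>. perm_of_diagram A le p n \<pi>))
   \<and> (\<forall>(A :: 'a set) le p (B :: 'b set) le' p' \<pi> \<pi>'.
        ssl A le \<and> lattice_length A le n \<and> planar_diagram A le p \<and>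
        ssl B le' \<and> lattice_length B le' n \<and> planar_diagram B le' p' \<and>
        bsim A le p B le' p' \<and> perm_of_diagram A le p n \<pi> \<and> perm_of_diagram B le' p' n \<pi>'
        \<longrightarrow> \<pi> = \<pi>')
   \<comment> \<open>... psi_0 (phi_0 pi) = pi ...\<close>
   \<and> (\<forall>\<pi> p. \<pi> permutes {1..n} \<and> phi0_diagram n \<pi> p \<longrightarrow>
        perm_of_diagram (quot_carrier n \<pi>) (quot_le n \<pi>) p n \<pi>)
   \<comment> \<open>... and phi_0 (psi_0 D) is boundarily similar to D\<close>
   \<and> (\<forall>(A :: 'a set) le p \<pi>. ssl A le \<and> lattice_length A le n \<and> planar_diagram A le p \<and>
        perm_of_diagram A le p n \<pi> \<longrightarrow>
        (\<exists>p'. phi0_diagram n \<pi> p' \<and> bsim A le p (quot_carrier n \<pi>) (quot_le n \<pi>) p'))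
   \<comment> \<open>(3) phi is well defined\<close>
   \<and> (\<forall>\<pi> \<mu>. (\<pi>, \<mu>) \<in> rho_ie n \<longrightarrow>
        isomorphic (quot_carrier n \<pi>) (quot_le n \<pi>) (quot_carrier n \<mu>) (quot_le n \<mu>))
   \<comment> \<open>psi is well defined: every member of S_n has a planar diagram, and the class of pi_D
        does not depend on the choice of the lattice within its isomorphism class or of D\<close>
   \<and> (\<forall>(A :: 'a set) le. ssl A le \<and> lattice_length A le n \<longrightarrow> (\<exists>p. planar_diagram A le p))
   \<and> (\<forall>(A :: 'a set) le p (B :: 'b set) le' p' \<pi> \<mu>.
        ssl A le \<and> lattice_length A le n \<and> planar_diagram A le p \<and>
        ssl B le' \<and> lattice_length B le' n \<and> planar_diagram B le' p' \<and>
        isomorphic A le B le' \<and> perm_of_diagram A le p n \<pi> \<and> perm_of_diagram B le' p' n \<mu>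
        \<longrightarrow> (\<pi>, \<mu>) \<in> rho_ie n)
   \<comment> \<open>psi (phi [pi]) = [pi]\<close>
   \<and> (\<forall>\<pi> p \<mu>. \<pi> permutes {1..n} \<and> planar_diagram (quot_carrier n \<pi>) (quot_le n \<pi>) p \<and>
        perm_of_diagram (quot_carrier n \<pi>) (quot_le n \<pi>) p n \<mu> \<longrightarrow> (\<pi>, \<mu>) \<in> rho_ie n)
   \<comment> \<open>phi (psi [L]) = [L]\<close>
   \<and> (\<forall>(A :: 'a set) le p \<pi>. ssl A le \<and> lattice_length A le n \<and> planar_diagram A le p \<and>
        perm_of_diagram A le p n \<pi> \<longrightarrow>
        isomorphic A le (quot_carrier n \<pi>) (quot_le n \<pi>))"
proof (intro conjI allI impI, goal_cases)
  case 1 show ?case by (rule equiv_rho_ie)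
next
  case (2 \<pi>) then show ?case by (rule quot_ssl[OF assms])
next
  case (3 \<pi>) then show ?case by (rule quot_length[OF assms])
next
  case (4 \<pi>) then show ?case by (rule ex_phi0_diagram[OF assms])
next
  case (5 \<pi> p p') then show ?case using phi0_bsim[OF assms] by blast
next
  case (6 A le p)
  then show ?case using ex_diag_rep[OF assms] perm_of_diagram_unique[OF diagramI[OF _ _ assms]] by metis
next
  case (7 A le p B le' p' \<pi> \<pi>') then show ?case using bsim_perm_eq[OF assms] by blast
next
  case (8 \<pi> p) then show ?case using phi0_perm[OF assms] by blast
next
  case (9 A le p \<pi>)
  then have A: "ssl A le" "lattice_length A le n" "planar_diagram A le p" "perm_of_diagram A le p n \<pi>" by blast+
  obtain g C D where "diag_rep A le p n \<pi> g C D" by (rule perm_of_diagram_diag_rep[OF assms A])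
  moreover have "\<pi> permutes {1..n}" using A(4) by (simp add: perm_of_diagram_def)
  ultimately show ?case using diag_rep_bsim_quot(1)[OF assms] by blast
next
  case (10 \<pi> \<mu>) then show ?case by (rule rho_ie_isomorphic)
next
  case (11 A le) then show ?case using ssl_has_planar_diagram[OF assms] by blast
next
  case (12 A le p B le' p' \<pi> \<mu>)
  then have A: "ssl A le" "lattice_length A le n" "planar_diagram A le p" "perm_of_diagram A le p n \<pi>"
    and B: "ssl B le'" "lattice_length B le' n" "planar_diagram B le' p'" "perm_of_diagram B le' p' n \<mu>"
    and iso: "isomorphic A le B le'" by blast+
  obtain g C D where R: "diag_rep A le p n \<pi> g C D" by (rule perm_of_diagram_diag_rep[OF assms A])
  obtain g' C' D' where R': "diag_rep B le' p' n \<mu> g' C' D'" by (rule perm_of_diagram_diag_rep[OF assms B])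
  obtain f where f: "lat_iso A le B le' f" using iso by (auto simp: isomorphic_def)
  show ?case
    by (rule isomorphic_imp_rho_ie[OF _ _ _ _ f, of _ _ _ g g']) (use R R' in \<open>simp_all add: diag_rep_def\<close>)
next
  case (13 \<pi> p \<mu>)
  then have \<pi>: "\<pi> permutes {1..n}" and p: "planar_diagram (quot_carrier n \<pi>) (quot_le n \<pi>) p"
    "perm_of_diagram (quot_carrier n \<pi>) (quot_le n \<pi>) p n \<mu>" by blast+
  obtain g C D where R: "diag_rep (quot_carrier n \<pi>) (quot_le n \<pi>) p n \<mu> g C D"
    by (rule perm_of_diagram_diag_rep[OF assms quot_ssl[OF assms \<pi>] quot_length[OF assms \<pi>] p])
  then have g: "\<mu> permutes {1..n}" "lat_iso (quot_carrier n \<pi>) (quot_le n \<pi>) (Ufam n \<mu>) (\<supseteq>) g"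
    by (simp_all add: diag_rep_def)
  show ?case by (rule isomorphic_imp_rho_ie[OF \<pi> g(1) quot_iso_Ufam[OF \<pi>] g(2) lat_iso_id])
next
  case (14 A le p \<pi>)
  then have A: "ssl A le" "lattice_length A le n" "planar_diagram A le p" "perm_of_diagram A le p n \<pi>" by blast+
  obtain g C D where "diag_rep A le p n \<pi> g C D" by (rule perm_of_diagram_diag_rep[OF assms A])
  moreover have "\<pi> permutes {1..n}" using A(4) by (simp add: perm_of_diagram_def)
  ultimately show ?case using diag_rep_bsim_quot(2)[OF assms] by blast
qed

end
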